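(* Let $\mathcal{S}\subseteq\mathbb{A}_k^q$ be constructible, $U=\mathfrak{m}^l\cdot\mathcal{C}^m$, and let $f_{\mathcal{S}}\colon\mathcal{S}\times U\to\mathcal{C}^p$ be a regular family of textile maps over $\mathcal{S}$. Write $f_{\mathcal{S}}=\ell_{\mathcal{S}}+h_{\mathcal{S}}$ with $\ell_{\mathcal{S}}:=T_0f_{\mathcal{S}}$. Assume $f_{\mathcal{S}}(-,0)=0$ and that the following conditions hold: (i) the linear family $\ell_{\mathcal{S}}$ admits a scission $\sigma_{\mathcal{S}}$ such that $\sigma_{\mathcal{S}}h_{\mathcal{S}}$ is contractive; (ii) the family $f_{\mathcal{S}}$ is of constant rank at $0$ with respect to a direct complement $J$ of $\mathrm{im}(T_0f_{\mathcal{S}})$ (that is, of $\mathrm{im}(T_0 f_s)$ for every $s\in\mathcal{S}$). Then there exist regular (locally) invertible families $u_{\mathcal{S}}$ and $v_{\mathcal{S}}$ with $$v_{\mathcal{S}}\,f_{\mathcal{S}}\,u_{\mathcal{S}}^{-1}=\ell_{\mathcal{S}}.$$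
   Context: Let $k$ be a field of characteristic $0$, $n\ge1$. $\mathcal{C}$ is the space of cords $(c_\alpha)_{\alpha\in\mathbb{N}^n}$ in $k$ ($\mathbb N\ni 0$), identified with $k[[x_1,\dots,x_n]]$, with maximal ideal $\mathfrak{m}$; $\mathrm{ord}$ of an element of $\mathcal{C}^m$ is the minimum of the orders of its components. $\mathcal{C}^m$ carries the $\mathfrak{m}$-adic topology (basic $0$-neighbourhoods $\mathfrak{m}^l\cdot\mathcal{C}^m$). Textile maps: a map $\mathcal{C}^m\to\mathcal{C}^p$ is textile if every coefficient of the image of $c$ is a polynomial over $k$ in finitely many coefficients of $c$; on subsets: restrictions of such maps. Regular families: for $Y\subseteq\mathcal{C}^m$ a map $\mathcal{S}\times Y\to k$ is a regular $k$-valued family if it is the restriction of a function $g\colon Z\times Y\to k$, with $Z\subseteq\mathbb{A}_k^q$ a subvariety containing $\mathcal{S}$, that is locally (in the Zariski topology) a quotient of two polynomials in the coordinates $s_1,\dots,s_q$ and the coefficients of the cord variable, the denominator being locally nonvanishing. A regular family of textile maps over $\mathcal{S}$ on $Y$ is a map $f_{\mathcal{S}}\colon\mathcal{S}\times Y\to\mathcal{C}^p$ all of whose coefficients are regular $k$-valued families; $f_s:=f_{\mathcal{S}}(s,-)$. It is linear if every $f_s$ is linear. Composition is pointwise in $s$: $(f_{\mathcal{S}}\circ g_{\mathcal{S}})_s=f_s\circ g_s$; $\mathrm{id}_{\mathcal{S}}$ is the family with all members the identity. A regular family is invertible if there is a regular family $g_{\mathcal{S}}$ with $f_{\mathcal{S}}\circ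 g_{\mathcal{S}}=\mathrm{id}_{\mathcal{S}}$; "(locally)" means on suitable $\mathfrak{m}$-adic neighbourhoods of $0$ in the cord variable. $f_{\mathcal{S}}$ is contractive on $U$ if for all $s\in\mathcal{S}$ and $a\ne b$ in $U$: $\mathrm{ord}(f_s(a)-f_s(b))>\mathrm{ord}(a-b)$. Tangent maps: $T_af_s\cdot v=\frac1t(f_s(a+tv)-f_s(a))|_{t=0}$ (formal directional derivative in the cord variable), a linear map $U\to\mathcal{C}^p$; $T_0f_{\mathcal{S}}$ is the family of the $T_0f_s$. Scission of a regular linear family $\ell_{\mathcal{S}}\colon\mathcal{S}\times U\to\mathcal{C}^p$: a regular linear family $\sigma_{\mathcal{S}}$ from $\mathcal{C}^p$ to $U\subseteq \mathcal C^m$ over $\mathcal{S}$ with $\ell_{\mathcal{S}}\sigma_{\mathcal{S}}\ell_{\mathcal{S}}=\ell_{\mathcal{S}}$. Curves: a curve in a subset $M\subseteq\mathcal{C}^r$ is a textile map $V\to\mathcal{C}^r$ with image in $M$, $V$ an $\mathfrak{m}$-adic neighbourhood of $0$ in $\mathcal{C}$. Constant rank of $f_s$ at $0$ with respect to $J$, where $\mathcal{C}^p=\mathrm{im}(T_0f_s)\oplus J$ as topological vector spaces: for all curves $\gamma$ in $U$ with $\gamma(0)=0$ and all curves $\eta$ in $\mathcal{C}^p$ (over the same $V$) there are curves $\rho$ in $U$ and $\tau$ in $J$ with $\eta=T_\gamma f_s\cdot\rho+\tau$ (where $T_\gamma f_s\cdot\rho$ is $t\mapsto T_{\gamma(t)}f_s\cdot\rho(t)$),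 and this decomposition of $\eta$ is unique. The family $f_{\mathcal{S}}$ is of constant rank at $0$ with respect to $J$ if $J$ is a direct complement of $\mathrm{im}(T_0f_s)$ for all $s\in\mathcal{S}$ and every $f_s$ is of constant rank at $0$ with respect to $J$. *)

theory Defs
  imports
    "HOL-Analysis.Analysis"
    "HOL-Computational_Algebra.Polynomial"
    "HOL-Library.Poly_Mapping"
    "HOL-Library.Function_Algebras"
    "HOL-Library.Extended_Nat"
begin

section \<open>Cords\<close>

text \<open>
  A cord is a family of coefficients indexed by the exponents of the monomials in the variables
  \<open>x\<^sub>i\<close>, \<open>i :: 'n\<close>.  Zero, addition and subtraction of cords and of vectors of cords are the
  pointwise operations on functions; the ring product is \<open>cord_mult\<close>.  Pitfall: the symbols
  \<open>*\<close> and \<open>1\<close> on cords would be pointwise as well and are never used.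
\<close>

type_synonym ('n, 'k) cord = "('n \<Rightarrow> nat) \<Rightarrow> 'k"

type_synonym ('m, 'n, 'k) cords = "'m \<Rightarrow> ('n, 'k) cord"

definition cord_mult ::
    "('n::finite, 'k::comm_ring_1) cord \<Rightarrow> ('n, 'k) cord \<Rightarrow> ('n, 'k) cord" where
  "cord_mult c d = (\<lambda>\<gamma>. \<Sum>(\<alpha>, \<beta>) \<in> {(\<alpha>, \<beta>). \<alpha> + \<beta> = \<gamma>}. c \<alpha> * d \<beta>)"

definition cord_smult ::
    "('n::finite, 'k::comm_ring_1) cord \<Rightarrow> ('m, 'n, 'k) cords \<Rightarrow> ('m, 'n, 'k) cords" where
  "cord_smult a v = (\<lambda>i. cord_mult a (v i))"

definition cscale :: "'k::comm_ring_1 \<Rightarrow> ('m, 'n, 'k) cords \<Rightarrow> ('m, 'n, 'k) cords" where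
  "cscale t v = (\<lambda>i \<alpha>. t * v i \<alpha>)"

interpretation cvec: vector_space "cscale :: 'k::field \<Rightarrow> ('m, 'n, 'k) cords \<Rightarrow> ('m, 'n, 'k) cords"
  by unfold_locales (auto simp: cscale_def fun_eq_iff algebra_simps)

definition linear_on_cords ::
    "('m, 'n, 'k::field) cords set \<Rightarrow> (('m, 'n, 'k) cords \<Rightarrow> ('p, 'n, 'k) cords) \<Rightarrow> bool" where
  "linear_on_cords Y F \<longleftrightarrow>
     (\<forall>a\<in>Y. \<forall>b\<in>Y. F (a + b) = F a + F b) \<and> (\<forall>t. \<forall>a\<in>Y. F (cscale t a) = cscale t (F a))"

definition cord_ord :: "('n::finite, 'k::zero) cord \<Rightarrow> enat" where
  "cord_ord c = (INF \<alpha>\<in>{\<alpha>. c \<alpha> \<noteq> 0}. enat (\<Sum>i\<in>UNIV. \<alpha> i))"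

definition cords_ord :: "('m::finite, 'n::finite, 'k::zero) cords \<Rightarrow> enat" where
  "cords_ord v = (INF i. cord_ord (v i))"

definition max_ideal :: "('n::finite, 'k::comm_ring_1) cord set" where
  "max_ideal = {c. c (\<lambda>_. 0) = 0}"

definition ideal_smult ::
    "('n::finite, 'k::comm_ring_1) cord set \<Rightarrow> ('m, 'n, 'k) cords set \<Rightarrow> ('m, 'n, 'k) cords set" where
  "ideal_smult I M =
     {\<Sum>i<N. cord_smult (a i) (v i) | (N::nat) a v. \<forall>i<N. a i \<in> I \<and> v i \<in> M}"

text \<open>\<open>madic l\<close> is the submodule \<open>\<mm>\<^sup>l \<cdot> \<C>\<^sup>m\<close>.\<close>

primrec madic :: "nat \<Rightarrow> ('m, 'n::finite, 'k::comm_ring_1) cords set" where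
  "madic 0 = UNIV"
| "madic (Suc l) = ideal_smult max_ideal (madic l)"

lemma ideal_smult_mono: "M \<subseteq> M' \<Longrightarrow> ideal_smult I M \<subseteq> ideal_smult I M'"
  unfolding ideal_smult_def by blast

lemma madic_Suc_subset:
  "madic (Suc l) \<subseteq> (madic l :: ('m, 'n::finite, 'k::comm_ring_1) cords set)"
proof (induction l)
  case (Suc l)
  show ?case
    using ideal_smult_mono[OF Suc, of max_ideal] by (simp only: madic.simps)
qed simp

lemma madic_antimono:
  "k \<le> l \<Longrightarrow> madic l \<subseteq> (madic k :: ('m, 'n::finite, 'k::comm_ring_1) cords set)"
  using lift_Suc_antimono_le[of "madic :: nat \<Rightarrow> ('m, 'n, 'k) cords set"] madic_Suc_subset
  by blast

lemma enat_le_cord_ord_iff: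
  "enat l \<le> cord_ord c \<longleftrightarrow> (\<forall>\<alpha>. (\<Sum>i\<in>UNIV. \<alpha> i) < l \<longrightarrow> c \<alpha> = 0)"
  unfolding cord_ord_def by (auto simp: le_INF_iff not_less)

lemma enat_le_cords_ord_iff:
  "enat l \<le> cords_ord v \<longleftrightarrow> (\<forall>i \<alpha>. (\<Sum>i\<in>UNIV. \<alpha> i) < l \<longrightarrow> v i \<alpha> = 0)"
  unfolding cords_ord_def by (auto simp: le_INF_iff enat_le_cord_ord_iff)

lemma finite_exponent_splits: "finite {(\<alpha>, \<beta>). \<alpha> + \<beta> = (\<gamma> :: 'n::finite \<Rightarrow> nat)}"
proof -
  have "finite (UNIV \<rightarrow>\<^sub>E {..Max (range \<gamma>)} :: ('n \<Rightarrow> nat) set)"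
    by (intro finite_PiE) auto
  moreover have "{(\<alpha>, \<beta>). \<alpha> + \<beta> = \<gamma>} \<subseteq>
      (UNIV \<rightarrow>\<^sub>E {..Max (range \<gamma>)}) \<times> (UNIV \<rightarrow>\<^sub>E {..Max (range \<gamma>)})"
  proof
    fix z assume "z \<in> {(\<alpha>, \<beta>). \<alpha> + \<beta> = \<gamma>}"
    then obtain \<alpha> \<beta> where z: "z = (\<alpha>, \<beta>)" and \<gamma>: "\<And>i. \<gamma> i = \<alpha> i + \<beta> i"
      by auto
    have "\<gamma> i \<le> Max (range \<gamma>)" for i
      by (rule Max_ge) auto
    then have "\<alpha> i \<le> Max (range \<gamma>)" "\<beta> i \<le> Max (range \<gamma>)" for i
      by (metis add_leD1 \<gamma>, metis add_leD2 \<gamma>)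
    then show "z \<in> (UNIV \<rightarrow>\<^sub>E {..Max (range \<gamma>)}) \<times> (UNIV \<rightarrow>\<^sub>E {..Max (range \<gamma>)})"
      unfolding z by auto
  qed
  ultimately show ?thesis
    by (meson finite_SigmaI finite_subset)
qed

lemma sum_fun_apply2: "(\<Sum>i\<in>I. f i) j \<alpha> = (\<Sum>i\<in>I. f i j \<alpha>)"
  by (induction I rule: infinite_finite_induct) auto

lemma mem_madic_iff: "v \<in> madic l \<longleftrightarrow> enat l \<le> cords_ord v"
  for v :: "('m::finite, 'n::finite, 'k::comm_ring_1) cords"
proof (induction l arbitrary: v)
  case (Suc l)
  show ?case
  proof
    assume "v \<in> madic (Suc l)"
    then obtain N :: nat and a w where v: "v = (\<Sum>i<N. cord_smult (a i) (w i))"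
      and a: "\<And>i. i < N \<Longrightarrow> a i \<in> max_ideal" and w: "\<And>i. i < N \<Longrightarrow> enat l \<le> cords_ord (w i)"
      using Suc by (auto simp: ideal_smult_def)
    have "cord_mult (a i) (w i j) \<gamma> = 0" if i: "i < N" and \<gamma>: "(\<Sum>i\<in>UNIV. \<gamma> i) < Suc l" for i j \<gamma>
      unfolding cord_mult_def
    proof (rule sum.neutral, clarsimp)
      fix \<alpha> \<beta> :: "'n \<Rightarrow> nat" assume "\<gamma> = \<alpha> + \<beta>"
      then have *: "(\<Sum>i\<in>UNIV. \<alpha> i) + (\<Sum>i\<in>UNIV. \<beta> i) < Suc l"
        using \<gamma> by (simp add: sum.distrib)
      show "a i \<alpha> * w i j \<beta> = 0"
      proof (cases "\<alpha> = (\<lambda>_. 0)")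
        case True
        then show ?thesis
          using a[OF i] by (simp add: max_ideal_def)
      next
        case False
        then have "(\<Sum>i\<in>UNIV. \<alpha> i) > 0"
          by (auto simp: fun_eq_iff intro: gr0I)
        then show ?thesis
          using * w[OF i] by (simp add: enat_le_cords_ord_iff)
      qed
    qed
    then show "enat (Suc l) \<le> cords_ord v"
      unfolding enat_le_cords_ord_iff v by (simp add: sum_fun_apply2 cord_smult_def)
  next
    assume v: "enat (Suc l) \<le> cords_ord v"
    obtain e :: "nat \<Rightarrow> 'n" where e: "bij_betw e {..<CARD('n)} UNIV"
      using ex_bij_betw_nat_finite[of "UNIV :: 'n set"] by (auto simp: atLeast0LessThan)
    define \<delta> :: "'n \<Rightarrow> 'n \<Rightarrow> nat" where "\<delta> = (\<lambda>i j. if j = i then 1 else 0)"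
    define p :: "('n \<Rightarrow> nat) \<Rightarrow> 'n" where "p = (\<lambda>\<gamma>. SOME i. \<gamma> i > 0)"
    define a :: "'n \<Rightarrow> ('n, 'k) cord" where "a = (\<lambda>i \<alpha>. if \<alpha> = \<delta> i then 1 else 0)"
    define w :: "'n \<Rightarrow> ('m, 'n, 'k) cords" where
      "w = (\<lambda>i j \<beta>. if p (\<delta> i + \<beta>) = i then v j (\<delta> i + \<beta>) else 0)"
    have sum\<delta>: "(\<Sum>k\<in>UNIV. \<delta> i k) = 1" for i
      by (simp add: \<delta>_def)
    have "\<delta> i \<noteq> (\<lambda>_. 0)" for i
      by (simp add: \<delta>_def fun_eq_iff)
    then have a: "a i \<in> max_ideal" for i
      unfolding max_ideal_def a_def by (metis (mono_tags, lifting) mem_Collect_eq)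
    have w: "w i \<in> madic l" for i
      unfolding Suc enat_le_cords_ord_iff w_def using v sum\<delta>
      by (auto simp: enat_le_cords_ord_iff sum.distrib)
    have mult: "cord_mult (a i) (w i j) \<gamma> = (if \<gamma> i > 0 \<and> p \<gamma> = i then v j \<gamma> else 0)" for i j \<gamma>
    proof (cases "\<gamma> i > 0")
      case True
      have \<gamma>: "\<delta> i + (\<gamma> - \<delta> i) = \<gamma>"
        using True by (auto simp: fun_eq_iff \<delta>_def)
      have "cord_mult (a i) (w i j) \<gamma> =
          (\<Sum>(\<alpha>, \<beta>) \<in> {(\<delta> i, \<gamma> - \<delta> i)}. a i \<alpha> * w i j \<beta>)"
        unfolding cord_mult_def
        by (rule sum.mono_neutral_right[OF finite_exponent_splits])
           (use \<gamma> in \<open>auto simp: a_def split: if_splits\<close>)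
      then show ?thesis
        using True \<gamma> by (simp add: a_def w_def)
    next
      case False
      have "cord_mult (a i) (w i j) \<gamma> = 0"
        unfolding cord_mult_def
        by (rule sum.neutral) (use False in \<open>auto simp: a_def \<delta>_def\<close>)
      then show ?thesis
        using False by simp
    qed
    have "v j \<gamma> = (\<Sum>i\<in>UNIV. cord_mult (a i) (w i j) \<gamma>)" for j \<gamma>
    proof (cases "\<gamma> = (\<lambda>_. 0)")
      case True
      then show ?thesis
        using v by (simp add: mult enat_le_cords_ord_iff)
    next
      case False
      then have "\<exists>i. \<gamma> i > 0"
        by auto
      then have "\<gamma> (p \<gamma>) > 0"
        unfolding p_def by (rule someI_ex)
      then have "(\<gamma> i > 0 \<and> p \<gamma> = i) = (i = p \<gamma>)" for i
        by auto
      then show ?thesis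
        by (simp add: mult)
    qed
    also have "(\<Sum>i\<in>UNIV. cord_mult (a i) (w i j) \<gamma>) =
        (\<Sum>k<CARD('n). cord_mult (a (e k)) (w (e k) j) \<gamma>)" for j \<gamma>
      by (rule sum.reindex_bij_betw[OF e, symmetric])
    finally have "v = (\<Sum>k<CARD('n). cord_smult (a (e k)) (w (e k)))"
      by (simp add: fun_eq_iff sum_fun_apply2 cord_smult_def)
    then show "v \<in> madic (Suc l)"
      unfolding madic.simps ideal_smult_def using a w
      by (auto intro!: exI[of _ "CARD('n)"] exI[of _ "\<lambda>k. a (e k)"] exI[of _ "\<lambda>k. w (e k)"])
  qed
qed (simp add: zero_enat_def[symmetric])

definition madic_topology :: "('m, 'n::finite, 'k::comm_ring_1) cords topology" where
  "madic_topology = topology (\<lambda>W. \<forall>a\<in>W. \<exists>l. \<forall>v\<in>madic l. a + v \<in> W)"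

lemma openin_madic_topology:
  fixes W :: "('m, 'n::finite, 'k::comm_ring_1) cords set"
  shows "openin madic_topology W \<longleftrightarrow> (\<forall>a\<in>W. \<exists>l. \<forall>v\<in>madic l. a + v \<in> W)"
proof -
  have "istopology (\<lambda>W. \<forall>a\<in>W. \<exists>l. \<forall>v\<in>(madic l :: ('m, 'n, 'k) cords set). a + v \<in> W)"
    unfolding istopology_def
  proof (intro conjI allI impI ballI)
    fix S T :: "('m, 'n, 'k) cords set" and a
    assume S: "\<forall>a\<in>S. \<exists>l. \<forall>v\<in>madic l. a + v \<in> S" and T: "\<forall>a\<in>T. \<exists>l. \<forall>v\<in>madic l. a + v \<in> T"
      and a: "a \<in> S \<inter> T"
    obtain l1 l2 where "\<forall>v\<in>madic l1. a + v \<in> S" "\<forall>v\<in>madic l2. a + v \<in> T"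
      using S T a by blast
    moreover have "madic (max l1 l2) \<subseteq> madic l1" "madic (max l1 l2) \<subseteq> madic l2"
      by (rule madic_antimono, simp)+
    ultimately show "\<exists>l. \<forall>v\<in>madic l. a + v \<in> S \<inter> T"
      by blast
  next
    fix K :: "('m, 'n, 'k) cords set set" and a
    assume "\<forall>S\<in>K. \<forall>a\<in>S. \<exists>l. \<forall>v\<in>madic l. a + v \<in> S" "a \<in> \<Union>K"
    then show "\<exists>l. \<forall>v\<in>madic l. a + v \<in> \<Union>K"
      by (metis UnionE UnionI)
  qed
  then show ?thesis
    unfolding madic_topology_def by (subst topology_inverse') (assumption, rule refl)
qed

definition nbhd0 :: "('m, 'n::finite, 'k::comm_ring_1) cords set \<Rightarrow> bool" where
  "nbhd0 V \<longleftrightarrow> (\<exists>W. openin madic_topology W \<and> 0 \<in> W \<and> W \<subseteq> V)"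

text \<open>
  Direct sum decomposition \<open>\<C>\<^sup>p = A \<oplus> B\<close> as topological vector spaces: the addition map
  \<open>A \<times> B \<rightarrow> \<C>\<^sup>p\<close> is bijective (this is part of \<open>homeomorphic_map\<close>) and a homeomorphism.
\<close>

definition topological_direct_sum ::
    "('p, 'n::finite, 'k::field) cords set \<Rightarrow> ('p, 'n, 'k) cords set \<Rightarrow> bool" where
  "topological_direct_sum A B \<longleftrightarrow>
     cvec.subspace A \<and> cvec.subspace B \<and>
     homeomorphic_map
       (prod_topology (subtopology madic_topology A) (subtopology madic_topology B))
       madic_topology (\<lambda>(a, b). a + b)"


section \<open>Polynomials and textile maps\<close>

text \<open>Polynomials in (finitely many of the) variables from a possibly infinite type \<open>'x\<close>.\<close>

type_synonym ('x, 'k) mpol = "('x \<Rightarrow>\<^sub>0 nat) \<Rightarrow>\<^sub>0 'k"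

definition mpol_eval :: "('x, 'k::comm_ring_1) mpol \<Rightarrow> ('x \<Rightarrow> 'k) \<Rightarrow> 'k" where
  "mpol_eval P \<xi> =
     (\<Sum>\<mu>\<in>Poly_Mapping.keys P.
        Poly_Mapping.lookup P \<mu> * (\<Prod>x\<in>Poly_Mapping.keys \<mu>. \<xi> x ^ Poly_Mapping.lookup \<mu> x))"

definition textile ::
    "(('m, 'n, 'k::comm_ring_1) cords \<Rightarrow> ('p, 'n, 'k) cords) \<Rightarrow> bool" where
  "textile F \<longleftrightarrow>
     (\<forall>j \<alpha>. \<exists>P :: ('m \<times> ('n \<Rightarrow> nat), 'k) mpol. \<forall>c. F c j \<alpha> = mpol_eval P (\<lambda>(i, \<beta>). c i \<beta>))"

definition textile_on ::
    "('m, 'n, 'k::comm_ring_1) cords set \<Rightarrow> (('m, 'n, 'k) cords \<Rightarrow> ('p, 'n, 'k) cords) \<Rightarrow> bool" where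
  "textile_on Y F \<longleftrightarrow> (\<exists>G. textile G \<and> (\<forall>c\<in>Y. F c = G c))"


section \<open>Regular families\<close>

definition zariski_closed :: "('x \<Rightarrow> 'k::comm_ring_1) set \<Rightarrow> bool" where
  "zariski_closed Z \<longleftrightarrow> (\<exists>\<P> :: ('x, 'k) mpol set. Z = {\<xi>. \<forall>P\<in>\<P>. mpol_eval P \<xi> = 0})"

definition zariski_open :: "('x \<Rightarrow> 'k::comm_ring_1) set \<Rightarrow> bool" where
  "zariski_open W \<longleftrightarrow> zariski_closed (- W)"

text \<open>
  Subvarieties of affine space are understood as locally closed subsets of \<open>k\<^sup>q\<close>, not necessarily
  irreducible.
\<close>

definition subvariety :: "('q \<Rightarrow> 'k::comm_ring_1) set \<Rightarrow> bool" where
  "subvariety Z \<longleftrightarrow> (\<exists>W A. zariski_open W \<and> zariski_closed A \<and> Z = W \<inter> A)"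

definition constructible :: "('q \<Rightarrow> 'k::comm_ring_1) set \<Rightarrow> bool" where
  "constructible S \<longleftrightarrow> (\<exists>\<Z>. finite \<Z> \<and> (\<forall>Z\<in>\<Z>. subvariety Z) \<and> S = \<Union>\<Z>)"

text \<open>The joint coordinates of a parameter and a vector of cords.\<close>

definition joint_coords ::
    "('q \<Rightarrow> 'k) \<Rightarrow> ('m, 'n, 'k) cords \<Rightarrow> ('q + 'm \<times> ('n \<Rightarrow> nat)) \<Rightarrow> 'k" where
  "joint_coords s c = case_sum s (\<lambda>(i, \<alpha>). c i \<alpha>)"

definition locally_quotient ::
    "('q \<Rightarrow> 'k::field) set \<Rightarrow> ('m, 'n, 'k) cords set \<Rightarrow>
     (('q \<Rightarrow> 'k) \<Rightarrow> ('m, 'n, 'k) cords \<Rightarrow> 'k) \<Rightarrow> bool" where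
  "locally_quotient Z Y g \<longleftrightarrow>
     (\<forall>s0\<in>Z. \<forall>c0\<in>Y.
        \<exists>W. zariski_open W \<and> joint_coords s0 c0 \<in> W \<and>
        (\<exists>P Q. \<forall>s\<in>Z. \<forall>c\<in>Y. joint_coords s c \<in> W \<longrightarrow>
           mpol_eval Q (joint_coords s c) \<noteq> 0 \<and>
           g s c = mpol_eval P (joint_coords s c) / mpol_eval Q (joint_coords s c)))"

definition regular_scalar_family ::
    "('q \<Rightarrow> 'k::field) set \<Rightarrow> ('m, 'n, 'k) cords set \<Rightarrow>
     (('q \<Rightarrow> 'k) \<Rightarrow> ('m, 'n, 'k) cords \<Rightarrow> 'k) \<Rightarrow> bool" where
  "regular_scalar_family S Y \<phi> \<longleftrightarrow>
     (\<exists>Z g. subvariety Z \<and> S \<subseteq> Z \<and> locally_quotient Z Y g \<and>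
            (\<forall>s\<in>S. \<forall>c\<in>Y. \<phi> s c = g s c))"

text \<open>
  A regular family of textile maps over \<open>S\<close> on \<open>Y\<close>.  Its members are required to be textile
  explicitly: over a field that is not algebraically closed this does not follow from the
  regularity of the coefficients (consider \<open>1 / (1 + c\<^sup>2)\<close> over the reals, \<open>c\<close> a coefficient).
\<close>

definition regular_family ::
    "('q \<Rightarrow> 'k::field) set \<Rightarrow> ('m, 'n, 'k) cords set \<Rightarrow>
     (('q \<Rightarrow> 'k) \<Rightarrow> ('m, 'n, 'k) cords \<Rightarrow> ('p, 'n, 'k) cords) \<Rightarrow> bool" where
  "regular_family S Y f \<longleftrightarrow>
     (\<forall>s\<in>S. textile_on Y (f s)) \<and>
     (\<forall>j \<alpha>. regular_scalar_family S Y (\<lambda>s c. f s c j \<alpha>))"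

text \<open>
  \<open>u\<close> is an invertible regular family over \<open>S\<close> from \<open>A\<close> onto \<open>B\<close>, with inverse family \<open>w\<close>.
\<close>

definition regular_inverse_families ::
    "('q \<Rightarrow> 'k::field) set \<Rightarrow> ('m, 'n, 'k) cords set \<Rightarrow> ('m, 'n, 'k) cords set \<Rightarrow>
     (('q \<Rightarrow> 'k) \<Rightarrow> ('m, 'n, 'k) cords \<Rightarrow> ('m, 'n, 'k) cords) \<Rightarrow>
     (('q \<Rightarrow> 'k) \<Rightarrow> ('m, 'n, 'k) cords \<Rightarrow> ('m, 'n, 'k) cords) \<Rightarrow> bool" where
  "regular_inverse_families S A B u w \<longleftrightarrow>
     regular_family S A u \<and> regular_family S B w \<and>
     (\<forall>s\<in>S. (\<forall>a\<in>A. u s a \<in> B \<and> w s (u s a) = a) \<and> (\<forall>b\<in>B. w s b \<in> A \<and> u s (w s b) = b))"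

definition contractive_family ::
    "('q \<Rightarrow> 'k::field) set \<Rightarrow> ('m::finite, 'n::finite, 'k) cords set \<Rightarrow>
     (('q \<Rightarrow> 'k) \<Rightarrow> ('m, 'n, 'k) cords \<Rightarrow> ('p::finite, 'n, 'k) cords) \<Rightarrow> bool" where
  "contractive_family S U f \<longleftrightarrow>
     (\<forall>s\<in>S. \<forall>a\<in>U. \<forall>b\<in>U. a \<noteq> b \<longrightarrow> cords_ord (f s a - f s b) > cords_ord (a - b))"


section \<open>Tangent maps, scissions, constant rank\<close>

text \<open>
  \<open>tangent F a v\<close> is \<open>1/t \<cdot> (F (a + t v) - F a)\<close> at \<open>t = 0\<close>: for textile \<open>F\<close>, each coefficient of the
  difference is \<open>t\<close> times a polynomial \<open>P\<close> in \<open>t\<close> (unique, as \<open>k\<close> is infinite), to be evaluated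
  at \<open>0\<close>.
\<close>

definition tangent ::
    "(('m, 'n, 'k::field_char_0) cords \<Rightarrow> ('p, 'n, 'k) cords) \<Rightarrow>
     ('m, 'n, 'k) cords \<Rightarrow> ('m, 'n, 'k) cords \<Rightarrow> ('p, 'n, 'k) cords" where
  "tangent F a v =
     (\<lambda>j \<alpha>. THE d. \<exists>P. (\<forall>t. F (a + cscale t v) j \<alpha> - F a j \<alpha> = t * poly P t) \<and> d = poly P 0)"

definition scission ::
    "('q \<Rightarrow> 'k::field) set \<Rightarrow> ('m, 'n, 'k) cords set \<Rightarrow>
     (('q \<Rightarrow> 'k) \<Rightarrow> ('m, 'n, 'k) cords \<Rightarrow> ('p, 'n, 'k) cords) \<Rightarrow>
     (('q \<Rightarrow> 'k) \<Rightarrow> ('p, 'n, 'k) cords \<Rightarrow> ('m, 'n, 'k) cords) \<Rightarrow> bool" where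
  "scission S U ell \<sigma> \<longleftrightarrow>
     regular_family S UNIV \<sigma> \<and>
     (\<forall>s\<in>S. linear_on_cords UNIV (\<sigma> s) \<and> range (\<sigma> s) \<subseteq> U \<and>
             (\<forall>c\<in>U. ell s (\<sigma> s (ell s c)) = ell s c))"

text \<open>The source \<open>V\<close> of a curve lies in \<open>\<C>\<close>, which is \<open>\<C>\<^sup>1\<close> with index type \<open>unit\<close>.\<close>

definition curve ::
    "(unit, 'n, 'k::field) cords set \<Rightarrow> ('r, 'n, 'k) cords set \<Rightarrow>
     ((unit, 'n, 'k) cords \<Rightarrow> ('r, 'n, 'k) cords) \<Rightarrow> bool" where
  "curve V M \<gamma> \<longleftrightarrow> textile_on V \<gamma> \<and> \<gamma> ` V \<subseteq> M"

definition rank_decomposition ::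
    "(unit, 'n, 'k::field_char_0) cords set \<Rightarrow> ('m, 'n, 'k) cords set \<Rightarrow> ('p, 'n, 'k) cords set \<Rightarrow>
     (('m, 'n, 'k) cords \<Rightarrow> ('p, 'n, 'k) cords) \<Rightarrow>
     ((unit, 'n, 'k) cords \<Rightarrow> ('m, 'n, 'k) cords) \<Rightarrow>
     ((unit, 'n, 'k) cords \<Rightarrow> ('p, 'n, 'k) cords) \<Rightarrow>
     ((unit, 'n, 'k) cords \<Rightarrow> ('m, 'n, 'k) cords) \<Rightarrow>
     ((unit, 'n, 'k) cords \<Rightarrow> ('p, 'n, 'k) cords) \<Rightarrow> bool" where
  "rank_decomposition V U J F \<gamma> \<eta> \<rho> \<tau> \<longleftrightarrow>
     curve V U \<rho> \<and> curve V J \<tau> \<and> (\<forall>t\<in>V. \<eta> t = tangent F (\<gamma> t) (\<rho> t) + \<tau> t)"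

text \<open>
  Uniqueness concerns the two summands \<open>T\<^sub>\<gamma> F \<cdot> \<rho>\<close> and \<open>\<tau>\<close>; the curve \<open>\<rho>\<close> itself is determined only
  up to curves annihilated by \<open>T\<^sub>\<gamma> F\<close>.
\<close>

definition constant_rank_at_0 ::
    "('m, 'n::finite, 'k::field_char_0) cords set \<Rightarrow> ('p, 'n, 'k) cords set \<Rightarrow>
     (('m, 'n, 'k) cords \<Rightarrow> ('p, 'n, 'k) cords) \<Rightarrow> bool" where
  "constant_rank_at_0 U J F \<longleftrightarrow>
     topological_direct_sum (tangent F 0 ` U) J \<and>
     (\<forall>V \<gamma> \<eta>. nbhd0 V \<and> curve V U \<gamma> \<and> \<gamma> 0 = 0 \<and> curve V UNIV \<eta> \<longrightarrow>
        (\<exists>\<rho> \<tau>. rank_decomposition V U J F \<gamma> \<eta> \<rho> \<tau>) \<and>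
        (\<forall>\<rho> \<tau> \<rho>' \<tau>'.
           rank_decomposition V U J F \<gamma> \<eta> \<rho> \<tau> \<and> rank_decomposition V U J F \<gamma> \<eta> \<rho>' \<tau>' \<longrightarrow>
           (\<forall>t\<in>V. tangent F (\<gamma> t) (\<rho> t) = tangent F (\<gamma> t) (\<rho>' t) \<and> \<tau> t = \<tau>' t)))"

definition constant_rank_family ::
    "('q \<Rightarrow> 'k::field_char_0) set \<Rightarrow> ('m, 'n::finite, 'k) cords set \<Rightarrow> ('p, 'n, 'k) cords set \<Rightarrow>
     (('q \<Rightarrow> 'k) \<Rightarrow> ('m, 'n, 'k) cords \<Rightarrow> ('p, 'n, 'k) cords) \<Rightarrow> bool" where
  "constant_rank_family S U J f \<longleftrightarrow>
     (\<forall>s\<in>S. topological_direct_sum (tangent (f s) 0 ` U) J) \<and>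
     (\<forall>s\<in>S. constant_rank_at_0 U J (f s))"

end

theory Submission
  imports Defs
begin

text \<open>
  Let \<open>\<pi>\<^sub>s = \<ell>\<^sub>s \<sigma>\<^sub>s\<close>, a projection onto the image of \<open>\<ell>\<^sub>s\<close>.  The family \<open>u = id + \<sigma> h\<close> is a contractive
  perturbation of the identity, hence invertible by Picard iteration, and \<open>\<pi> f = \<ell> u\<close>.  So
  \<open>g = f u\<^sup>-\<^sup>1\<close> satisfies \<open>\<pi> g = \<ell>\<close>, and \<open>v y = y - (1 - \<pi>) g (\<sigma> y)\<close>, with inverse
  \<open>y \<mapsto> y + (1 - \<pi>) g (\<sigma> y)\<close>, maps \<open>g\<close> to \<open>\<ell>\<close> as soon as \<open>g b\<close> depends only on \<open>\<ell> b\<close>.  The latter is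
  where constant rank enters: if \<open>\<ell> w = 0\<close>, then \<open>T\<^sub>b g \<cdot> w\<close> is tangential to \<open>f\<close> and killed by \<open>\<pi>\<close>,
  which forces it to vanish.

  Regularity of all these families rests on a normal form: the coefficients of a regular family on
  \<open>\<mm>\<^sup>l \<cdot> \<C>\<^sup>m\<close> are polynomials in finitely many coefficients of the cord, whose own coefficients are
  regular functions of the parameter.  Finiteness is local in the parameter, by comparing degrees
  and variables on lines through \<open>0\<close>, and global because affine space is Noetherian.  In normal form,
  composition and passing to tangent maps preserve regularity.
\<close>

section \<open>Noetherian rings of functions\<close>

text \<open>The definition of a regular family does not visibly survive composition: every
  coefficient has its own subvariety around \<open>S\<close>, and over the added parameters the
  values of an inner family may leave the domain of an outer one. Once the denominators involve the
  parameter alone, substitution is harmless. The obstacle to such a form is uniformity: at a fixed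
  parameter a coefficient is a polynomial, but its degree and its variables could grow with the
  parameter.

  Constant rank is a statement about \<open>J\<close>, whereas the scission provides the kernel of
  \<open>\<pi>\<^sub>s\<close>, another complement of the image, which may move with
  \<open>s\<close>. The two are never compared directly; only the uniqueness of decompositions along
  curves links them. As these curves have to start at 0, information at a point \<open>b\<close> is
  transported along the image under \<open>u\<^sup>-\<^sup>1\<close> of the segment from 0 to
  \<open>b\<close>.\<close>

inductive_set ideal_span :: "'r::comm_ring_1 set \<Rightarrow> 'r set \<Rightarrow> 'r set" for A B where
  zero: "0 \<in> ideal_span A B"
| step: "a \<in> A \<Longrightarrow> b \<in> B \<Longrightarrow> y \<in> ideal_span A B \<Longrightarrow> a * b + y \<in> ideal_span A B"

definition subring_of :: "'r::comm_ring_1 set \<Rightarrow> bool" where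
  "subring_of A \<longleftrightarrow> 1 \<in> A \<and> (\<forall>a\<in>A. \<forall>b\<in>A. a - b \<in> A \<and> a * b \<in> A)"

text \<open>Rings are subsets of one ambient ring, because polynomial functions are generated by one
  more coordinate at a time. The generators are taken from \<open>B\<close> itself: later
  \<open>B\<close> is a set of local denominators from which finitely many are to be
  selected.\<close>

definition noetherian_on :: "'r::comm_ring_1 set \<Rightarrow> bool" where
  "noetherian_on A \<longleftrightarrow> (\<forall>B\<subseteq>A. \<exists>B0. finite B0 \<and> B0 \<subseteq> B \<and> B \<subseteq> ideal_span A B0)"

lemma noetherian_onE:
  assumes "noetherian_on A" "B \<subseteq> A"
  obtains B0 where "finite B0" "B0 \<subseteq> B" "B \<subseteq> ideal_span A B0"
proof -
  have "\<exists>B0. finite B0 \<and> B0 \<subseteq> B \<and> B \<subseteq> ideal_span A B0"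
    using assms(1)[unfolded noetherian_on_def, THEN spec, THEN mp, OF assms(2)] .
  then show thesis by (elim exE conjE) (rule that)
qed

lemma subring_of_one: "subring_of A \<Longrightarrow> 1 \<in> A"
  unfolding subring_of_def by blast

lemma subring_of_diff: "subring_of A \<Longrightarrow> a \<in> A \<Longrightarrow> b \<in> A \<Longrightarrow> a - b \<in> A"
  unfolding subring_of_def by blast

lemma subring_of_zero: "subring_of A \<Longrightarrow> 0 \<in> A"
  using subring_of_diff[of A 1 1] by (simp add: subring_of_one)

lemma subring_of_uminus: "subring_of A \<Longrightarrow> a \<in> A \<Longrightarrow> - a \<in> A"
  using subring_of_diff[of A 0 a] by (simp add: subring_of_zero)

lemma subring_of_add: "subring_of A \<Longrightarrow> a \<in> A \<Longrightarrow> b \<in> A \<Longrightarrow> a + b \<in> A"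
  using subring_of_diff[of A a "- b"] by (simp add: subring_of_uminus)

lemma subring_of_mult: "subring_of A \<Longrightarrow> a \<in> A \<Longrightarrow> b \<in> A \<Longrightarrow> a * b \<in> A"
  unfolding subring_of_def by blast

lemma subring_of_sum: "subring_of A \<Longrightarrow> (\<And>i. i \<in> I \<Longrightarrow> g i \<in> A) \<Longrightarrow> sum g I \<in> A"
  by (induction I rule: infinite_finite_induct) (auto simp: subring_of_zero subring_of_add)

lemma ideal_span_add:
  "x \<in> ideal_span A B \<Longrightarrow> y \<in> ideal_span A B \<Longrightarrow> x + y \<in> ideal_span A B"
  by (induction x rule: ideal_span.induct) (auto simp: add.assoc intro: ideal_span.intros)

lemma ideal_span_base: "subring_of A \<Longrightarrow> b \<in> B \<Longrightarrow> b \<in> ideal_span A B"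
  using ideal_span.step[OF _ _ ideal_span.zero, of 1 A b B] by (simp add: subring_of_one)

lemma ideal_span_mult:
  "x \<in> ideal_span A B \<Longrightarrow> subring_of A \<Longrightarrow> c \<in> A \<Longrightarrow> c * x \<in> ideal_span A B"
proof (induction x rule: ideal_span.induct)
  case (step a b y)
  then have "(c * a) * b + c * y \<in> ideal_span A B"
    by (intro ideal_span.step) (auto simp: subring_of_mult)
  then show ?case by (simp add: algebra_simps)
qed (simp add: ideal_span.zero)

lemma ideal_span_diff:
  assumes "subring_of A" "x \<in> ideal_span A B" "y \<in> ideal_span A B"
  shows "x - y \<in> ideal_span A B"
proof -
  have "- 1 \<in> A" using assms(1) by (intro subring_of_uminus subring_of_one)
  then have "x + (- 1) * y \<in> ideal_span A B"
    using assms by (intro ideal_span_add ideal_span_mult)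
  then show ?thesis by simp
qed

lemma ideal_span_least:
  assumes "subring_of A" "B \<subseteq> ideal_span A B'"
  shows "ideal_span A B \<subseteq> ideal_span A B'"
proof
  fix x assume "x \<in> ideal_span A B"
  then show "x \<in> ideal_span A B'"
    by induction (use assms in \<open>auto intro!: ideal_span_add ideal_span_mult ideal_span.zero\<close>)
qed

lemma ideal_span_mono: "B \<subseteq> B' \<Longrightarrow> ideal_span A B \<subseteq> ideal_span A B'"
proof
  fix x assume "B \<subseteq> B'" "x \<in> ideal_span A B"
  from this(2,1) show "x \<in> ideal_span A B'"
    by induction (auto intro: ideal_span.intros)
qed

lemma ideal_span_subset: "subring_of A \<Longrightarrow> B \<subseteq> A \<Longrightarrow> ideal_span A B \<subseteq> A"
proof
  fix x assume "subring_of A" "B \<subseteq> A" "x \<in> ideal_span A B"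
  from this(3,1,2) show "x \<in> A"
    by induction (auto intro!: subring_of_add subring_of_mult simp: subring_of_zero)
qed

lemma ideal_span_finite:
  "x \<in> ideal_span A B \<Longrightarrow> \<exists>B0. finite B0 \<and> B0 \<subseteq> B \<and> x \<in> ideal_span A B0"
proof (induction x rule: ideal_span.induct)
  case zero
  show ?case by (rule exI[of _ "{}"]) (simp add: ideal_span.zero)
next
  case (step a b y)
  then obtain B0 where B0: "finite B0" "B0 \<subseteq> B" "y \<in> ideal_span A B0" by blast
  then have "y \<in> ideal_span A (insert b B0)"
    using ideal_span_mono[of B0 "insert b B0" A] by blast
  then have "a * b + y \<in> ideal_span A (insert b B0)"
    using step by (intro ideal_span.step) auto
  then show ?case using B0 step by (intro exI[of _ "insert b B0"]) auto
qed

section \<open>Polynomials over a Noetherian ring\<close>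

definition poly_over :: "'r::comm_ring_1 set \<Rightarrow> 'r poly set" where
  "poly_over A = {p. \<forall>i. coeff p i \<in> A}"

lemma subring_of_poly_over:
  assumes "subring_of A"
  shows "subring_of (poly_over A)"
proof -
  have "p * q \<in> poly_over A" if "p \<in> poly_over A" "q \<in> poly_over A" for p q
    unfolding poly_over_def
  proof (intro CollectI allI)
    fix i
    show "coeff (p * q) i \<in> A"
      unfolding coeff_mult
      by (intro subring_of_sum[OF assms] subring_of_mult[OF assms])
         (use that in \<open>auto simp: poly_over_def\<close>)
  qed
  moreover have "1 \<in> poly_over A"
    using assms subring_of_zero[OF assms] by (auto simp: poly_over_def coeff_1 subring_of_one)
  moreover have "p - q \<in> poly_over A" if "p \<in> poly_over A" "q \<in> poly_over A" for p q
    using assms that by (auto simp: poly_over_def subring_of_diff)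
  ultimately show ?thesis unfolding subring_of_def by blast
qed

lemma monom_in_poly_over: "subring_of A \<Longrightarrow> a \<in> A \<Longrightarrow> monom a n \<in> poly_over A"
  by (auto simp: poly_over_def subring_of_zero)

text \<open>
  Hilbert's basis theorem.  \<open>L n\<close> is the ideal of the coefficients at \<open>n\<close> of the elements of the
  given ideal that have degree at most \<open>n\<close>; the \<open>L n\<close> increase and become constant from \<open>D\<close> on.
\<close>

lemma noetherian_on_poly_over:
  assumes A: "subring_of A" and noeth: "noetherian_on A"
  shows "noetherian_on (poly_over A)"
  unfolding noetherian_on_def
proof (intro allI impI)
  fix B :: "'a poly set" assume B: "B \<subseteq> poly_over A"
  let ?AX = "poly_over A"
  define I where "I = ideal_span ?AX B"
  have AX: "subring_of ?AX" by (rule subring_of_poly_over[OF A])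
  have I: "I \<subseteq> ?AX" unfolding I_def by (rule ideal_span_subset[OF AX B])
  define L where "L n = {coeff p n | p. p \<in> I \<and> degree p \<le> n}" for n
  have LA: "L n \<subseteq> A" for n using I by (auto simp: L_def poly_over_def)
  have step: "L n \<subseteq> L (n + d)" for n d
  proof
    fix a assume "a \<in> L n"
    then obtain p where p: "p \<in> I" "degree p \<le> n" "a = coeff p n" by (auto simp: L_def)
    have "monom 1 d * p \<in> I" unfolding I_def
      using p(1) AX A
      by (intro ideal_span_mult monom_in_poly_over) (auto simp: I_def subring_of_one)
    moreover have "degree (monom 1 d * p) \<le> n + d"
      using degree_mult_le[of "monom 1 d" p] degree_monom_le[of "1::'a" d] p(2) by linarith
    moreover have "coeff (monom 1 d * p) (n + d) = a"
      using p(3) by (simp add: coeff_monom_mult)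
    ultimately show "a \<in> L (n + d)" unfolding L_def by blast
  qed
  have Lmono: "n \<le> n' \<Longrightarrow> L n \<subseteq> L n'" for n n'
    using step[of n "n' - n"] by simp
  have "\<forall>n. \<exists>G. finite G \<and> G \<subseteq> I \<and> (\<forall>p\<in>G. degree p \<le> n) \<and>
            L n \<subseteq> ideal_span A ((\<lambda>p. coeff p n) ` G)"
  proof
    fix n
    obtain B0 where B0: "finite B0" "B0 \<subseteq> L n" "L n \<subseteq> ideal_span A B0"
      by (rule noetherian_onE[OF noeth LA[of n]])
    have "\<forall>b\<in>B0. \<exists>p. p \<in> I \<and> degree p \<le> n \<and> coeff p n = b"
      using B0(2) by (auto simp: L_def)
    then obtain q where q: "\<And>b. b \<in> B0 \<Longrightarrow> q b \<in> I \<and> degree (q b) \<le> n \<and> coeff (q b) n = b"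
      by metis
    then have "(\<lambda>p. coeff p n) ` q ` B0 = B0" by (simp add: image_image)
    then show "\<exists>G. finite G \<and> G \<subseteq> I \<and> (\<forall>p\<in>G. degree p \<le> n) \<and>
        L n \<subseteq> ideal_span A ((\<lambda>p. coeff p n) ` G)"
      using B0 q by (intro exI[of _ "q ` B0"]) auto
  qed
  from choice[OF this] obtain G where G: "\<And>n. finite (G n)" "\<And>n. G n \<subseteq> I"
    "\<And>n p. p \<in> G n \<Longrightarrow> degree p \<le> n"
    "\<And>n. L n \<subseteq> ideal_span A ((\<lambda>p. coeff p n) ` G n)" by blast
  obtain D where D: "\<And>n. L n \<subseteq> ideal_span A (L D)"
  proof -
    \<comment> \<open>The union of the \<open>L n\<close> lies in the span of finitely many of its
      elements, and by monotonicity these all lie in one \<open>L D\<close>.\<close>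
    have LA': "(\<Union>n. L n) \<subseteq> A" using LA by blast
    obtain B0 where B0: "finite B0" "B0 \<subseteq> (\<Union>n. L n)" "(\<Union>n. L n) \<subseteq> ideal_span A B0"
      by (rule noetherian_onE[OF noeth LA'])
    have "\<exists>D. B0 \<subseteq> L D" using B0(1,2)
    proof (induction B0 rule: finite_induct)
      case (insert b B1)
      then obtain D n where "B1 \<subseteq> L D" "b \<in> L n" by auto
      then have "insert b B1 \<subseteq> L (max D n)"
        using Lmono[of D "max D n"] Lmono[of n "max D n"] by auto
      then show ?case by blast
    qed simp
    then obtain D where "B0 \<subseteq> L D" by blast
    with B0(3) ideal_span_mono[OF this, of A] show thesis by (intro that[of D]) blast
  qed
  define H where "H = (\<Union>n\<le>D. G n)"
  have H: "finite H" "H \<subseteq> I" using G(1,2) by (auto simp: H_def)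
  have red: "\<exists>r. r \<in> ideal_span ?AX H \<and> degree r \<le> n \<and> coeff r n = a" if a: "a \<in> L n" for n a
  proof -
    \<comment> \<open>Up to \<open>D\<close> the generators of \<open>L n\<close> itself serve;
      beyond \<open>D\<close> those of \<open>L D\<close> do, multiplied by the power
      \<open>n - m\<close> of the variable.\<close>
    define m where "m = min n D"
    have "a \<in> ideal_span A ((\<lambda>p. coeff p m) ` G m)"
    proof (cases "n \<le> D")
      case True
      then show ?thesis using G(4)[of n] a by (auto simp: m_def)
    next
      case False
      have "ideal_span A (L D) \<subseteq> ideal_span A ((\<lambda>p. coeff p D) ` G D)"
        by (rule ideal_span_least[OF A G(4)])
      then show ?thesis using False D[of n] a by (auto simp: m_def)
    qed
    then show ?thesis
    proof induction
      case zero
      then show ?case by (intro exI[of _ 0]) (simp add: ideal_span.zero)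
    next
      case (step c b y)
      then obtain r p where r: "r \<in> ideal_span ?AX H" "degree r \<le> n" "coeff r n = y"
        and p: "p \<in> G m" "b = coeff p m" by blast
      have mn: "m \<le> n" by (simp add: m_def)
      have "p \<in> H" using p(1) by (auto simp: H_def m_def)
      then have "monom c (n - m) * p + r \<in> ideal_span ?AX H"
        using step(1) r(1) A by (intro ideal_span.step monom_in_poly_over)
      moreover have "degree (monom c (n - m) * p) \<le> n"
        using degree_mult_le[of "monom c (n - m)" p] degree_monom_le[of c "n - m"] G(3)[OF p(1)] mn
        by linarith
      then have "degree (monom c (n - m) * p + r) \<le> n" using r(2) by (rule degree_add_le)
      moreover have "coeff (monom c (n - m) * p + r) n = c * b + y"
        using mn r(3) p(2) by (simp add: coeff_monom_mult)
      ultimately show ?case by blast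
    qed
  qed
  \<comment> \<open>Subtracting an element of the span with the same coefficient at \<open>n\<close>
    lowers the degree.\<close>
  have main: "degree p < n \<Longrightarrow> p \<in> I \<Longrightarrow> p \<in> ideal_span ?AX H" for n p
  proof (induction n arbitrary: p)
    case (Suc n)
    obtain r where r: "r \<in> ideal_span ?AX H" "degree r \<le> n" "coeff r n = coeff p n"
      using red[of "coeff p n" n] Suc.prems by (auto simp: L_def less_Suc_eq_le)
    have "r \<in> I" using r(1) ideal_span_least[OF AX, of H B] H(2) by (auto simp: I_def)
    then have pr: "p - r \<in> I" using Suc.prems(2) AX unfolding I_def by (intro ideal_span_diff)
    have "p - r \<in> ideal_span ?AX H"
    \<comment> \<open>The zero polynomial has degree 0 and is treated apart: for
      \<open>n = 0\<close> the degree could not drop strictly.\<close>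
    proof (cases "p - r = 0")
      case False
      have "degree (p - r) \<le> n" using Suc.prems(1) r(2) by (intro degree_diff_le) auto
      moreover have "coeff (p - r) n = 0" using r(3) by simp
      ultimately have "degree (p - r) < n"
        using False by (metis leading_coeff_0_iff le_neq_implies_less)
      then show ?thesis using Suc.IH pr by blast
    qed (simp add: ideal_span.zero)
    from ideal_span_add[OF this r(1)] show ?case by simp
  qed simp
  \<comment> \<open>The elements of \<open>H\<close> are themselves spanned by \<open>B\<close>,
    each by finitely many members.\<close>
  have "\<exists>B1. finite B1 \<and> B1 \<subseteq> B \<and> H \<subseteq> ideal_span ?AX B1" using H
  proof (induction H rule: finite_induct)
    case (insert h H)
    then obtain B1 B2 where "finite B1" "B1 \<subseteq> B" "H \<subseteq> ideal_span ?AX B1"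
      "finite B2" "B2 \<subseteq> B" "h \<in> ideal_span ?AX B2"
      using ideal_span_finite[of h ?AX B] by (auto simp: I_def)
    then show ?case
      using ideal_span_mono[of B1 "B1 \<union> B2" ?AX] ideal_span_mono[of B2 "B1 \<union> B2" ?AX]
      by (intro exI[of _ "B1 \<union> B2"]) auto
  qed (auto intro: exI[of _ "{}"])
  then obtain B1 where B1: "finite B1" "B1 \<subseteq> B" "H \<subseteq> ideal_span ?AX B1" by blast
  have "B \<subseteq> I" unfolding I_def using ideal_span_base[OF AX] by blast
  then have "B \<subseteq> ideal_span ?AX H" using main by blast
  then have "B \<subseteq> ideal_span ?AX B1" using ideal_span_least[OF AX B1(3)] by blast
  then show "\<exists>B0. finite B0 \<and> B0 \<subseteq> B \<and> B \<subseteq> ideal_span ?AX B0"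
    using B1 by (intro exI[of _ B1]) simp
qed

section \<open>Adjoining one element to a ring\<close>

definition adjoin :: "'r::comm_ring_1 set \<Rightarrow> 'r \<Rightarrow> 'r set" where
  "adjoin A x = (\<lambda>p. poly p x) ` poly_over A"

lemma subring_of_adjoin:
  assumes "subring_of A"
  shows "subring_of (adjoin A x)"
proof -
  have "p - q \<in> poly_over A" "p * q \<in> poly_over A" if "p \<in> poly_over A" "q \<in> poly_over A" for p q
    using subring_of_poly_over[OF assms] that unfolding subring_of_def by auto
  moreover have "1 \<in> poly_over A"
    using subring_of_poly_over[OF assms] unfolding subring_of_def by auto
  ultimately show ?thesis
    unfolding subring_of_def adjoin_def
    by (auto simp flip: poly_diff poly_mult intro: image_eqI[of _ _ 1])
qed

lemma subset_adjoin: "subring_of A \<Longrightarrow> A \<subseteq> adjoin A x"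
proof
  fix a assume "subring_of A" "a \<in> A"
  then have "monom a 0 \<in> poly_over A" by (rule monom_in_poly_over)
  then show "a \<in> adjoin A x" unfolding adjoin_def by (rule rev_image_eqI) (simp add: poly_monom)
qed

lemma mem_adjoin: "subring_of A \<Longrightarrow> x \<in> adjoin A x"
proof -
  assume "subring_of A"
  then have "monom 1 1 \<in> poly_over A" by (intro monom_in_poly_over subring_of_one)
  then show "x \<in> adjoin A x" unfolding adjoin_def by (rule rev_image_eqI) (simp add: poly_monom)
qed

text \<open>Evaluation at \<open>x\<close> maps \<open>poly_over A\<close> onto
  \<open>adjoin A x\<close>, and Noetherian rings have Noetherian images: a subset is pulled back,
  finitely many generators are found upstairs and pushed forward. \<open>x\<close> may satisfy
  relations over \<open>A\<close>.\<close>

lemma noetherian_on_adjoin: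
  assumes A: "subring_of A" and noeth: "noetherian_on A"
  shows "noetherian_on (adjoin A x)"
  unfolding noetherian_on_def
proof (intro allI impI)
  fix B assume B: "B \<subseteq> adjoin A x"
  define \<psi> where "\<psi> = (\<lambda>p. poly p x)"
  define C where "C = {p \<in> poly_over A. \<psi> p \<in> B}"
  have C: "C \<subseteq> poly_over A" by (auto simp: C_def)
  obtain C0 where C0: "finite C0" "C0 \<subseteq> C" "C \<subseteq> ideal_span (poly_over A) C0"
    by (rule noetherian_onE[OF noetherian_on_poly_over[OF A noeth] C])
  have "\<psi> p \<in> ideal_span (adjoin A x) (\<psi> ` C0)" if "p \<in> ideal_span (poly_over A) C0" for p
    using that
  proof induction
    case (step a b y)
    have "\<psi> a \<in> adjoin A x" using step(1) by (auto simp: adjoin_def \<psi>_def)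
    then have "\<psi> a * \<psi> b + \<psi> y \<in> ideal_span (adjoin A x) (\<psi> ` C0)"
      using step by (intro ideal_span.step) auto
    then show ?case by (simp add: \<psi>_def)
  qed (simp add: \<psi>_def ideal_span.zero)
  moreover have "B \<subseteq> \<psi> ` C" using B by (auto simp: C_def adjoin_def \<psi>_def)
  ultimately have "B \<subseteq> ideal_span (adjoin A x) (\<psi> ` C0)" using C0(3) by blast
  moreover have "\<psi> ` C0 \<subseteq> B" using C0(2) by (auto simp: C_def)
  ultimately show "\<exists>B0. finite B0 \<and> B0 \<subseteq> B \<and> B \<subseteq> ideal_span (adjoin A x) B0"
    using C0(1) by (intro exI[of _ "\<psi> ` C0"]) simp
qed

section \<open>Polynomial functions\<close>

text \<open>Polynomials as functions rather than formal expressions, so that closure properties and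
  derivatives are inductions; \<open>polyfun_eq_range_mpol_eval\<close> gives the link to
  \<open>mpol_eval\<close>.\<close>

inductive_set polyfun :: "(('x \<Rightarrow> 'k::comm_ring_1) \<Rightarrow> 'k) set" where
  const: "(\<lambda>_. a) \<in> polyfun"
| coord: "(\<lambda>\<xi>. \<xi> x) \<in> polyfun"
| add: "p \<in> polyfun \<Longrightarrow> q \<in> polyfun \<Longrightarrow> (\<lambda>\<xi>. p \<xi> + q \<xi>) \<in> polyfun"
| mult: "p \<in> polyfun \<Longrightarrow> q \<in> polyfun \<Longrightarrow> (\<lambda>\<xi>. p \<xi> * q \<xi>) \<in> polyfun"

text \<open>Quasi-compactness of open subsets of affine space. All polynomial functions lie in a
  ring obtained from the constants by adjoining the finitely many coordinates, and a common zero of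
  \<open>R0\<close> is a zero of the whole ideal it spans.\<close>

lemma polyfun_noetherian_cover:
  fixes R :: "(('x::finite \<Rightarrow> 'k::field) \<Rightarrow> 'k) set"
  assumes "R \<subseteq> polyfun"
  shows "\<exists>R0. finite R0 \<and> R0 \<subseteq> R \<and> (\<forall>\<xi>. (\<exists>r\<in>R. r \<xi> \<noteq> 0) \<longrightarrow> (\<exists>r\<in>R0. r \<xi> \<noteq> 0))"
proof -
  have "\<exists>A :: (('x \<Rightarrow> 'k) \<Rightarrow> 'k) set. subring_of A \<and> noetherian_on A \<and>
      (\<forall>a. (\<lambda>_. a) \<in> A) \<and> (\<forall>x\<in>T. (\<lambda>\<xi>. \<xi> x) \<in> A)" for T :: "'x set"
    using finite[of T]
  proof (induction T rule: finite_induct)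
    case empty
    define K :: "(('x \<Rightarrow> 'k) \<Rightarrow> 'k) set" where "K = range (\<lambda>a _. a)"
    have "noetherian_on K"
      unfolding noetherian_on_def
    proof (intro allI impI)
      fix B assume B: "B \<subseteq> K"
      show "\<exists>B0. finite B0 \<and> B0 \<subseteq> B \<and> B \<subseteq> ideal_span K B0"
      \<comment> \<open>Over a field a single nonzero constant spans all constants.\<close>
      proof (cases "\<exists>b. b \<noteq> 0 \<and> (\<lambda>_. b) \<in> B")
        case True
        then obtain b where b: "b \<noteq> 0" "(\<lambda>_. b) \<in> B" by blast
        have "(\<lambda>_. c) \<in> ideal_span K {\<lambda>_. b}" for c
          using ideal_span.step[of "\<lambda>_. c / b" K "\<lambda>_. b" "{\<lambda>_. b}" 0] b(1)
          by (auto simp: K_def ideal_span.zero times_fun_def plus_fun_def)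
        then show ?thesis using B b(2) by (intro exI[of _ "{\<lambda>_. b}"]) (auto simp: K_def)
      next
        case False
        then have "B \<subseteq> {0}" using B by (auto simp: K_def zero_fun_def fun_eq_iff)
        then show ?thesis by (intro exI[of _ "{}"]) (auto intro: ideal_span.zero)
      qed
    qed
    moreover have "subring_of K"
      by (auto simp: subring_of_def K_def one_fun_def fun_diff_def times_fun_def)
    ultimately show ?case by (intro exI[of _ K]) (auto simp: K_def)
  next
    case (insert x T)
    then obtain A :: "(('x \<Rightarrow> 'k) \<Rightarrow> 'k) set" where A: "subring_of A" "noetherian_on A"
      "\<And>a. (\<lambda>_. a) \<in> A" "\<And>x. x \<in> T \<Longrightarrow> (\<lambda>\<xi>. \<xi> x) \<in> A" by blast
    then show ?case
      using subring_of_adjoin[OF A(1)] noetherian_on_adjoin[OF A(1,2)] subset_adjoin[OF A(1)]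
        mem_adjoin[OF A(1)]
      by (intro exI[of _ "adjoin A (\<lambda>\<xi>. \<xi> x)"]) blast
  qed
  then obtain A :: "(('x \<Rightarrow> 'k) \<Rightarrow> 'k) set" where A: "subring_of A" "noetherian_on A"
      "\<And>a. (\<lambda>_. a) \<in> A" "\<And>x. (\<lambda>\<xi>. \<xi> x) \<in> A" by (metis UNIV_I)
  have "p \<in> A" if "p \<in> polyfun" for p using that
  proof induction
    case (add p q)
    then show ?case using subring_of_add[OF A(1)] by (fastforce simp: plus_fun_def)
  next
    case (mult p q)
    then show ?case using subring_of_mult[OF A(1)] by (fastforce simp: times_fun_def)
  qed (use A in auto)
  then have RA: "R \<subseteq> A" using assms by blast
  obtain R0 where R0: "finite R0" "R0 \<subseteq> R" "R \<subseteq> ideal_span A R0"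
    by (rule noetherian_onE[OF A(2) RA])
  have "r \<xi> = 0" if "r \<in> ideal_span A R0" "\<forall>r\<in>R0. r \<xi> = 0" for r \<xi>
    using that by induction auto
  then have "\<exists>r\<in>R0. r \<xi> \<noteq> 0" if "r \<in> R" "r \<xi> \<noteq> 0" for r \<xi>
    using R0(3) that by blast
  then show ?thesis using R0(1,2) by (intro exI[of _ R0]) metis
qed

lemma polyfun_sum: "(\<And>i. i \<in> I \<Longrightarrow> p i \<in> polyfun) \<Longrightarrow> (\<lambda>\<xi>. \<Sum>i\<in>I. p i \<xi>) \<in> polyfun"
  by (induction I rule: infinite_finite_induct) (auto intro: polyfun.intros)

lemma polyfun_prod: "(\<And>i. i \<in> I \<Longrightarrow> p i \<in> polyfun) \<Longrightarrow> (\<lambda>\<xi>. \<Prod>i\<in>I. p i \<xi>) \<in> polyfun"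
  by (induction I rule: infinite_finite_induct) (auto intro: polyfun.intros)

lemma polyfun_power: "p \<in> polyfun \<Longrightarrow> (\<lambda>\<xi>. p \<xi> ^ n) \<in> polyfun"
  by (induction n) (auto intro: polyfun.intros)

lemma polyfun_subst:
  assumes "p \<in> polyfun" "\<And>x. (\<lambda>\<eta>. \<sigma> \<eta> x) \<in> polyfun"
  shows "(\<lambda>\<eta>. p (\<sigma> \<eta>)) \<in> polyfun"
  using assms by (induction p rule: polyfun.induct) (auto intro: polyfun.intros)

section \<open>Formal polynomials and polynomial functions\<close>

definition mpol_monom :: "('x \<Rightarrow>\<^sub>0 nat) \<Rightarrow> ('x \<Rightarrow> 'k::comm_ring_1) \<Rightarrow> 'k" where
  "mpol_monom \<mu> \<xi> = (\<Prod>x\<in>Poly_Mapping.keys \<mu>. \<xi> x ^ Poly_Mapping.lookup \<mu> x)"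

lemma mpol_monom_superset:
  "finite A \<Longrightarrow> Poly_Mapping.keys \<mu> \<subseteq> A \<Longrightarrow>
    mpol_monom \<mu> \<xi> = (\<Prod>x\<in>A. \<xi> x ^ Poly_Mapping.lookup \<mu> x)"
  unfolding mpol_monom_def by (intro prod.mono_neutral_left) (auto simp: in_keys_iff)

lemma mpol_monom_add: "mpol_monom (\<mu> + \<nu>) \<xi> = mpol_monom \<mu> \<xi> * mpol_monom \<nu> \<xi>"
proof -
  let ?A = "Poly_Mapping.keys \<mu> \<union> Poly_Mapping.keys \<nu>"
  have "Poly_Mapping.keys (\<mu> + \<nu>) \<subseteq> ?A" by (rule keys_add)
  then show ?thesis
    by (simp add: mpol_monom_superset[of ?A] lookup_add power_add prod.distrib)
qed

lemma mpol_eval_superset: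
  "finite A \<Longrightarrow> Poly_Mapping.keys P \<subseteq> A \<Longrightarrow>
    mpol_eval P \<xi> = (\<Sum>\<mu>\<in>A. Poly_Mapping.lookup P \<mu> * mpol_monom \<mu> \<xi>)"
  unfolding mpol_eval_def mpol_monom_def[symmetric]
  by (intro sum.mono_neutral_left) (auto simp: in_keys_iff)

lemma mpol_eval_add: "mpol_eval (P + Q) \<xi> = mpol_eval P \<xi> + mpol_eval Q \<xi>"
proof -
  let ?A = "Poly_Mapping.keys P \<union> Poly_Mapping.keys Q"
  have "Poly_Mapping.keys (P + Q) \<subseteq> ?A" by (rule keys_add)
  then show ?thesis
    by (simp add: mpol_eval_superset[of ?A] lookup_add sum.distrib algebra_simps)
qed

lemma mpol_eval_single: "mpol_eval (Poly_Mapping.single \<mu> a) \<xi> = a * mpol_monom \<mu> \<xi>"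
  by (subst mpol_eval_superset[of "{\<mu>}"]) auto

lemma mpol_eval_sum_in_range:
  "finite I \<Longrightarrow> (\<And>i. i \<in> I \<Longrightarrow> g i \<in> range mpol_eval) \<Longrightarrow> (\<lambda>\<xi>. \<Sum>i\<in>I. g i \<xi>) \<in> range mpol_eval"
proof (induction I rule: finite_induct)
  case empty
  show ?case by (rule range_eqI[of _ _ 0]) (simp add: mpol_eval_def)
next
  case (insert i I)
  then obtain P Q where "g i = mpol_eval P" "(\<lambda>\<xi>. \<Sum>i\<in>I. g i \<xi>) = mpol_eval Q" by blast
  then have "(\<lambda>\<xi>. \<Sum>i\<in>insert i I. g i \<xi>) = mpol_eval (P + Q)"
    using insert(1,2) by (simp add: fun_eq_iff mpol_eval_add)
  then show ?case by blast
qed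

lemma polyfun_eq_range_mpol_eval: "polyfun = range mpol_eval"
proof (intro equalityI subsetI)
  fix p :: "('a \<Rightarrow> 'b) \<Rightarrow> 'b" assume "p \<in> range mpol_eval"
  then show "p \<in> polyfun"
    unfolding mpol_eval_def[abs_def]
    by (auto intro!: polyfun_sum polyfun_prod polyfun_power polyfun.intros)
next
  fix p :: "('a \<Rightarrow> 'b) \<Rightarrow> 'b" assume "p \<in> polyfun"
  then show "p \<in> range mpol_eval"
  proof induction
    case (const a)
    show ?case
      by (rule range_eqI[of _ _ "Poly_Mapping.single 0 a"])
         (simp add: fun_eq_iff mpol_eval_single mpol_monom_def)
  next
    case (coord x)
    show ?case
      by (rule range_eqI[of _ _ "Poly_Mapping.single (Poly_Mapping.single x 1) 1"])
         (simp add: fun_eq_iff mpol_eval_single mpol_monom_def)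
  next
    case (add p q)
    then obtain P Q where "p = mpol_eval P" "q = mpol_eval Q" by blast
    then show ?case
      by (intro range_eqI[of _ _ "P + Q"]) (simp add: fun_eq_iff mpol_eval_add)
  next
    case (mult p q)
    then obtain P Q where PQ: "p = mpol_eval P" "q = mpol_eval Q" by blast
    have "p \<xi> * q \<xi> = (\<Sum>(\<mu>, \<nu>)\<in>Poly_Mapping.keys P \<times> Poly_Mapping.keys Q. mpol_eval
        (Poly_Mapping.single (\<mu> + \<nu>) (Poly_Mapping.lookup P \<mu> * Poly_Mapping.lookup Q \<nu>)) \<xi>)" for \<xi>
      unfolding PQ mpol_eval_single mpol_monom_add
        mpol_eval_superset[OF finite_keys order_refl, of P]
        mpol_eval_superset[OF finite_keys order_refl, of Q]
      by (simp add: sum_product sum.cartesian_product algebra_simps)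
    then have "(\<lambda>\<xi>. p \<xi> * q \<xi>) = (\<lambda>\<xi>. \<Sum>z\<in>Poly_Mapping.keys P \<times> Poly_Mapping.keys Q.
        mpol_eval (case z of (\<mu>, \<nu>) \<Rightarrow>
          Poly_Mapping.single (\<mu> + \<nu>) (Poly_Mapping.lookup P \<mu> * Poly_Mapping.lookup Q \<nu>)) \<xi>)"
      by (simp add: fun_eq_iff case_prod_unfold)
    also have "\<dots> \<in> range mpol_eval"
      by (rule mpol_eval_sum_in_range) auto
    finally show ?case .
  qed
qed

lemma polyfun_mpol_eval: "mpol_eval P \<in> polyfun"
  by (simp add: polyfun_eq_range_mpol_eval)

text \<open>A monomial is the list of its variables with repetitions. Its degree is the length of
  the list, and truncating by degree or by variables is a \<open>filter\<close>; the representation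
  is not unique.\<close>

definition list_eval :: "('k::comm_ring_1 \<times> 'x list) list \<Rightarrow> ('x \<Rightarrow> 'k) \<Rightarrow> 'k" where
  "list_eval ps \<xi> = (\<Sum>(a, xs)\<leftarrow>ps. a * (\<Prod>x\<leftarrow>xs. \<xi> x))"

lemma list_eval_simps [simp]:
  "list_eval [] \<xi> = 0"
  "list_eval ((a, xs) # ps) \<xi> = a * (\<Prod>x\<leftarrow>xs. \<xi> x) + list_eval ps \<xi>"
  "list_eval (ps @ qs) \<xi> = list_eval ps \<xi> + list_eval qs \<xi>"
  by (simp_all add: list_eval_def)

lemma polyfun_list_eval:
  "p \<in> polyfun \<Longrightarrow> \<exists>ps. p = list_eval ps"
proof (induction p rule: polyfun.induct)
  case (const a)
  show ?case by (rule exI[of _ "[(a, [])]"]) (simp add: fun_eq_iff)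
next
  case (coord x)
  show ?case by (rule exI[of _ "[(1, [x])]"]) (simp add: fun_eq_iff)
next
  case (add p q)
  then obtain ps qs where "p = list_eval ps" "q = list_eval qs" by blast
  then show ?case by (intro exI[of _ "ps @ qs"]) (simp add: fun_eq_iff)
next
  case (mult p q)
  then obtain ps qs where pq: "p = list_eval ps" "q = list_eval qs" by blast
  have 1: "list_eval (map (\<lambda>(b, ys). (a * b, xs @ ys)) qs) \<xi> =
      a * (\<Prod>x\<leftarrow>xs. \<xi> x) * list_eval qs \<xi>" for a xs and \<xi> :: "'a \<Rightarrow> 'b"
    by (induction qs) (auto simp: algebra_simps)
  have "\<exists>rs. \<forall>\<xi>. list_eval rs \<xi> = list_eval ps \<xi> * list_eval qs \<xi>"
  proof (induction ps)
    case Nil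
    show ?case by (rule exI[of _ "[]"]) simp
  next
    case (Cons z ps)
    obtain a xs where z: "z = (a, xs)" by fastforce
    from Cons obtain rs where "\<forall>\<xi>. list_eval rs \<xi> = list_eval ps \<xi> * list_eval qs \<xi>" by blast
    then show ?case
      by (intro exI[of _ "map (\<lambda>(b, ys). (a * b, xs @ ys)) qs @ rs"])
         (simp add: z 1 distrib_right)
  qed
  then show ?case by (auto simp: pq fun_eq_iff eq_commute)
qed

lemma polyfun_finite_support:
  "p \<in> polyfun \<Longrightarrow> \<exists>F. finite F \<and> (\<forall>\<xi> \<xi>'. (\<forall>x\<in>F. \<xi> x = \<xi>' x) \<longrightarrow> p \<xi> = p \<xi>')"
proof (induction p rule: polyfun.induct)
  case (coord x)
  show ?case by (rule exI[of _ "{x}"]) auto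
next
  case (add p q)
  then obtain F G where FG: "finite F" "\<And>\<xi> \<xi>'. (\<forall>x\<in>F. \<xi> x = \<xi>' x) \<Longrightarrow> p \<xi> = p \<xi>'"
    "finite G" "\<And>\<xi> \<xi>'. (\<forall>x\<in>G. \<xi> x = \<xi>' x) \<Longrightarrow> q \<xi> = q \<xi>'" by metis
  then show ?case
    by (intro exI[of _ "F \<union> G"]) (auto intro!: arg_cong2[where f = "(+)"])
next
  case (mult p q)
  then obtain F G where FG: "finite F" "\<And>\<xi> \<xi>'. (\<forall>x\<in>F. \<xi> x = \<xi>' x) \<Longrightarrow> p \<xi> = p \<xi>'"
    "finite G" "\<And>\<xi> \<xi>'. (\<forall>x\<in>G. \<xi> x = \<xi>' x) \<Longrightarrow> q \<xi> = q \<xi>'" by metis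
  then show ?case
    by (intro exI[of _ "F \<union> G"]) (auto intro!: arg_cong2[where f = "(*)"])
qed auto

text \<open>The bound \<open>d\<close> comes before the line: it plays the role of the total degree
  without a formal polynomial being chosen.\<close>

lemma polyfun_line:
  "p \<in> polyfun \<Longrightarrow>
    \<exists>d. \<forall>a b. \<exists>r. degree r \<le> d \<and> (\<forall>t. p (\<lambda>x. a x + t * b x) = poly r t)"
proof (induction p rule: polyfun.induct)
  case (const c)
  show ?case by (rule exI[of _ 0], intro allI exI[of _ "[:c:]"]) simp
next
  case (coord x)
  have "degree [:a x, b x:] \<le> 1 \<and> (\<forall>t. a x + t * b x = poly [:a x, b x:] t)"
    for a b :: "'a \<Rightarrow> 'b" by (simp add: mult.commute)
  then show ?case by blast
next
  case (add p q)
  then obtain d e where "\<forall>a b. \<exists>r. degree r \<le> d \<and> (\<forall>t. p (\<lambda>x. a x + t * b x) = poly r t)"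
    "\<forall>a b. \<exists>r. degree r \<le> e \<and> (\<forall>t. q (\<lambda>x. a x + t * b x) = poly r t)" by blast
  then have "\<forall>a b. \<exists>r. degree r \<le> max d e \<and>
      (\<forall>t. p (\<lambda>x. a x + t * b x) + q (\<lambda>x. a x + t * b x) = poly r t)"
    by (metis degree_add_le max.coboundedI1 max.coboundedI2 poly_add)
  then show ?case by blast
next
  case (mult p q)
  then obtain d e where de: "\<forall>a b. \<exists>r. degree r \<le> d \<and> (\<forall>t. p (\<lambda>x. a x + t * b x) = poly r t)"
    "\<forall>a b. \<exists>r. degree r \<le> e \<and> (\<forall>t. q (\<lambda>x. a x + t * b x) = poly r t)" by blast
  have "\<exists>r. degree r \<le> d + e \<and>
      (\<forall>t. p (\<lambda>x. a x + t * b x) * q (\<lambda>x. a x + t * b x) = poly r t)" for a b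
  proof -
    obtain r1 r2 where "degree r1 \<le> d" "\<forall>t. p (\<lambda>x. a x + t * b x) = poly r1 t"
      "degree r2 \<le> e" "\<forall>t. q (\<lambda>x. a x + t * b x) = poly r2 t" using de by metis
    then show ?thesis
      using degree_mult_le[of r1 r2] by (intro exI[of _ "r1 * r2"]) auto
  qed
  then show ?case by blast
qed

text \<open>
  This exhibits the coefficients of a polynomial as combinations of its values, so that the
  coefficients of a regular family become regular functions of the parameter.
\<close>

lemma interpolation:
  fixes B :: "('c \<Rightarrow> 'k::field) set"
  assumes "finite B" "B \<subseteq> V" and V: "\<And>f g a. f \<in> V \<Longrightarrow> g \<in> V \<Longrightarrow> (\<lambda>y. f y + a * g y) \<in> V"
  shows "\<exists>L. (\<forall>(c, e)\<in>set L. c \<in> Y \<and> e \<in> V) \<and> (\<forall>b\<in>B. \<forall>y\<in>Y. b y = (\<Sum>(c, e)\<leftarrow>L. b c * e y))"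
  using assms(1,2)
proof (induction B rule: finite_induct)
  case empty
  show ?case by (rule exI[of _ "[]"]) simp
next
  case (insert b0 B)
  then obtain L where L: "\<And>c e. (c, e) \<in> set L \<Longrightarrow> c \<in> Y \<and> e \<in> V"
    and eq: "\<And>b y. b \<in> B \<Longrightarrow> y \<in> Y \<Longrightarrow> b y = (\<Sum>(c, e)\<leftarrow>L. b c * e y)" by fast
  define T where "T p y = (\<Sum>(c, e)\<leftarrow>L. p c * e y)" for p :: "'c \<Rightarrow> 'k" and y
  \<comment> \<open>The error of \<open>b0\<close> under the interpolation found so far. As in
    Newton interpolation, a node where it does not vanish is added.\<close>
  define b where "b y = b0 y - T b0 y" for y
  show ?case
  proof (cases "\<forall>y\<in>Y. b y = 0")
    case True
    then show ?thesis using L eq by (intro exI[of _ L]) (auto simp: b_def T_def)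
  next
    case False
    then obtain x where x: "x \<in> Y" "b x \<noteq> 0" by blast
    \<comment> \<open>\<open>V\<close> is not assumed to contain 0, so a multiple of
      \<open>b0\<close> is written as \<open>b0\<close> plus \<open>a - 1\<close> times
      \<open>b0\<close>.\<close>
    have "(\<lambda>y. a * b0 y) \<in> V" for a
      using V[of b0 b0 "a - 1"] insert.prems by (simp add: algebra_simps)
    moreover have "(\<lambda>y. g y + a * (\<Sum>(c, e)\<leftarrow>K. p c * e y)) \<in> V"
      if "g \<in> V" "set K \<subseteq> set L" for g a p K
      using that
    proof (induction K arbitrary: g)
      case (Cons z K)
      obtain c e where z: "z = (c, e)" by fastforce
      have "(\<lambda>y. (g y + (a * p c) * e y) + a * (\<Sum>(c, e)\<leftarrow>K. p c * e y)) \<in> V"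
        using Cons.prems L[of c e] by (intro Cons.IH V) (auto simp: z)
      then show ?case by (simp add: z algebra_simps)
    qed simp
    ultimately have "(\<lambda>y. (1 / b x) * b0 y + (- 1 / b x) * T b0 y) \<in> V"
      unfolding T_def by blast
    moreover define e' where "e' y = b y / b x" for y
    moreover have "e' = (\<lambda>y. (1 / b x) * b0 y + (- 1 / b x) * T b0 y)"
      by (simp add: e'_def b_def fun_eq_iff diff_divide_distrib)
    ultimately have e': "e' \<in> V" by simp
    \<comment> \<open>\<open>e'\<close> is 1 at the new node, and the old functions are corrected to
      vanish there. On \<open>B\<close> nothing changes, since the old interpolation is already
      exact at \<open>x\<close>.\<close>
    define L' where "L' = (x, e') # map (\<lambda>(c, e). (c, \<lambda>y. e y - e x * e' y)) L"
    have L': "(\<Sum>(c, e)\<leftarrow>L'. p c * e y) = T p y + (p x - T p x) * e' y" for p y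
    proof -
      have "(\<Sum>(c, e)\<leftarrow>map (\<lambda>(c, e). (c, \<lambda>y. e y - e x * e' y)) K. p c * e y) =
          (\<Sum>(c, e)\<leftarrow>K. p c * e y) - (\<Sum>(c, e)\<leftarrow>K. p c * e x) * e' y" for K
        by (induction K) (auto simp: algebra_simps)
      then show ?thesis by (simp add: L'_def T_def algebra_simps)
    qed
    have "c \<in> Y \<and> e \<in> V" if "(c, e) \<in> set L'" for c e
      using that x(1) e' L V[of _ e' "- _"] by (auto simp: L'_def)
    moreover have "p y = (\<Sum>(c, e)\<leftarrow>L'. p c * e y)" if "p \<in> insert b0 B" "y \<in> Y" for p y
    proof (cases "p = b0")
      case True
      then show ?thesis using x(2) unfolding L' by (simp add: e'_def b_def)
    next
      case False
      then have "p \<in> B" using that by blast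
      then show ?thesis using eq[of p y] eq[of p x] x(1) that(2) unfolding L' by (simp add: T_def)
    qed
    ultimately show ?thesis by (intro exI[of _ L']) auto
  qed
qed

section \<open>Zariski open sets and subvarieties\<close>

lemma zariski_open_nonzero: "p \<in> polyfun \<Longrightarrow> zariski_open {\<xi>. p \<xi> \<noteq> 0}"
proof -
  assume "p \<in> polyfun"
  then obtain P where "p = mpol_eval P" by (auto simp: polyfun_eq_range_mpol_eval)
  then have "- {\<xi>. p \<xi> \<noteq> 0} = {\<xi>. \<forall>P\<in>{P}. mpol_eval P \<xi> = 0}" by auto
  then show ?thesis unfolding zariski_open_def zariski_closed_def by blast
qed

lemma zariski_openE:
  assumes "zariski_open W" "\<xi> \<in> W"
  obtains p where "p \<in> polyfun" "p \<xi> \<noteq> 0" "\<And>\<xi>'. p \<xi>' \<noteq> 0 \<Longrightarrow> \<xi>' \<in> W"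
proof -
  obtain \<P> where "- W = {\<xi>. \<forall>P\<in>\<P>. mpol_eval P \<xi> = 0}"
    using assms(1) unfolding zariski_open_def zariski_closed_def by blast
  then have W: "\<xi>' \<in> W \<longleftrightarrow> (\<exists>P\<in>\<P>. mpol_eval P \<xi>' \<noteq> 0)" for \<xi>' by (auto simp: set_eq_iff)
  then obtain P where "P \<in> \<P>" "mpol_eval P \<xi> \<noteq> 0" using assms(2) by blast
  with W show thesis by (intro that[of "mpol_eval P"] polyfun_mpol_eval) auto
qed

lemma zariski_open_UNIV: "zariski_open UNIV"
  using zariski_open_nonzero[OF polyfun.const[of 1]] by simp

lemma zariski_closed_UNIV: "zariski_closed UNIV"
  unfolding zariski_closed_def by (rule exI[of _ "{}"]) simp

lemma zariski_closed_Int: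
  "zariski_closed A \<Longrightarrow> zariski_closed B \<Longrightarrow> zariski_closed (A \<inter> B)"
  unfolding zariski_closed_def
proof (elim exE)
  fix \<P> \<Q> :: "('a, 'b) mpol set"
  assume "A = {\<xi>. \<forall>P\<in>\<P>. mpol_eval P \<xi> = 0}" "B = {\<xi>. \<forall>P\<in>\<Q>. mpol_eval P \<xi> = 0}"
  then show "\<exists>\<P>. A \<inter> B = {\<xi>. \<forall>P\<in>\<P>. mpol_eval P \<xi> = 0}"
    by (intro exI[of _ "\<P> \<union> \<Q>"]) auto
qed

text \<open>In a domain a product is nonzero where both factors are. As equations of the complement
  all polynomials vanishing on it are taken, so the products need not be listed.\<close>

lemma zariski_open_Int:
  fixes V W :: "('x \<Rightarrow> 'k::idom) set"
  assumes "zariski_open V" "zariski_open W"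
  shows "zariski_open (V \<inter> W)"
proof -
  define \<P> :: "('x, 'k) mpol set" where "\<P> = {P. \<forall>\<xi>\<in>- (V \<inter> W). mpol_eval P \<xi> = 0}"
  have "\<xi> \<in> V \<inter> W \<longleftrightarrow> (\<exists>P\<in>\<P>. mpol_eval P \<xi> \<noteq> 0)" for \<xi>
  proof
    assume "\<xi> \<in> V \<inter> W"
    then obtain p q where "p \<in> polyfun" "p \<xi> \<noteq> 0" "\<And>\<xi>'. p \<xi>' \<noteq> 0 \<Longrightarrow> \<xi>' \<in> V"
      "q \<in> polyfun" "q \<xi> \<noteq> 0" "\<And>\<xi>'. q \<xi>' \<noteq> 0 \<Longrightarrow> \<xi>' \<in> W"
      using assms by (elim IntE) (metis zariski_openE)
    moreover from this obtain P where "(\<lambda>\<xi>. p \<xi> * q \<xi>) = mpol_eval P"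
      using polyfun.mult[of p q] by (auto simp: polyfun_eq_range_mpol_eval)
    ultimately show "\<exists>P\<in>\<P>. mpol_eval P \<xi> \<noteq> 0"
      by (intro bexI[of _ P]) (auto simp: \<P>_def fun_eq_iff simp flip: \<open>_ = mpol_eval P\<close>)
  qed (auto simp: \<P>_def)
  then have "- (V \<inter> W) = {\<xi>. \<forall>P\<in>\<P>. mpol_eval P \<xi> = 0}" by blast
  then show ?thesis unfolding zariski_open_def zariski_closed_def by blast
qed

lemma subvariety_UNIV: "subvariety UNIV"
  unfolding subvariety_def using zariski_open_UNIV zariski_closed_UNIV by blast

lemma subvariety_Int:
  fixes Y Z :: "('x \<Rightarrow> 'k::idom) set"
  shows "subvariety Y \<Longrightarrow> subvariety Z \<Longrightarrow> subvariety (Y \<inter> Z)"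
proof -
  assume "subvariety Y" "subvariety Z"
  then obtain V W A B where "zariski_open V" "zariski_closed A" "Y = V \<inter> A"
    "zariski_open W" "zariski_closed B" "Z = W \<inter> B" unfolding subvariety_def by blast
  then show ?thesis
    unfolding subvariety_def
    by (intro exI[of _ "V \<inter> W"] exI[of _ "A \<inter> B"]) (auto intro: zariski_open_Int zariski_closed_Int)
qed

text \<open>
  Clearing denominators: multiplying \<open>P\<close> and \<open>Q\<close> by a polynomial that vanishes off \<open>W\<close> turns the
  local identity \<open>g = P / Q\<close> on \<open>W\<close> into the identity \<open>g Q = P\<close> on all of \<open>Z \<times> Y\<close>.
\<close>

lemma locally_quotient_iff:
  "locally_quotient Z Y g \<longleftrightarrow>
    (\<forall>s0\<in>Z. \<forall>c0\<in>Y. \<exists>P Q. P \<in> polyfun \<and> Q \<in> polyfun \<and> Q (joint_coords s0 c0) \<noteq> 0 \<and>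
       (\<forall>s\<in>Z. \<forall>c\<in>Y. g s c * Q (joint_coords s c) = P (joint_coords s c)))"
  (is "_ \<longleftrightarrow> (\<forall>s0\<in>Z. \<forall>c0\<in>Y. ?loc s0 c0)")
proof (intro iffI ballI)
  fix s0 c0 assume lq: "locally_quotient Z Y g" and s0: "s0 \<in> Z" "c0 \<in> Y"
  from lq[unfolded locally_quotient_def, rule_format, OF s0]
  obtain W P Q where W: "zariski_open W" "joint_coords s0 c0 \<in> W"
    and PQ: "\<And>s c. s \<in> Z \<Longrightarrow> c \<in> Y \<Longrightarrow> joint_coords s c \<in> W \<Longrightarrow>
         mpol_eval Q (joint_coords s c) \<noteq> 0 \<and>
         g s c = mpol_eval P (joint_coords s c) / mpol_eval Q (joint_coords s c)"
    by blast
  obtain R where R: "R \<in> polyfun" "R (joint_coords s0 c0) \<noteq> 0" "\<And>\<xi>. R \<xi> \<noteq> 0 \<Longrightarrow> \<xi> \<in> W"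
    using zariski_openE[OF W] by blast
  have "g s c * (mpol_eval Q (joint_coords s c) * R (joint_coords s c)) =
      mpol_eval P (joint_coords s c) * R (joint_coords s c)" if "s \<in> Z" "c \<in> Y" for s c
    using PQ[OF that] R(3)[of "joint_coords s c"] by (cases "R (joint_coords s c) = 0") auto
  then show "?loc s0 c0"
    using R(1,2) PQ[OF s0 W(2)]
    by - (rule exI[of _ "\<lambda>\<xi>. mpol_eval P \<xi> * R \<xi>"],
          rule exI[of _ "\<lambda>\<xi>. mpol_eval Q \<xi> * R \<xi>"],
          intro conjI polyfun.mult polyfun_mpol_eval ballI, simp_all)
next
  assume loc: "\<forall>s0\<in>Z. \<forall>c0\<in>Y. ?loc s0 c0"
  show "locally_quotient Z Y g"
    unfolding locally_quotient_def
  proof (intro ballI)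
    fix s0 c0 assume "s0 \<in> Z" "c0 \<in> Y"
    then obtain P Q where P: "P \<in> polyfun" and Q: "Q \<in> polyfun" "Q (joint_coords s0 c0) \<noteq> 0"
      and eq: "\<And>s c. s \<in> Z \<Longrightarrow> c \<in> Y \<Longrightarrow> g s c * Q (joint_coords s c) = P (joint_coords s c)"
      using loc by blast
    obtain P' Q' where "P = mpol_eval P'" "Q = mpol_eval Q'"
      using P Q(1) by (auto simp: polyfun_eq_range_mpol_eval)
    then show "\<exists>W. zariski_open W \<and> joint_coords s0 c0 \<in> W \<and>
        (\<exists>P Q. \<forall>s\<in>Z. \<forall>c\<in>Y. joint_coords s c \<in> W \<longrightarrow>
           mpol_eval Q (joint_coords s c) \<noteq> 0 \<and>
           g s c = mpol_eval P (joint_coords s c) / mpol_eval Q (joint_coords s c))"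
      using Q eq
      by - (rule exI[of _ "{\<xi>. Q \<xi> \<noteq> 0}"], intro conjI zariski_open_nonzero, simp, simp,
          rule exI[of _ P'], rule exI[of _ Q'],
          simp add: nonzero_eq_divide_eq)
  qed
qed

section \<open>Regular families as polynomials over the regular functions of the parameter\<close>

text \<open>The cord-free counterpart of \<open>regular_scalar_family\<close>, with denominators
  cleared from the start. These functions are the coefficients of the normal form.\<close>

definition regular_fun :: "('q \<Rightarrow> 'k::field) set \<Rightarrow> (('q \<Rightarrow> 'k) \<Rightarrow> 'k) \<Rightarrow> bool" where
  "regular_fun S a \<longleftrightarrow>
     (\<exists>Z g. subvariety Z \<and> S \<subseteq> Z \<and> (\<forall>s\<in>S. a s = g s) \<and>
        (\<forall>s0\<in>Z. \<exists>P Q. P \<in> polyfun \<and> Q \<in> polyfun \<and> Q s0 \<noteq> 0 \<and> (\<forall>s\<in>Z. g s * Q s = P s)))"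

inductive_set regpoly :: "('q \<Rightarrow> 'k::field) set \<Rightarrow> (('q \<Rightarrow> 'k) \<Rightarrow> ('m, 'n, 'k) cords \<Rightarrow> 'k) set"
  for S where
  coef: "regular_fun S a \<Longrightarrow> (\<lambda>s c. a s) \<in> regpoly S"
| coord: "(\<lambda>s c. c i \<alpha>) \<in> regpoly S"
| add: "\<phi> \<in> regpoly S \<Longrightarrow> \<psi> \<in> regpoly S \<Longrightarrow> (\<lambda>s c. \<phi> s c + \<psi> s c) \<in> regpoly S"
| mult: "\<phi> \<in> regpoly S \<Longrightarrow> \<psi> \<in> regpoly S \<Longrightarrow> (\<lambda>s c. \<phi> s c * \<psi> s c) \<in> regpoly S"

definition polyfam ::
    "('q \<Rightarrow> 'k::field) set \<Rightarrow> ('m, 'n, 'k) cords set \<Rightarrow>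
     (('q \<Rightarrow> 'k) \<Rightarrow> ('m, 'n, 'k) cords \<Rightarrow> ('p, 'n, 'k) cords) \<Rightarrow> bool" where
  "polyfam S Y f \<longleftrightarrow> (\<forall>j \<alpha>. \<exists>\<psi>\<in>regpoly S. \<forall>s\<in>S. \<forall>c\<in>Y. f s c j \<alpha> = \<psi> s c)"

lemma regular_funI:
  assumes "subvariety Z" "S \<subseteq> Z" "\<And>s. s \<in> S \<Longrightarrow> a s = g s"
    "\<And>s0. s0 \<in> Z \<Longrightarrow>
      \<exists>P Q. P \<in> polyfun \<and> Q \<in> polyfun \<and> Q s0 \<noteq> 0 \<and> (\<forall>s\<in>Z. g s * Q s = P s)"
  shows "regular_fun S a"
  unfolding regular_fun_def
  by (rule exI[of _ Z], rule exI[of _ g], intro conjI ballI)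
     (erule (1) assms | erule assms | rule assms)+

lemma regular_scalar_familyI:
  assumes "subvariety Z" "S \<subseteq> Z" "locally_quotient Z Y g"
    "\<And>s c. s \<in> S \<Longrightarrow> c \<in> Y \<Longrightarrow> \<phi> s c = g s c"
  shows "regular_scalar_family S Y \<phi>"
  unfolding regular_scalar_family_def
  by (rule exI[of _ Z], rule exI[of _ g], intro conjI ballI)
     (erule (1) assms | erule assms | rule assms)+

lemma regular_scalar_familyE:
  assumes "regular_scalar_family S Y \<phi>"
  obtains Z g where "subvariety Z" "S \<subseteq> Z" "locally_quotient Z Y g"
    "\<forall>s\<in>S. \<forall>c\<in>Y. \<phi> s c = g s c"
  using assms unfolding regular_scalar_family_def by (elim exE conjE)

lemma regular_fun_const: "regular_fun S (\<lambda>_. a)"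
proof (rule regular_funI[OF subvariety_UNIV])
  fix s0 :: "'a \<Rightarrow> 'b"
  show "\<exists>P Q. P \<in> polyfun \<and> Q \<in> polyfun \<and> Q s0 \<noteq> 0 \<and> (\<forall>s\<in>UNIV. a * Q s = P s)"
    by - (rule exI[of _ "\<lambda>_. a"], rule exI[of _ "\<lambda>_. 1"],
          simp add: polyfun.const)
qed auto

lemma joint_coords_polyfun: "(\<lambda>s. joint_coords s c x) \<in> polyfun"
  by (cases x) (auto simp: joint_coords_def intro: polyfun.intros)

text \<open>Freezing the cord leaves a regular function of the parameter. Values at interpolation
  nodes enter the normal form in this way.\<close>

lemma regular_fun_eval:
  assumes "regular_scalar_family S Y \<phi>" "c \<in> Y"
  shows "regular_fun S (\<lambda>s. \<phi> s c)"
proof -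
  obtain Z g where Z: "subvariety Z" "S \<subseteq> Z" "locally_quotient Z Y g"
    "\<forall>s\<in>S. \<forall>c\<in>Y. \<phi> s c = g s c"
    using assms(1) by (rule regular_scalar_familyE)
  have "\<exists>P Q. P \<in> polyfun \<and> Q \<in> polyfun \<and> Q s0 \<noteq> 0 \<and> (\<forall>s\<in>Z. g s c * Q s = P s)"
    if s0: "s0 \<in> Z" for s0
  proof -
    obtain P Q where "P \<in> polyfun" "Q \<in> polyfun" "Q (joint_coords s0 c) \<noteq> 0"
      "\<And>s c. s \<in> Z \<Longrightarrow> c \<in> Y \<Longrightarrow> g s c * Q (joint_coords s c) = P (joint_coords s c)"
      using Z(3)[unfolded locally_quotient_iff, THEN bspec, THEN bspec, OF s0 assms(2)] by blast
    moreover have sub: "(\<lambda>s. p (joint_coords s c)) \<in> polyfun" if "p \<in> polyfun" for p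
      by (rule polyfun_subst[OF that joint_coords_polyfun])
    ultimately show ?thesis
      using assms(2)
      by - (rule exI[of _ "\<lambda>s. P (joint_coords s c)"],
          rule exI[of _ "\<lambda>s. Q (joint_coords s c)"], intro conjI sub, simp_all)
  qed
  moreover have "\<phi> s c = g s c" if "s \<in> S" for s using Z(4) that assms(2) by blast
  ultimately show ?thesis
    using regular_funI[OF Z(1,2), of "\<lambda>s. \<phi> s c" "\<lambda>s. g s c"] by simp
qed

lemma regular_scalar_family_add_mult:
  assumes "regular_scalar_family S Y \<phi>" "regular_scalar_family S Y \<psi>"
  shows "regular_scalar_family S Y (\<lambda>s c. \<phi> s c + \<psi> s c)" (is ?A)
    and "regular_scalar_family S Y (\<lambda>s c. \<phi> s c * \<psi> s c)" (is ?M)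
proof -
  obtain Z g where Z: "subvariety Z" "S \<subseteq> Z" "locally_quotient Z Y g"
    "\<forall>s\<in>S. \<forall>c\<in>Y. \<phi> s c = g s c"
    using assms(1) by (rule regular_scalar_familyE)
  obtain Z' g' where Z': "subvariety Z'" "S \<subseteq> Z'" "locally_quotient Z' Y g'"
    "\<forall>s\<in>S. \<forall>c\<in>Y. \<psi> s c = g' s c"
    using assms(2) by (rule regular_scalar_familyE)
  \<comment> \<open>The product of the two local denominators is a common denominator on the
    intersection.\<close>
  have "locally_quotient (Z \<inter> Z') Y (\<lambda>s c. g s c + g' s c) \<and>
      locally_quotient (Z \<inter> Z') Y (\<lambda>s c. g s c * g' s c)"
    unfolding locally_quotient_iff
  proof (intro conjI ballI)
    fix s0 c0 assume "s0 \<in> Z \<inter> Z'" and c0: "c0 \<in> Y"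
    then have s0: "s0 \<in> Z" "s0 \<in> Z'" by auto
    obtain P Q where PQ: "P \<in> polyfun" "Q \<in> polyfun" "Q (joint_coords s0 c0) \<noteq> 0"
      "\<And>s c. s \<in> Z \<Longrightarrow> c \<in> Y \<Longrightarrow> g s c * Q (joint_coords s c) = P (joint_coords s c)"
      using Z(3)[unfolded locally_quotient_iff, rule_format, OF s0(1) c0] by blast
    obtain P' Q' where PQ': "P' \<in> polyfun" "Q' \<in> polyfun" "Q' (joint_coords s0 c0) \<noteq> 0"
      "\<And>s c. s \<in> Z' \<Longrightarrow> c \<in> Y \<Longrightarrow> g' s c * Q' (joint_coords s c) = P' (joint_coords s c)"
      using Z'(3)[unfolded locally_quotient_iff, rule_format, OF s0(2) c0] by blast
    show "\<exists>P Q. P \<in> polyfun \<and> Q \<in> polyfun \<and> Q (joint_coords s0 c0) \<noteq> 0 \<and>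
        (\<forall>s\<in>Z \<inter> Z'. \<forall>c\<in>Y. (g s c + g' s c) * Q (joint_coords s c) = P (joint_coords s c))"
      using PQ(1-3) PQ'(1-3)
      by - (rule exI[of _ "\<lambda>\<xi>. P \<xi> * Q' \<xi> + P' \<xi> * Q \<xi>"],
          rule exI[of _ "\<lambda>\<xi>. Q \<xi> * Q' \<xi>"], intro conjI polyfun.add polyfun.mult,
          simp_all add: PQ(4)[symmetric] PQ'(4)[symmetric] algebra_simps)
    show "\<exists>P Q. P \<in> polyfun \<and> Q \<in> polyfun \<and> Q (joint_coords s0 c0) \<noteq> 0 \<and>
        (\<forall>s\<in>Z \<inter> Z'. \<forall>c\<in>Y. (g s c * g' s c) * Q (joint_coords s c) = P (joint_coords s c))"
      using PQ(1-3) PQ'(1-3)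
      by - (rule exI[of _ "\<lambda>\<xi>. P \<xi> * P' \<xi>"],
          rule exI[of _ "\<lambda>\<xi>. Q \<xi> * Q' \<xi>"], intro conjI polyfun.mult,
          simp_all add: PQ(4)[symmetric] PQ'(4)[symmetric] algebra_simps)
  qed
  then show ?A ?M
    using Z(1,2) Z'(1,2)
      regular_scalar_familyI[of "Z \<inter> Z'" S Y "\<lambda>s c. g s c + g' s c" "\<lambda>s c. \<phi> s c + \<psi> s c"]
      regular_scalar_familyI[of "Z \<inter> Z'" S Y "\<lambda>s c. g s c * g' s c" "\<lambda>s c. \<phi> s c * \<psi> s c"]
    by (simp_all add: subvariety_Int Z(4) Z'(4))
qed

lemma regpoly_regular: "\<psi> \<in> regpoly S \<Longrightarrow> regular_scalar_family S Y \<psi>"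
proof (induction rule: regpoly.induct)
  case (coef a)
  then obtain Z g where Z: "subvariety Z" "S \<subseteq> Z" "\<forall>s\<in>S. a s = g s"
    and loc: "\<And>s0. s0 \<in> Z \<Longrightarrow> \<exists>P Q. P \<in> polyfun \<and> Q \<in> polyfun \<and> Q s0 \<noteq> 0 \<and> (\<forall>s\<in>Z. g s * Q s = P s)"
    unfolding regular_fun_def by blast
  have "locally_quotient Z Y (\<lambda>s c. g s)"
    unfolding locally_quotient_iff
  proof (intro ballI)
    fix s0 c0 assume "s0 \<in> Z"
    from loc[OF this] obtain P Q where
      "P \<in> polyfun" "Q \<in> polyfun" "Q s0 \<noteq> 0" "\<forall>s\<in>Z. g s * Q s = P s" by blast
    moreover have sub: "(\<lambda>\<xi>. p (\<lambda>x. \<xi> (Inl x))) \<in> polyfun" if "p \<in> polyfun" for p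
      by (rule polyfun_subst[OF that polyfun.coord])
    ultimately show "\<exists>P Q. P \<in> polyfun \<and> Q \<in> polyfun \<and> Q (joint_coords s0 c0) \<noteq> 0 \<and>
        (\<forall>s\<in>Z. \<forall>c\<in>Y. g s * Q (joint_coords s c) = P (joint_coords s c))"
      by - (rule exI[of _ "\<lambda>\<xi>. P (\<lambda>x. \<xi> (Inl x))"],
          rule exI[of _ "\<lambda>\<xi>. Q (\<lambda>x. \<xi> (Inl x))"], intro conjI sub,
          simp_all add: joint_coords_def)
  qed
  then show ?case using Z(3) by (intro regular_scalar_familyI[OF Z(1,2)]) auto
next
  case (coord i \<alpha>)
  have "locally_quotient UNIV Y (\<lambda>s c. c i \<alpha>)"
    unfolding locally_quotient_iff
    by - (intro ballI, rule exI[of _ "\<lambda>\<xi>. \<xi> (Inr (i, \<alpha>))"],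
          rule exI[of _ "\<lambda>\<xi>. 1"], intro conjI polyfun.intros,
          auto simp: joint_coords_def)
  then show ?case by (rule regular_scalar_familyI[OF subvariety_UNIV, rotated]) auto
qed (auto intro: regular_scalar_family_add_mult)

lemma regpoly_polyfun:
  "\<psi> \<in> regpoly S \<Longrightarrow> \<exists>p\<in>polyfun. \<forall>c. \<psi> s c = p (\<lambda>(i, \<alpha>). c i \<alpha>)"
proof (induction rule: regpoly.induct)
  case (coef a)
  show ?case by (rule bexI[of _ "\<lambda>_. a s"]) (auto intro: polyfun.const)
next
  case (coord i \<alpha>)
  show ?case by (rule bexI[of _ "\<lambda>\<xi>. \<xi> (i, \<alpha>)"]) (auto intro: polyfun.coord)
next
  case (add \<phi> \<psi>)
  then obtain p q where "p \<in> polyfun" "q \<in> polyfun" "\<forall>c. \<phi> s c = p (\<lambda>(i, \<alpha>). c i \<alpha>)"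
    "\<forall>c. \<psi> s c = q (\<lambda>(i, \<alpha>). c i \<alpha>)" by blast
  then show ?case by (intro bexI[of _ "\<lambda>\<xi>. p \<xi> + q \<xi>"]) (auto intro: polyfun.add)
next
  case (mult \<phi> \<psi>)
  then obtain p q where "p \<in> polyfun" "q \<in> polyfun" "\<forall>c. \<phi> s c = p (\<lambda>(i, \<alpha>). c i \<alpha>)"
    "\<forall>c. \<psi> s c = q (\<lambda>(i, \<alpha>). c i \<alpha>)" by blast
  then show ?case by (intro bexI[of _ "\<lambda>\<xi>. p \<xi> * q \<xi>"]) (auto intro: polyfun.mult)
qed

lemma textile_iff:
  "textile F \<longleftrightarrow> (\<forall>j \<alpha>. \<exists>p\<in>polyfun. \<forall>c. F c j \<alpha> = p (\<lambda>(i, \<beta>). c i \<beta>))"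
  unfolding textile_def polyfun_eq_range_mpol_eval by blast

lemma textile_onI:
  assumes "\<And>j \<alpha>. \<exists>p\<in>polyfun. \<forall>c\<in>Y. F c j \<alpha> = p (\<lambda>(i, \<beta>). c i \<beta>)"
  shows "textile_on Y F"
proof -
  have "\<forall>j \<alpha>. \<exists>p. p \<in> polyfun \<and> (\<forall>c\<in>Y. F c j \<alpha> = p (\<lambda>(i, \<beta>). c i \<beta>))" using assms by blast
  then obtain p where p: "\<And>j \<alpha>. p j \<alpha> \<in> polyfun"
    "\<And>j \<alpha> c. c \<in> Y \<Longrightarrow> F c j \<alpha> = p j \<alpha> (\<lambda>(i, \<beta>). c i \<beta>)" by metis
  then show ?thesis
    unfolding textile_on_def textile_iff
    by (intro exI[of _ "\<lambda>c j \<alpha>. p j \<alpha> (\<lambda>(i, \<beta>). c i \<beta>)"]) (auto simp: fun_eq_iff)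
qed

lemma textile_onD:
  "textile_on Y F \<Longrightarrow> \<exists>p\<in>polyfun. \<forall>c\<in>Y. F c j \<alpha> = p (\<lambda>(i, \<beta>). c i \<beta>)"
  unfolding textile_on_def textile_iff by metis

lemma regular_family_if_polyfam:
  assumes "polyfam S Y f"
  shows "regular_family S Y f"
  unfolding regular_family_def
proof (intro conjI ballI allI)
  fix s assume "s \<in> S"
  then show "textile_on Y (f s)"
    using assms unfolding polyfam_def by (intro textile_onI) (metis regpoly_polyfun)
next
  fix j \<alpha>
  obtain \<psi> where \<psi>: "\<psi> \<in> regpoly S" "\<forall>s\<in>S. \<forall>c\<in>Y. f s c j \<alpha> = \<psi> s c"
    using assms unfolding polyfam_def by blast
  obtain Z g where "subvariety Z" "S \<subseteq> Z" "locally_quotient Z Y g"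
    "\<forall>s\<in>S. \<forall>c\<in>Y. \<psi> s c = g s c"
    using regpoly_regular[OF \<psi>(1), of Y] by (rule regular_scalar_familyE)
  then show "regular_scalar_family S Y (\<lambda>s c. f s c j \<alpha>)"
    using \<psi>(2) by (intro regular_scalar_familyI[of Z S Y g]) auto
qed

section \<open>Reduction of regular families to the normal form\<close>

lemma zero_in_madic: "(0 :: ('m::finite, 'n::finite, 'k::comm_ring_1) cords) \<in> madic l"
  by (simp add: mem_madic_iff enat_le_cords_ord_iff)

lemma add_in_madic: "v \<in> madic l \<Longrightarrow> w \<in> madic l \<Longrightarrow> v + w \<in> madic l"
  for v :: "('m::finite, 'n::finite, 'k::comm_ring_1) cords"
  by (simp add: mem_madic_iff enat_le_cords_ord_iff)

lemma diff_in_madic: "v \<in> madic l \<Longrightarrow> w \<in> madic l \<Longrightarrow> v - w \<in> madic l"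
  for v :: "('m::finite, 'n::finite, 'k::comm_ring_1) cords"
  by (simp add: mem_madic_iff enat_le_cords_ord_iff)

lemma cscale_in_madic: "v \<in> madic l \<Longrightarrow> cscale t v \<in> madic l"
  for v :: "('m::finite, 'n::finite, 'k::comm_ring_1) cords"
  by (simp add: mem_madic_iff enat_le_cords_ord_iff cscale_def)

lemma degree_le_of_mult:
  fixes p q r :: "'k::idom poly"
  assumes "p * q = r" "q \<noteq> 0" "degree r \<le> d"
  shows "degree p \<le> d"
  using assms by (cases "p = 0") (auto simp: degree_mult_eq)

text \<open>
  Near a parameter \<open>s0\<close> we have \<open>f Q = P\<close> with \<open>Q(s, 0) \<noteq> 0\<close>.  Restricted to the lines \<open>t \<mapsto> t v\<close>
  this is an identity of univariate polynomials; it shows that \<open>f s\<close> has degree at most that of \<open>P\<close>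
  and involves only variables occurring in \<open>P\<close> or \<open>Q\<close>.
\<close>

lemma local_monomial_bound:
  fixes \<phi> :: "('q \<Rightarrow> 'k::field_char_0) \<Rightarrow> ('m::finite, 'n::finite, 'k) cords \<Rightarrow> 'k"
  assumes fam: "regular_scalar_family S (madic l) \<phi>"
    and pol: "\<And>s. s \<in> S \<Longrightarrow> \<exists>p\<in>polyfun. \<forall>c\<in>madic l. \<phi> s c = p (\<lambda>(i, \<beta>). c i \<beta>)"
    and s0: "s0 \<in> S"
  shows "\<exists>r F d. r \<in> polyfun \<and> r s0 \<noteq> 0 \<and> finite F \<and>
    (\<forall>s\<in>S. r s \<noteq> 0 \<longrightarrow> (\<exists>ps. (\<forall>(a, xs)\<in>set ps. length xs \<le> d \<and> set xs \<subseteq> F) \<and>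
       (\<forall>c\<in>madic l. \<phi> s c = list_eval ps (\<lambda>(i, \<beta>). c i \<beta>))))"
proof -
  let ?Y = "madic l :: ('m, 'n, 'k) cords set"
  obtain Z g where Z: "S \<subseteq> Z" "locally_quotient Z ?Y g" "\<forall>s\<in>S. \<forall>c\<in>?Y. \<phi> s c = g s c"
    using fam by (rule regular_scalar_familyE)
  have "s0 \<in> Z" using s0 Z(1) by blast
  obtain P Q where P: "P \<in> polyfun" and Q: "Q \<in> polyfun" "Q (joint_coords s0 0) \<noteq> 0"
    and gPQ: "\<And>s c. s \<in> Z \<Longrightarrow> c \<in> ?Y \<Longrightarrow> g s c * Q (joint_coords s c) = P (joint_coords s c)"
    using Z(2)[unfolded locally_quotient_iff, THEN bspec, THEN bspec, OF \<open>s0 \<in> Z\<close> zero_in_madic]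
    by blast
  have PQ: "\<phi> s c * Q (joint_coords s c) = P (joint_coords s c)" if "s \<in> S" "c \<in> ?Y" for s c
    using gPQ[of s c] Z(1,3) that by (auto simp: subset_iff)
  obtain FP FQ where FP: "finite FP" "\<And>\<xi> \<xi>'. (\<forall>x\<in>FP. \<xi> x = \<xi>' x) \<Longrightarrow> P \<xi> = P \<xi>'"
    and FQ: "finite FQ" "\<And>\<xi> \<xi>'. (\<forall>x\<in>FQ. \<xi> x = \<xi>' x) \<Longrightarrow> Q \<xi> = Q \<xi>'"
    using polyfun_finite_support[OF P] polyfun_finite_support[OF Q(1)] by blast
  define F where "F = Inr -` (FP \<union> FQ)"
  have F: "finite F" unfolding F_def using FP(1) FQ(1)
    by (intro finite_vimageI) (auto simp: inj_def)
  obtain d where d: "\<And>a b. \<exists>r. degree r \<le> d \<and> (\<forall>t. P (\<lambda>x. a x + t * b x) = poly r t)"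
    using polyfun_line[OF P] by blast
  obtain e where e: "\<And>a b. \<exists>r. degree r \<le> e \<and> (\<forall>t. Q (\<lambda>x. a x + t * b x) = poly r t)"
    using polyfun_line[OF Q(1)] by blast
  have line: "joint_coords s (cscale t v) = (\<lambda>x. joint_coords s 0 x + t * joint_coords 0 v x)"
    for s t and v :: "('m, 'n, 'k) cords"
    by (auto simp: joint_coords_def cscale_def fun_eq_iff split: sum.split)
  have main: "\<exists>ps. (\<forall>(a, xs)\<in>set ps. length xs \<le> d \<and> set xs \<subseteq> F) \<and>
       (\<forall>c\<in>madic l. \<phi> s c = list_eval ps (\<lambda>(i, \<beta>). c i \<beta>))"
    if s: "s \<in> S" and Qs: "Q (joint_coords s 0) \<noteq> 0" for s
  proof -
    obtain p where "p \<in> polyfun" "\<forall>c\<in>?Y. \<phi> s c = p (\<lambda>(i, \<beta>). c i \<beta>)"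
      using pol[OF s] by blast
    then obtain ps where ps: "\<And>c. c \<in> ?Y \<Longrightarrow> \<phi> s c = list_eval ps (\<lambda>(i, \<beta>). c i \<beta>)"
      using polyfun_list_eval by metis
    define co :: "('m, 'n, 'k) cords \<Rightarrow> 'm \<times> ('n \<Rightarrow> nat) \<Rightarrow> 'k" where "co c = (\<lambda>(i, \<beta>). c i \<beta>)" for c
    \<comment> \<open>\<open>p v\<close> restricts the coefficient to the line through
      \<open>v\<close>; a monomial of length \<open>i\<close> contributes exactly to the coefficient
      at \<open>i\<close>.\<close>
    define p where "p v = (\<Sum>(a, xs)\<leftarrow>ps. monom (a * (\<Prod>x\<leftarrow>xs. co v x)) (length xs))" for v
    have co_scale: "(\<Prod>x\<leftarrow>xs. co (cscale t v) x) = t ^ length xs * (\<Prod>x\<leftarrow>xs. co v x)" for t v xs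
      by (induction xs) (auto simp: co_def cscale_def)
    have "poly (\<Sum>(a, xs)\<leftarrow>qs. monom (a * (\<Prod>x\<leftarrow>xs. co v x)) (length xs)) t =
        list_eval qs (co (cscale t v))" for qs v t
      by (induction qs) (auto simp: poly_monom co_scale)
    then have p: "poly (p v) t = \<phi> s (cscale t v)" if "v \<in> ?Y" for v t
      using ps[OF cscale_in_madic[OF that]] by (simp add: p_def co_def)
    have "\<forall>v. \<exists>r. degree r \<le> e \<and> (\<forall>t. Q (joint_coords s (cscale t v)) = poly r t)"
      unfolding line by (rule allI) (rule e)
    from choice[OF this] obtain q where q: "\<And>v. degree (q v) \<le> e"
        "\<And>v t. Q (joint_coords s (cscale t v)) = poly (q v) t" by blast
    have "\<forall>v. \<exists>r. degree r \<le> d \<and> (\<forall>t. P (joint_coords s (cscale t v)) = poly r t)"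
      unfolding line by (rule allI) (rule d)
    from choice[OF this] obtain r where r: "\<And>v. degree (r v) \<le> d"
        "\<And>v t. P (joint_coords s (cscale t v)) = poly (r v) t" by blast
    have pqr: "p v * q v = r v" if "v \<in> ?Y" for v
      using PQ[OF s cscale_in_madic[OF that]] p[OF that] q(2) r(2)
      by (simp flip: poly_eq_poly_eq_iff add: fun_eq_iff)
    \<comment> \<open>All the lines pass through the cord 0 at \<open>t = 0\<close>, so a single
      condition on \<open>s\<close> serves every \<open>v\<close>.\<close>
    have q0: "q v \<noteq> 0" for v
      using q(2)[of 0 v] Qs by (auto simp: cscale_def zero_fun_def)
    have deg: "degree (p v) \<le> d" if "v \<in> ?Y" for v
      using degree_le_of_mult[OF pqr[OF that] q0 r(1)] .
    \<comment> \<open>\<open>R\<close> erases the coordinates outside \<open>F\<close>. Neither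
      \<open>P\<close> nor \<open>Q\<close> notices, so cancelling \<open>q v\<close> gives
      \<open>p (R v) = p v\<close>.\<close>
    define R :: "('m, 'n, 'k) cords \<Rightarrow> ('m, 'n, 'k) cords" where
      "R v = (\<lambda>i \<beta>. if (i, \<beta>) \<in> F then v i \<beta> else 0)" for v
    have R: "R v \<in> ?Y" if "v \<in> ?Y" for v
      using that by (auto simp: mem_madic_iff enat_le_cords_ord_iff R_def)
    have agree: "joint_coords s (cscale t (R v)) x = joint_coords s (cscale t v) x"
      if "x \<in> FP \<union> FQ" for x v t
      using that by (auto simp: joint_coords_def cscale_def R_def F_def split: sum.split)
    have "P (joint_coords s (cscale t (R v))) = P (joint_coords s (cscale t v))" for t v
      by (rule FP(2)) (simp add: agree)
    then have rR: "r (R v) = r v" for v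
      by (simp add: r(2) flip: poly_eq_poly_eq_iff add: fun_eq_iff)
    have "Q (joint_coords s (cscale t (R v))) = Q (joint_coords s (cscale t v))" for t v
      by (rule FQ(2)) (simp add: agree)
    then have qR: "q (R v) = q v" for v
      by (simp add: q(2) flip: poly_eq_poly_eq_iff add: fun_eq_iff)
    have pR: "p (R v) = p v" if "v \<in> ?Y" for v
      using pqr[OF that] pqr[OF R[OF that]] q0[of v]
      unfolding rR qR by (metis mult_right_cancel)
    define ps' where "ps' = filter (\<lambda>(a, xs). length xs \<le> d \<and> set xs \<subseteq> F) ps"
    have coR: "(\<Prod>x\<leftarrow>xs. co (R v) x) = (if set xs \<subseteq> F then (\<Prod>x\<leftarrow>xs. co v x) else 0)" for xs v
      by (induction xs) (auto simp: co_def R_def)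
    \<comment> \<open>Stopping the sum at \<open>d\<close> drops the monomials longer than
      \<open>d\<close>, and \<open>R\<close> drops those with a variable outside \<open>F\<close>.
      By the degree bound the sum is still the value at \<open>t = 1\<close>.\<close>
    have "(\<Sum>i\<le>d. coeff (\<Sum>(a, xs)\<leftarrow>qs. monom (a * (\<Prod>x\<leftarrow>xs. co (R v) x)) (length xs)) i) =
        list_eval (filter (\<lambda>(a, xs). length xs \<le> d \<and> set xs \<subseteq> F) qs) (co v)" for qs v
      by (induction qs) (auto simp: sum.distrib coR split: if_splits)
    then have "(\<Sum>i\<le>d. coeff (p (R v)) i) = list_eval ps' (co v)" for v
      by (simp add: p_def ps'_def)
    moreover have "(\<Sum>i\<le>d. coeff (p v) i) = poly (p v) 1" if "v \<in> ?Y" for v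
      using poly_altdef[of "p v" 1] deg[OF that]
      by (simp add: sum.mono_neutral_left[of "{..d}" "{..degree (p v)}"] coeff_eq_0)
    moreover have "poly (p v) 1 = \<phi> s v" if "v \<in> ?Y" for v
      using p[OF that, of 1] by (simp add: cscale_def)
    ultimately have "\<forall>c\<in>?Y. \<phi> s c = list_eval ps' (\<lambda>(i, \<beta>). c i \<beta>)"
      using pR by (metis co_def)
    then show ?thesis by - (rule exI[of _ ps'], auto simp: ps'_def)
  qed
  have "(\<lambda>s. Q (joint_coords s 0)) \<in> polyfun"
    by (rule polyfun_subst[OF Q(1) joint_coords_polyfun])
  then show ?thesis
    using Q(2) F main
    by - (rule exI[of _ "\<lambda>s. Q (joint_coords s 0)"], rule exI[of _ F], rule exI[of _ d], simp)
qed

lemma regpoly_const: "(\<lambda>s c. a) \<in> regpoly S"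
  by (rule regpoly.coef[OF regular_fun_const])

lemma regpoly_diff:
  assumes "\<phi> \<in> regpoly S" "\<psi> \<in> regpoly S"
  shows "(\<lambda>s c. \<phi> s c - \<psi> s c) \<in> regpoly S"
  using regpoly.add[OF assms(1) regpoly.mult[OF regpoly_const[of "-1"] assms(2)]] by simp

text \<open>Finitely many of the local bounds cover \<open>S\<close>, so one finite set
  \<open>B\<close> of monomials spans every \<open>\<phi> s\<close>. Interpolation then expresses
  \<open>\<phi> s\<close> through its own values at finitely many cords. These values are regular in
  \<open>s\<close>, whereas nothing is known about how the chosen lists of monomials depend on
  \<open>s\<close>.\<close>

lemma regular_scalar_family_regpoly:
  fixes \<phi> :: "('q::finite \<Rightarrow> 'k::field_char_0) \<Rightarrow> ('m::finite, 'n::finite, 'k) cords \<Rightarrow> 'k"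
  assumes fam: "regular_scalar_family S (madic l) \<phi>"
    and pol: "\<And>s. s \<in> S \<Longrightarrow> \<exists>p\<in>polyfun. \<forall>c\<in>madic l. \<phi> s c = p (\<lambda>(i, \<beta>). c i \<beta>)"
  shows "\<exists>\<psi>\<in>regpoly S. \<forall>s\<in>S. \<forall>c\<in>madic l. \<phi> s c = \<psi> s c"
proof -
  define co :: "('m, 'n, 'k) cords \<Rightarrow> 'm \<times> ('n \<Rightarrow> nat) \<Rightarrow> 'k" where "co c = (\<lambda>(i, \<beta>). c i \<beta>)" for c
  have "\<forall>s0\<in>S. \<exists>z. case z of (r, F, d) \<Rightarrow> r \<in> polyfun \<and> r s0 \<noteq> 0 \<and> finite F \<and>
    (\<forall>s\<in>S. r s \<noteq> 0 \<longrightarrow> (\<exists>ps. (\<forall>(a, xs)\<in>set ps. length xs \<le> d \<and> set xs \<subseteq> F) \<and>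
       (\<forall>c\<in>madic l. \<phi> s c = list_eval ps (co c))))"
    using local_monomial_bound[OF fam pol] unfolding co_def by simp
  from bchoice[OF this] obtain z where z: "\<forall>s0\<in>S. case z s0 of (r, F, d) \<Rightarrow>
    r \<in> polyfun \<and> r s0 \<noteq> 0 \<and> finite F \<and>
    (\<forall>s\<in>S. r s \<noteq> 0 \<longrightarrow> (\<exists>ps. (\<forall>(a, xs)\<in>set ps. length xs \<le> d \<and> set xs \<subseteq> F) \<and>
       (\<forall>c\<in>madic l. \<phi> s c = list_eval ps (co c))))" ..
  define r F d where "r s = fst (z s)" and "F s = fst (snd (z s))" and "d s = snd (snd (z s))" for s
  have r: "r s0 \<in> polyfun" "r s0 s0 \<noteq> 0" and F: "finite (F s0)" if "s0 \<in> S" for s0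
    using bspec[OF z that] by (auto simp: r_def F_def case_prod_unfold)
  have rep: "\<exists>ps. (\<forall>(a, xs)\<in>set ps. length xs \<le> d s0 \<and> set xs \<subseteq> F s0) \<and>
       (\<forall>c\<in>madic l. \<phi> s c = list_eval ps (co c))" if "s0 \<in> S" "s \<in> S" "r s0 s \<noteq> 0" for s0 s
    using bspec[OF z that(1)] that(2,3) by (simp add: r_def F_def d_def case_prod_unfold)
  have "r ` S \<subseteq> polyfun" using r(1) by blast
  from polyfun_noetherian_cover[OF this] obtain R0 where R0: "finite R0 \<and> R0 \<subseteq> r ` S \<and>
    (\<forall>\<xi>. (\<exists>p\<in>r ` S. p \<xi> \<noteq> 0) \<longrightarrow> (\<exists>p\<in>R0. p \<xi> \<noteq> 0))" ..
  then have "finite R0" "R0 \<subseteq> r ` S" by simp_all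
  from finite_subset_image[OF this] obtain S0 where S0: "S0 \<subseteq> S" "finite S0" "R0 = r ` S0"
    by (elim exE conjE)
  define G where "G = (\<Union>s\<in>S0. F s)"
  \<comment> \<open>The inserted 0 covers the case that \<open>S0\<close> is empty.\<close>
  define e where "e = Max (insert 0 (d ` S0))"
  have G: "finite G" using S0 F by (auto simp: G_def)
  define B where "B = (\<lambda>xs c. \<Prod>x\<leftarrow>xs. co c x) ` {xs. set xs \<subseteq> G \<and> length xs \<le> e}"
  have B: "finite B" unfolding B_def by (intro finite_imageI finite_lists_length_le G)
  \<comment> \<open>Functions of the cord alone, read as families constant in the parameter; the
    interpolating functions must remain of this kind.\<close>
  define V :: "(('m, 'n, 'k) cords \<Rightarrow> 'k) set" where "V = {b. (\<lambda>s c. b c) \<in> regpoly S}"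
  have "(\<lambda>c. \<Prod>x\<leftarrow>xs. co c x) \<in> V" for xs
    by (induction xs) (auto simp: V_def co_def intro: regpoly_const regpoly.intros)
  then have "B \<subseteq> V" by (auto simp: B_def)
  moreover have "(\<lambda>c. f c + a * g c) \<in> V" if "f \<in> V" "g \<in> V" for f g a
    using that unfolding V_def by (auto intro!: regpoly.add regpoly.mult regpoly_const)
  ultimately obtain L where L: "\<forall>(c, b)\<in>set L. c \<in> madic l \<and> b \<in> V"
    and B_eq: "\<forall>b\<in>B. \<forall>y\<in>madic l. b y = (\<Sum>(c, e)\<leftarrow>L. b c * e y)"
    using interpolation[OF B, of V "madic l"] by blast
  have \<phi>_eq: "\<phi> s y = (\<Sum>(c, b)\<leftarrow>L. \<phi> s c * b y)" if s: "s \<in> S" and y: "y \<in> madic l" for s y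
  proof -
    have "\<exists>p\<in>r ` S. p s \<noteq> 0" using r(2)[OF s] s by blast
    then obtain s0 where s0: "s0 \<in> S0" "r s0 s \<noteq> 0" using R0 S0(3) by blast
    obtain ps where ps: "\<forall>(a, xs)\<in>set ps. length xs \<le> d s0 \<and> set xs \<subseteq> F s0"
      and \<phi>: "\<forall>c\<in>madic l. \<phi> s c = list_eval ps (co c)"
      using rep[of s0 s] s0 S0(1) s by blast
    have "d s0 \<le> e" unfolding e_def using s0(1) S0(2) by (intro Max_ge) auto
    moreover have "F s0 \<subseteq> G" using s0(1) by (auto simp: G_def)
    ultimately have ps: "(\<lambda>c. \<Prod>x\<leftarrow>xs. co c x) \<in> B" if "(a, xs) \<in> set ps" for a xs
      using ps that unfolding B_def by fastforce
    have "list_eval qs (co y) = (\<Sum>(c, b)\<leftarrow>L. list_eval qs (co c) * b y)" if "set qs \<subseteq> set ps" for qs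
      using that
    proof (induction qs)
      case (Cons z qs)
      obtain a xs where z: "z = (a, xs)" by fastforce
      have "(\<Prod>x\<leftarrow>xs. co y x) = (\<Sum>(c, b)\<leftarrow>L. (\<Prod>x\<leftarrow>xs. co c x) * b y)"
        using bspec[OF bspec[OF B_eq ps] y, of a xs] Cons.prems z by simp
      moreover have "(\<Sum>(c, b)\<leftarrow>K. (a * (\<Prod>x\<leftarrow>xs. co c x) + list_eval qs (co c)) * b y) =
         a * (\<Sum>(c, b)\<leftarrow>K. (\<Prod>x\<leftarrow>xs. co c x) * b y) + (\<Sum>(c, b)\<leftarrow>K. list_eval qs (co c) * b y)" for K
        by (induction K) (auto simp: algebra_simps)
      ultimately show ?case using Cons by (simp add: z)
    qed (simp add: case_prod_unfold)
    then have "list_eval ps (co y) = (\<Sum>(c, b)\<leftarrow>L. list_eval ps (co c) * b y)" by blast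
    moreover have "(\<Sum>(c, b)\<leftarrow>K. list_eval ps (co c) * b y) = (\<Sum>(c, b)\<leftarrow>K. \<phi> s c * b y)"
      if "set K \<subseteq> set L" for K
      using that \<phi> L by (induction K) auto
    ultimately show ?thesis using \<phi> y by simp
  qed
  have "(\<lambda>s y. \<Sum>(c, b)\<leftarrow>K. \<phi> s c * b y) \<in> regpoly S" if "set K \<subseteq> set L" for K
    using that
  proof (induction K)
    case Nil
    show ?case using regpoly_const[of 0] by simp
  next
    case (Cons z K)
    obtain c b where z: "z = (c, b)" by fastforce
    have "c \<in> madic l" "(\<lambda>s c. b c) \<in> regpoly S" using Cons.prems L z by (auto simp: V_def)
    then have "(\<lambda>s y. \<phi> s c * b y) \<in> regpoly S"
      by (intro regpoly.mult[of "\<lambda>s y. \<phi> s c"] regpoly.coef regular_fun_eval[OF fam])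
    moreover have "(\<lambda>s y. \<Sum>(c, b)\<leftarrow>K. \<phi> s c * b y) \<in> regpoly S"
      using Cons by simp
    ultimately show ?case using regpoly.add by (fastforce simp: z)
  qed
  from this[of L] show ?thesis
    using \<phi>_eq by (intro bexI[of _ "\<lambda>s y. \<Sum>(c, b)\<leftarrow>L. \<phi> s c * b y"]) simp_all
qed

text \<open>The textile members supply a polynomial at each parameter, regularity supplies the
  dependence on the parameter. \<open>madic l\<close> contains the line spanned by each of its
  elements, as the comparison of degrees requires.\<close>

lemma polyfam_if_regular_family:
  fixes f :: "('q::finite \<Rightarrow> 'k::field_char_0) \<Rightarrow> ('m::finite, 'n::finite, 'k) cords
    \<Rightarrow> ('p, 'n, 'k) cords"
  assumes "regular_family S (madic l) f"
  shows "polyfam S (madic l) f"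
  unfolding polyfam_def
proof (intro allI)
  fix j \<alpha>
  show "\<exists>\<psi>\<in>regpoly S. \<forall>s\<in>S. \<forall>c\<in>madic l. f s c j \<alpha> = \<psi> s c"
    by (rule regular_scalar_family_regpoly)
       (use assms in \<open>auto simp: regular_family_def intro: textile_onD\<close>)
qed

section \<open>Closure of the normal form under sums, differences and composition\<close>

lemma polyfam_id: "polyfam S Y (\<lambda>s c. c)"
  unfolding polyfam_def
proof (intro allI)
  fix j \<alpha>
  show "\<exists>\<psi>\<in>regpoly S. \<forall>s\<in>S. \<forall>c\<in>Y. c j \<alpha> = \<psi> s c"
    by (rule bexI[of _ "\<lambda>s c. c j \<alpha>"]) (simp_all add: regpoly.coord)
qed

lemma polyfam_zero: "polyfam S Y (\<lambda>s c. 0)"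
  unfolding polyfam_def using regpoly_const[of 0] by fastforce

lemma polyfam_add:
  assumes "polyfam S Y f" "polyfam S Y g"
  shows "polyfam S Y (\<lambda>s c. f s c + g s c)"
  unfolding polyfam_def
proof (intro allI)
  fix j \<alpha>
  obtain \<phi> \<psi> where "\<phi> \<in> regpoly S" "\<forall>s\<in>S. \<forall>c\<in>Y. f s c j \<alpha> = \<phi> s c"
    "\<psi> \<in> regpoly S" "\<forall>s\<in>S. \<forall>c\<in>Y. g s c j \<alpha> = \<psi> s c"
    using assms unfolding polyfam_def by metis
  then show "\<exists>\<psi>\<in>regpoly S. \<forall>s\<in>S. \<forall>c\<in>Y. (f s c + g s c) j \<alpha> = \<psi> s c"
    by (intro bexI[of _ "\<lambda>s c. \<phi> s c + \<psi> s c"]) (auto intro: regpoly.add)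
qed

lemma polyfam_diff:
  assumes "polyfam S Y f" "polyfam S Y g"
  shows "polyfam S Y (\<lambda>s c. f s c - g s c)"
  unfolding polyfam_def
proof (intro allI)
  fix j \<alpha>
  obtain \<phi> \<psi> where "\<phi> \<in> regpoly S" "\<forall>s\<in>S. \<forall>c\<in>Y. f s c j \<alpha> = \<phi> s c"
    "\<psi> \<in> regpoly S" "\<forall>s\<in>S. \<forall>c\<in>Y. g s c j \<alpha> = \<psi> s c"
    using assms unfolding polyfam_def by metis
  then show "\<exists>\<psi>\<in>regpoly S. \<forall>s\<in>S. \<forall>c\<in>Y. (f s c - g s c) j \<alpha> = \<psi> s c"
    by (intro bexI[of _ "\<lambda>s c. \<phi> s c - \<psi> s c"]) (auto intro: regpoly_diff)
qed

text \<open>Substitution into a polynomial in the cord. The inner values have to lie in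
  \<open>Y'\<close> only for parameters in \<open>S\<close> itself.\<close>

lemma polyfam_comp:
  fixes f :: "('q \<Rightarrow> 'k::field) \<Rightarrow> ('m, 'n, 'k) cords \<Rightarrow> ('p, 'n, 'k) cords"
  assumes f: "polyfam S Y' f" and g: "polyfam S Y g"
    and Y: "\<And>s c. s \<in> S \<Longrightarrow> c \<in> Y \<Longrightarrow> g s c \<in> Y'"
  shows "polyfam S Y (\<lambda>s c. f s (g s c))"
  unfolding polyfam_def
proof (intro allI)
  fix j \<alpha>
  obtain \<phi> where \<phi>: "\<phi> \<in> regpoly S" "\<forall>s\<in>S. \<forall>c\<in>Y'. f s c j \<alpha> = \<phi> s c"
    using f unfolding polyfam_def by metis
  from \<phi>(1) have "\<exists>\<psi>\<in>regpoly S. \<forall>s\<in>S. \<forall>c\<in>Y. \<phi> s (g s c) = \<psi> s c"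
  proof induction
    case (coef a)
    then show ?case by (intro bexI[of _ "\<lambda>s c. a s"]) (auto intro: regpoly.coef)
  next
    case (coord i \<alpha>)
    then show ?case using g unfolding polyfam_def by blast
  next
    case (add \<phi> \<phi>')
    then obtain \<psi> \<psi>' where "\<psi> \<in> regpoly S" "\<psi>' \<in> regpoly S"
      "\<forall>s\<in>S. \<forall>c\<in>Y. \<phi> s (g s c) = \<psi> s c" "\<forall>s\<in>S. \<forall>c\<in>Y. \<phi>' s (g s c) = \<psi>' s c" by blast
    then show ?case by (intro bexI[of _ "\<lambda>s c. \<psi> s c + \<psi>' s c"]) (auto intro: regpoly.add)
  next
    case (mult \<phi> \<phi>')
    then obtain \<psi> \<psi>' where "\<psi> \<in> regpoly S" "\<psi>' \<in> regpoly S"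
      "\<forall>s\<in>S. \<forall>c\<in>Y. \<phi> s (g s c) = \<psi> s c" "\<forall>s\<in>S. \<forall>c\<in>Y. \<phi>' s (g s c) = \<psi>' s c" by blast
    then show ?case by (intro bexI[of _ "\<lambda>s c. \<psi> s c * \<psi>' s c"]) (auto intro: regpoly.mult)
  qed
  then show "\<exists>\<psi>\<in>regpoly S. \<forall>s\<in>S. \<forall>c\<in>Y. f s (g s c) j \<alpha> = \<psi> s c"
    using \<phi>(2) Y by auto
qed

section \<open>Tangent maps\<close>

definition coords :: "('m, 'n, 'k) cords \<Rightarrow> 'm \<times> ('n \<Rightarrow> nat) \<Rightarrow> 'k" where
  "coords c = (\<lambda>(i, \<beta>). c i \<beta>)"

lemma coords_simps [simp]: "coords c (i, \<beta>) = c i \<beta>"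
  by (simp add: coords_def)

lemma polyfun_derivative:
  fixes p :: "('x \<Rightarrow> 'k::comm_ring_1) \<Rightarrow> 'k"
  assumes "p \<in> polyfun"
  shows "\<exists>E\<in>polyfun.
    (\<forall>g. \<exists>\<Psi>. (\<forall>t. p (\<lambda>x. poly (g x) t) = poly \<Psi> t) \<and>
       coeff \<Psi> 1 = E (case_sum (\<lambda>x. coeff (g x) 0) (\<lambda>x. coeff (g x) 1))) \<and>
    (\<forall>a v w r. E (case_sum a (\<lambda>x. v x + r * w x)) = E (case_sum a v) + r * E (case_sum a w))"
  (is "\<exists>E\<in>polyfun. ?D p E")
  using assms
proof (induction p rule: polyfun.induct)
  case (const c)
  have "\<exists>\<Psi>. (\<forall>t. c = poly \<Psi> t) \<and> coeff \<Psi> 1 = 0"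
    by (rule exI[of _ "[:c:]"]) simp
  then show ?case by (intro bexI[of _ "\<lambda>_. 0"] polyfun.const) auto
next
  case (coord x)
  show ?case by (intro bexI[of _ "\<lambda>\<xi>. \<xi> (Inr x)"] polyfun.coord) auto
next
  case (add p q)
  then obtain E E' where E: "E \<in> polyfun" "?D p E" and E': "E' \<in> polyfun" "?D q E'" by blast
  have "\<exists>\<Psi>. (\<forall>t. p (\<lambda>x. poly (g x) t) + q (\<lambda>x. poly (g x) t) = poly \<Psi> t) \<and>
       coeff \<Psi> 1 = E (case_sum (\<lambda>x. coeff (g x) 0) (\<lambda>x. coeff (g x) 1)) +
         E' (case_sum (\<lambda>x. coeff (g x) 0) (\<lambda>x. coeff (g x) 1))" for g
  proof -
    obtain \<Psi> \<Psi>' where "\<forall>t. p (\<lambda>x. poly (g x) t) = poly \<Psi> t"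
      "coeff \<Psi> 1 = E (case_sum (\<lambda>x. coeff (g x) 0) (\<lambda>x. coeff (g x) 1))"
      "\<forall>t. q (\<lambda>x. poly (g x) t) = poly \<Psi>' t"
      "coeff \<Psi>' 1 = E' (case_sum (\<lambda>x. coeff (g x) 0) (\<lambda>x. coeff (g x) 1))"
      using E(2) E'(2) by blast
    then show ?thesis by (intro exI[of _ "\<Psi> + \<Psi>'"]) simp
  qed
  moreover have "E (case_sum a (\<lambda>x. v x + r * w x)) + E' (case_sum a (\<lambda>x. v x + r * w x)) =
      E (case_sum a v) + E' (case_sum a v) + r * (E (case_sum a w) + E' (case_sum a w))" for a v w r
    using E(2) E'(2) by (simp add: algebra_simps)
  ultimately show ?case
    by (intro bexI[of _ "\<lambda>\<xi>. E \<xi> + E' \<xi>"] polyfun.add E(1) E'(1)) blast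
next
  case (mult p q)
  then obtain E E' where E: "E \<in> polyfun" "?D p E" and E': "E' \<in> polyfun" "?D q E'" by blast
  define H where "H \<xi> = p (\<lambda>x. \<xi> (Inl x)) * E' \<xi> + E \<xi> * q (\<lambda>x. \<xi> (Inl x))" for \<xi>
  have "\<exists>\<Psi>. (\<forall>t. p (\<lambda>x. poly (g x) t) * q (\<lambda>x. poly (g x) t) = poly \<Psi> t) \<and>
       coeff \<Psi> 1 = H (case_sum (\<lambda>x. coeff (g x) 0) (\<lambda>x. coeff (g x) 1))" for g
  proof -
    obtain \<Psi> \<Psi>' where P: "\<forall>t. p (\<lambda>x. poly (g x) t) = poly \<Psi> t"
      "coeff \<Psi> 1 = E (case_sum (\<lambda>x. coeff (g x) 0) (\<lambda>x. coeff (g x) 1))"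
      "\<forall>t. q (\<lambda>x. poly (g x) t) = poly \<Psi>' t"
      "coeff \<Psi>' 1 = E' (case_sum (\<lambda>x. coeff (g x) 0) (\<lambda>x. coeff (g x) 1))"
      using E(2) E'(2) by blast
    have "coeff \<Psi> 0 = p (\<lambda>x. coeff (g x) 0)" "coeff \<Psi>' 0 = q (\<lambda>x. coeff (g x) 0)"
      using P(1)[THEN spec, of 0] P(3)[THEN spec, of 0] by (simp_all add: poly_0_coeff_0)
    then show ?thesis
      using P by (intro exI[of _ "\<Psi> * \<Psi>'"]) (simp add: coeff_mult H_def)
  qed
  moreover have "H (case_sum a (\<lambda>x. v x + r * w x)) = H (case_sum a v) + r * H (case_sum a w)"
    for a v w r
    using E(2) E'(2) by (simp add: H_def algebra_simps)
  moreover have "H \<in> polyfun"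
    unfolding H_def[abs_def]
    by (intro polyfun.add polyfun.mult E(1) E'(1) polyfun_subst[OF mult.hyps(1)]
          polyfun_subst[OF mult.hyps(2)] polyfun.coord)
  ultimately show ?case by (intro bexI[of _ H]) blast
qed

lemma polyfun_curve:
  assumes "p \<in> polyfun"
  shows "\<exists>\<Psi>. \<forall>t. p (\<lambda>x. poly (g x) t) = poly \<Psi> t"
  using polyfun_derivative[OF assms] by blast

text \<open>A polynomial over an infinite field is determined by its values, so the description in
  \<open>tangent\<close> picks out one number, the linear coefficient.\<close>

lemma tangent_eqI:
  fixes F :: "('m, 'n, 'k::field_char_0) cords \<Rightarrow> ('p, 'n, 'k) cords"
  assumes "\<And>t. F (a + cscale t v) j \<alpha> = poly \<Psi> t"
  shows "tangent F a v j \<alpha> = coeff \<Psi> 1"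
proof -
  obtain c \<Psi>' where \<Psi>: "\<Psi> = pCons c \<Psi>'" by (cases \<Psi>)
  have "a + cscale 0 v = a" by (simp add: cscale_def fun_eq_iff)
  then have *: "F (a + cscale t v) j \<alpha> - F a j \<alpha> = t * poly \<Psi>' t" for t
    using assms[of t] assms[of 0] by (simp add: \<Psi>)
  show ?thesis
    unfolding tangent_def
  proof (rule the_equality)
    show "\<exists>P. (\<forall>t. F (a + cscale t v) j \<alpha> - F a j \<alpha> = t * poly P t) \<and> coeff \<Psi> 1 = poly P 0"
      using * by (intro exI[of _ \<Psi>']) (simp add: \<Psi> poly_0_coeff_0)
  next
    fix d assume "\<exists>P. (\<forall>t. F (a + cscale t v) j \<alpha> - F a j \<alpha> = t * poly P t) \<and> d = poly P 0"
    then obtain P where P: "\<And>t. t * poly \<Psi>' t = t * poly P t" "d = poly P 0"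
      using * by metis
    have "poly ([:0, 1:] * \<Psi>') = poly ([:0, 1:] * P)"
      using P(1) by (simp add: fun_eq_iff)
    then have "[:0, 1:] * \<Psi>' = [:0, 1:] * P" by (simp add: poly_eq_poly_eq_iff)
    then have "\<Psi>' = P" by simp
    then show "d = coeff \<Psi> 1" using P(2) by (simp add: \<Psi> poly_0_coeff_0)
  qed
qed

text \<open>Membership in \<open>madic l\<close> is the vanishing of certain coordinates, and a
  polynomial with only zero values has zero coefficients. Hence velocities of paths in
  \<open>madic l\<close> stay there.\<close>

lemma poly_curve_coeff_in_madic:
  fixes G :: "'k::field_char_0 \<Rightarrow> ('m::finite, 'n::finite, 'k) cords"
  assumes "\<And>t. G t \<in> madic l" "\<And>t i \<beta>. G t i \<beta> = poly (g i \<beta>) t"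
  shows "(\<lambda>i \<beta>. coeff (g i \<beta>) r) \<in> madic l"
proof -
  have "g i \<beta> = 0" if "(\<Sum>i\<in>UNIV. \<beta> i) < l" for i \<beta>
  proof -
    have "poly (g i \<beta>) t = 0" for t
      using assms(1)[of t] that
        by (auto simp: mem_madic_iff enat_le_cords_ord_iff simp flip: assms(2))
    then show ?thesis using poly_all_0_iff_0 by blast
  qed
  then show ?thesis by (auto simp: mem_madic_iff enat_le_cords_ord_iff)
qed

lemma textile_on_derivative:
  fixes F :: "('m::finite, 'n::finite, 'k::field_char_0) cords \<Rightarrow> ('p, 'n, 'k) cords"
  assumes "textile_on (madic l) F"
  obtains E where "E \<in> polyfun"
    "\<And>G g. (\<And>t. G t \<in> madic l) \<Longrightarrow> (\<And>t i \<beta>. G t i \<beta> = poly (g i \<beta>) t) \<Longrightarrow>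
       \<exists>\<Psi>. (\<forall>t. F (G t) j \<alpha> = poly \<Psi> t) \<and>
         coeff \<Psi> 1 = E (case_sum (coords (G 0)) (coords (\<lambda>i \<beta>. coeff (g i \<beta>) 1)))"
    "\<And>a v w r. E (case_sum a (\<lambda>x. v x + r * w x)) = E (case_sum a v) + r * E (case_sum a w)"
    "\<And>a v. a \<in> madic l \<Longrightarrow> v \<in> madic l \<Longrightarrow> tangent F a v j \<alpha> = E (case_sum (coords a) (coords v))"
proof -
  obtain p where p: "p \<in> polyfun" "\<And>c. c \<in> madic l \<Longrightarrow> F c j \<alpha> = p (coords c)"
    using textile_onD[OF assms] unfolding coords_def by blast
  obtain E where E: "E \<in> polyfun"
    and E1: "\<forall>g. \<exists>\<Psi>. (\<forall>t. p (\<lambda>x. poly (g x) t) = poly \<Psi> t) \<and>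
       coeff \<Psi> 1 = E (case_sum (\<lambda>x. coeff (g x) 0) (\<lambda>x. coeff (g x) 1))"
    and E2: "\<forall>a v w r. E (case_sum a (\<lambda>x. v x + r * w x)) = E (case_sum a v) + r * E (case_sum a w)"
    using polyfun_derivative[OF p(1)] by blast
  have curve: "\<exists>\<Psi>. (\<forall>t. F (G t) j \<alpha> = poly \<Psi> t) \<and>
         coeff \<Psi> 1 = E (case_sum (coords (G 0)) (coords (\<lambda>i \<beta>. coeff (g i \<beta>) 1)))"
    if G: "\<And>t. G t \<in> madic l" "\<And>t i \<beta>. G t i \<beta> = poly (g i \<beta>) t" for G g
  proof -
    have *: "coords (G t) = (\<lambda>x. poly (case x of (i, \<beta>) \<Rightarrow> g i \<beta>) t)" for t
      by (auto simp: fun_eq_iff G(2))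
    have "coords (G 0) = (\<lambda>x. coeff (case x of (i, \<beta>) \<Rightarrow> g i \<beta>) 0)"
      "coords (\<lambda>i \<beta>. coeff (g i \<beta>) 1) = (\<lambda>x. coeff (case x of (i, \<beta>) \<Rightarrow> g i \<beta>) 1)"
      by (auto simp: fun_eq_iff * poly_0_coeff_0)
    then show ?thesis
      using E1[THEN spec, of "\<lambda>x. case x of (i, \<beta>) \<Rightarrow> g i \<beta>"] by (simp add: p(2)[OF G(1)] *)
  qed
  have "tangent F a v j \<alpha> = E (case_sum (coords a) (coords v))"
    if av: "a \<in> madic l" "v \<in> madic l" for a v
  proof -
    have "a + cscale t v \<in> madic l" for t using av by (intro add_in_madic cscale_in_madic)
    moreover have "(a + cscale t v) i \<beta> = poly [:a i \<beta>, v i \<beta>:] t" for t i \<beta>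
      by (simp add: cscale_def)
    ultimately obtain \<Psi> where \<Psi>: "\<forall>t. F (a + cscale t v) j \<alpha> = poly \<Psi> t"
       "coeff \<Psi> 1 = E (case_sum (coords (a + cscale 0 v))
          (coords (\<lambda>i \<beta>. coeff [:a i \<beta>, v i \<beta>:] 1)))"
      using curve[of "\<lambda>t. a + cscale t v" "\<lambda>i \<beta>. [:a i \<beta>, v i \<beta>:]"] by blast
    have "a + cscale 0 v = a" by (simp add: cscale_def fun_eq_iff)
    then show ?thesis
      using tangent_eqI[of F a v j \<alpha> \<Psi>] \<Psi> by simp
  qed
  with E E2 curve show thesis by (intro that[of E]) auto
qed

lemma textile_curve:
  fixes F :: "('m::finite, 'n::finite, 'k::field_char_0) cords \<Rightarrow> ('p, 'n, 'k) cords"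
  assumes "textile_on (madic l) F" "\<And>t. G t \<in> madic l" "\<And>t i \<beta>. G t i \<beta> = poly (g i \<beta>) t"
  obtains \<Psi> where "\<forall>t j \<alpha>. F (G t) j \<alpha> = poly (\<Psi> j \<alpha>) t"
    "tangent F (G 0) (\<lambda>i \<beta>. coeff (g i \<beta>) 1) = (\<lambda>j \<alpha>. coeff (\<Psi> j \<alpha>) 1)"
proof -
  have "\<exists>\<Psi>. (\<forall>t. F (G t) j \<alpha> = poly \<Psi> t) \<and>
      coeff \<Psi> 1 = tangent F (G 0) (\<lambda>i \<beta>. coeff (g i \<beta>) 1) j \<alpha>" for j \<alpha>
  proof (rule textile_on_derivative[OF assms(1), of j \<alpha>])
    fix E
    assume "\<And>G g. (\<And>t. G t \<in> madic l) \<Longrightarrow> (\<And>t i \<beta>. G t i \<beta> = poly (g i \<beta>) t) \<Longrightarrow>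
       \<exists>\<Psi>. (\<forall>t. F (G t) j \<alpha> = poly \<Psi> t) \<and>
         coeff \<Psi> 1 = E (case_sum (coords (G 0)) (coords (\<lambda>i \<beta>. coeff (g i \<beta>) 1)))"
      and E: "\<And>a v. a \<in> madic l \<Longrightarrow> v \<in> madic l \<Longrightarrow>
         tangent F a v j \<alpha> = E (case_sum (coords a) (coords v))"
    from this(1)[of G g, OF assms(2,3)] show ?thesis
      unfolding E[OF assms(2) poly_curve_coeff_in_madic[OF assms(2,3)]] .
  qed
  then have "\<forall>j \<alpha>. \<exists>\<Psi>. (\<forall>t. F (G t) j \<alpha> = poly \<Psi> t) \<and>
      coeff \<Psi> 1 = tangent F (G 0) (\<lambda>i \<beta>. coeff (g i \<beta>) 1) j \<alpha>" by blast
  then obtain \<Psi> where "\<forall>j \<alpha>. (\<forall>t. F (G t) j \<alpha> = poly (\<Psi> j \<alpha>) t) \<and>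
      coeff (\<Psi> j \<alpha>) 1 = tangent F (G 0) (\<lambda>i \<beta>. coeff (g i \<beta>) 1) j \<alpha>" by metis
  then show thesis by (intro that[of \<Psi>]) (auto simp: fun_eq_iff)
qed

lemma textile_line:
  fixes F :: "('m::finite, 'n::finite, 'k::field_char_0) cords \<Rightarrow> ('p, 'n, 'k) cords"
  assumes "textile_on (madic l) F" "a \<in> madic l" "v \<in> madic l"
  obtains \<Psi> where "\<forall>t j \<alpha>. F (a + cscale t v) j \<alpha> = poly (\<Psi> j \<alpha>) t"
    "tangent F a v = (\<lambda>j \<alpha>. coeff (\<Psi> j \<alpha>) 1)"
proof -
  have G: "a + cscale t v \<in> madic l" for t
    using assms(2,3) by (intro add_in_madic cscale_in_madic)
  have g: "(a + cscale t v) i \<beta> = poly [:a i \<beta>, v i \<beta>:] t" for t i \<beta>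
    by (simp add: cscale_def)
  obtain \<Psi> where \<Psi>: "\<forall>t j \<alpha>. F (a + cscale t v) j \<alpha> = poly (\<Psi> j \<alpha>) t"
    "tangent F (a + cscale 0 v) (\<lambda>i \<beta>. coeff [:a i \<beta>, v i \<beta>:] 1) = (\<lambda>j \<alpha>. coeff (\<Psi> j \<alpha>) 1)"
    by (rule textile_curve[OF assms(1) G g])
  from \<Psi>(1) have "tangent F a v = (\<lambda>j \<alpha>. coeff (\<Psi> j \<alpha>) 1)"
    by (intro ext tangent_eqI) simp
  with \<Psi>(1) show thesis by (rule that)
qed

text \<open>Along a line, the composite is \<open>F\<close> along the polynomial path traced by
  \<open>H\<close>, whose velocity is the tangent of \<open>H\<close>.\<close>

lemma tangent_comp:
  fixes F :: "('p::finite, 'n::finite, 'k::field_char_0) cords \<Rightarrow> ('r, 'n, 'k) cords"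
    and H :: "('m::finite, 'n, 'k) cords \<Rightarrow> ('p, 'n, 'k) cords"
  assumes "textile_on (madic l) H" "textile_on (madic l') F"
    and H: "\<And>c. c \<in> madic l \<Longrightarrow> H c \<in> madic l'" and av: "a \<in> madic l" "v \<in> madic l"
  shows "tangent (\<lambda>c. F (H c)) a v = tangent F (H a) (tangent H a v)"
    and "tangent H a v \<in> madic l'"
proof -
  obtain g where g: "\<forall>t j \<alpha>. H (a + cscale t v) j \<alpha> = poly (g j \<alpha>) t"
    "tangent H a v = (\<lambda>j \<alpha>. coeff (g j \<alpha>) 1)"
    by (rule textile_line[OF assms(1) av])
  have G: "H (a + cscale t v) \<in> madic l'" for t
    using av by (intro H add_in_madic cscale_in_madic)
  have g1: "H (a + cscale t v) j \<alpha> = poly (g j \<alpha>) t" for t j \<alpha> using g(1) by blast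
  show "tangent H a v \<in> madic l'"
    unfolding g(2) by (rule poly_curve_coeff_in_madic[OF G g1])
  obtain \<Psi> where \<Psi>: "\<forall>t j \<alpha>. F (H (a + cscale t v)) j \<alpha> = poly (\<Psi> j \<alpha>) t"
    "tangent F (H (a + cscale 0 v)) (\<lambda>i \<beta>. coeff (g i \<beta>) 1) = (\<lambda>j \<alpha>. coeff (\<Psi> j \<alpha>) 1)"
    by (rule textile_curve[OF assms(2) G g1])
  have "a + cscale 0 v = a" by (simp add: cscale_def fun_eq_iff)
  moreover have "tangent (\<lambda>c. F (H c)) a v = (\<lambda>j \<alpha>. coeff (\<Psi> j \<alpha>) 1)"
    using \<Psi>(1) by (intro ext tangent_eqI) simp
  ultimately show "tangent (\<lambda>c. F (H c)) a v = tangent F (H a) (tangent H a v)"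
    using \<Psi>(2) by (simp add: g(2))
qed

lemma tangent_add_cscale:
  fixes F :: "('m::finite, 'n::finite, 'k::field_char_0) cords \<Rightarrow> ('p, 'n, 'k) cords"
  assumes "textile_on (madic l) F" "a \<in> madic l" "v \<in> madic l" "w \<in> madic l"
  shows "tangent F a (v + cscale r w) = tangent F a v + cscale r (tangent F a w)"
proof (intro ext)
  fix j \<alpha>
  have co: "coords (v + cscale r w) = (\<lambda>x. coords v x + r * coords w x)"
    by (auto simp: fun_eq_iff cscale_def)
  show "tangent F a (v + cscale r w) j \<alpha> = (tangent F a v + cscale r (tangent F a w)) j \<alpha>"
  proof (rule textile_on_derivative[OF assms(1), of j \<alpha>])
    fix E
    assume E:
      "\<And>a v w r. E (case_sum a (\<lambda>x. v x + r * w x)) = E (case_sum a v) + r * E (case_sum a w)"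
      "\<And>a v. a \<in> madic l \<Longrightarrow> v \<in> madic l \<Longrightarrow> tangent F a v j \<alpha> = E (case_sum (coords a) (coords v))"
    have "v + cscale r w \<in> madic l" using assms(3,4) by (intro add_in_madic cscale_in_madic)
    from E(2)[OF assms(2) this] have
      "tangent F a (v + cscale r w) j \<alpha> =
        E (case_sum (coords a) (coords v)) + r * E (case_sum (coords a) (coords w))"
      unfolding co E(1) .
    then show ?thesis
      using assms(2-4) by (simp add: E(2)) (simp add: cscale_def E(2))
  qed
qed

text \<open>Polynomial dependence on the path parameter is what later permits a tangential field to
  be divided by powers of that parameter.\<close>

lemma tangent_poly_curve:
  fixes F :: "('m::finite, 'n::finite, 'k::field_char_0) cords \<Rightarrow> ('p, 'n, 'k) cords"
  assumes "textile_on (madic l) F" "\<And>t. G t \<in> madic l" "\<And>t i \<beta>. G t i \<beta> = poly (g i \<beta>) t"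
    "\<And>t. H t \<in> madic l" "\<And>t i \<beta>. H t i \<beta> = poly (h i \<beta>) t"
  obtains \<Psi> where "\<forall>t j \<alpha>. tangent F (G t) (H t) j \<alpha> = poly (\<Psi> j \<alpha>) t"
proof -
  have "\<forall>j \<alpha>. \<exists>\<Psi>. \<forall>t. tangent F (G t) (H t) j \<alpha> = poly \<Psi> t"
  proof (intro allI)
    fix j \<alpha>
    have co: "case_sum (coords (G t)) (coords (H t)) =
        (\<lambda>x. poly (case_sum (\<lambda>(i, \<beta>). g i \<beta>) (\<lambda>(i, \<beta>). h i \<beta>) x) t)" for t
      by (auto simp: fun_eq_iff assms(3,5) split: sum.split)
    show "\<exists>\<Psi>. \<forall>t. tangent F (G t) (H t) j \<alpha> = poly \<Psi> t"
    proof (rule textile_on_derivative[OF assms(1), of j \<alpha>])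
      fix E
      assume E: "E \<in> polyfun"
        "\<And>a v. a \<in> madic l \<Longrightarrow> v \<in> madic l \<Longrightarrow> tangent F a v j \<alpha> = E (case_sum (coords a) (coords v))"
      show ?thesis
        unfolding E(2)[OF assms(2,4)] co by (rule polyfun_curve[OF E(1)])
    qed
  qed
  then obtain \<Psi> where "\<forall>j \<alpha>. \<forall>t. tangent F (G t) (H t) j \<alpha> = poly (\<Psi> j \<alpha>) t" by metis
  then show thesis by (intro that[of \<Psi>]) auto
qed

lemma polyfam_textile_on: "polyfam S Y f \<Longrightarrow> s \<in> S \<Longrightarrow> textile_on Y (f s)"
  using regular_family_if_polyfam unfolding regular_family_def by blast

lemma polyfam_tangent_0:
  fixes f :: "('q \<Rightarrow> 'k::field_char_0) \<Rightarrow> ('m::finite, 'n::finite, 'k) cords \<Rightarrow> ('p, 'n, 'k) cords"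
  assumes "polyfam S (madic l) f"
  shows "polyfam S (madic l) (\<lambda>s. tangent (f s) 0)"
  unfolding polyfam_def
proof (intro allI)
  fix j \<alpha>
  have reg: "\<exists>\<theta>\<in>regpoly S. \<forall>s v. \<exists>\<Psi>. (\<forall>t. \<psi> s (cscale t v) = poly \<Psi> t) \<and> coeff \<Psi> 1 = \<theta> s v"
    if "\<psi> \<in> regpoly S" for \<psi> :: "_ \<Rightarrow> ('m, 'n, 'k) cords \<Rightarrow> 'k"
    using that
  proof induction
    case (coef a)
    have "\<exists>\<Psi>. (\<forall>t. a s = poly \<Psi> t) \<and> coeff \<Psi> 1 = 0" for s
      by (rule exI[of _ "[:a s:]"]) simp
    then show ?case by (intro bexI[of _ "\<lambda>s v. 0"] regpoly_const) blast
  next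
    case (coord i \<beta>)
    have "\<exists>\<Psi>. (\<forall>t. cscale t v i \<beta> = poly \<Psi> t) \<and> coeff \<Psi> 1 = v i \<beta>" for v :: "('m, 'n, 'k) cords"
      by (rule exI[of _ "[:0, v i \<beta>:]"]) (simp add: cscale_def)
    then show ?case by (intro bexI[of _ "\<lambda>s v. v i \<beta>"] regpoly.coord) blast
  next
    case (add \<phi> \<psi>)
    then obtain \<theta> \<theta>' where \<theta>: "\<theta> \<in> regpoly S" "\<theta>' \<in> regpoly S"
      "\<forall>s v. \<exists>\<Psi>. (\<forall>t. \<phi> s (cscale t v) = poly \<Psi> t) \<and> coeff \<Psi> 1 = \<theta> s v"
      "\<forall>s v. \<exists>\<Psi>. (\<forall>t. \<psi> s (cscale t v) = poly \<Psi> t) \<and> coeff \<Psi> 1 = \<theta>' s v" by blast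
    have "\<exists>\<Psi>. (\<forall>t. \<phi> s (cscale t v) + \<psi> s (cscale t v) = poly \<Psi> t) \<and> coeff \<Psi> 1 = \<theta> s v + \<theta>' s v"
      for s v
    proof -
      obtain \<Psi> \<Psi>' where "\<forall>t. \<phi> s (cscale t v) = poly \<Psi> t" "coeff \<Psi> 1 = \<theta> s v"
        "\<forall>t. \<psi> s (cscale t v) = poly \<Psi>' t" "coeff \<Psi>' 1 = \<theta>' s v" using \<theta>(3,4) by blast
      then show ?thesis by (intro exI[of _ "\<Psi> + \<Psi>'"]) simp
    qed
    then show ?case
      by (intro bexI[of _ "\<lambda>s v. \<theta> s v + \<theta>' s v"] regpoly.add \<theta>(1,2)) blast
  next
    case (mult \<phi> \<psi>)
    then obtain \<theta> \<theta>' where \<theta>: "\<theta> \<in> regpoly S" "\<theta>' \<in> regpoly S"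
      "\<forall>s v. \<exists>\<Psi>. (\<forall>t. \<phi> s (cscale t v) = poly \<Psi> t) \<and> coeff \<Psi> 1 = \<theta> s v"
      "\<forall>s v. \<exists>\<Psi>. (\<forall>t. \<psi> s (cscale t v) = poly \<Psi> t) \<and> coeff \<Psi> 1 = \<theta>' s v" by blast
    have "\<exists>\<Psi>. (\<forall>t. \<phi> s (cscale t v) * \<psi> s (cscale t v) = poly \<Psi> t) \<and>
        coeff \<Psi> 1 = \<phi> s 0 * \<theta>' s v + \<theta> s v * \<psi> s 0" for s v
    proof -
      obtain \<Psi> \<Psi>' where P: "\<forall>t. \<phi> s (cscale t v) = poly \<Psi> t" "coeff \<Psi> 1 = \<theta> s v"
        "\<forall>t. \<psi> s (cscale t v) = poly \<Psi>' t" "coeff \<Psi>' 1 = \<theta>' s v" using \<theta>(3,4) by blast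
      have "cscale 0 v = 0" by (simp add: cscale_def fun_eq_iff)
      then have "coeff \<Psi> 0 = \<phi> s 0" "coeff \<Psi>' 0 = \<psi> s 0"
        using P(1)[THEN spec, of 0] P(3)[THEN spec, of 0] by (simp_all add: poly_0_coeff_0)
      then show ?thesis using P by (intro exI[of _ "\<Psi> * \<Psi>'"]) (simp add: coeff_mult)
    qed
    \<comment> \<open>In the product rule at the cord 0 the undifferentiated factors depend on
      \<open>s\<close> alone and are regular functions of it.\<close>
    moreover have "(\<lambda>s v. \<phi> s 0 * \<theta>' s v + \<theta> s v * \<psi> s 0) \<in> regpoly S"
      using regpoly.coef[OF regular_fun_eval[OF regpoly_regular[OF mult.hyps(1)]], of 0 UNIV]
        regpoly.coef[OF regular_fun_eval[OF regpoly_regular[OF mult.hyps(2)]], of 0 UNIV]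
      by (intro regpoly.add regpoly.mult \<theta>(1,2)) auto
    ultimately show ?case by (intro bexI[of _ "\<lambda>s v. \<phi> s 0 * \<theta>' s v + \<theta> s v * \<psi> s 0"]) blast
  qed
  obtain \<psi> where \<psi>: "\<psi> \<in> regpoly S" "\<forall>s\<in>S. \<forall>c\<in>madic l. f s c j \<alpha> = \<psi> s c"
    using assms unfolding polyfam_def by blast
  obtain \<theta> where \<theta>: "\<theta> \<in> regpoly S"
    "\<forall>s v. \<exists>\<Psi>. (\<forall>t. \<psi> s (cscale t v) = poly \<Psi> t) \<and> coeff \<Psi> 1 = \<theta> s v"
    using reg[OF \<psi>(1)] by blast
  have "tangent (f s) 0 v j \<alpha> = \<theta> s v" if "s \<in> S" "v \<in> madic l" for s v
  proof -
    obtain \<Psi> where "\<forall>t. \<psi> s (cscale t v) = poly \<Psi> t" "coeff \<Psi> 1 = \<theta> s v" using \<theta>(2) by blast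
    then show ?thesis
      using tangent_eqI[of "f s" 0 v j \<alpha> \<Psi>] \<psi>(2) that by (simp add: cscale_in_madic)
  qed
  then show "\<exists>\<psi>\<in>regpoly S. \<forall>s\<in>S. \<forall>c\<in>madic l. tangent (f s) 0 c j \<alpha> = \<psi> s c"
    using \<theta>(1) by blast
qed

section \<open>Inverting contractive perturbations of the identity\<close>

lemma eq_zero_if_in_all_madic:
  fixes v :: "('m::finite, 'n::finite, 'k::comm_ring_1) cords"
  assumes "\<And>n. v \<in> madic n"
  shows "v = 0"
proof (intro ext)
  fix i \<alpha>
  show "v i \<alpha> = 0 i \<alpha>"
    using assms[of "Suc (\<Sum>i\<in>UNIV. \<alpha> i)"]
    by (simp add: mem_madic_iff enat_le_cords_ord_iff del: madic.simps)
qed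

text \<open>Orders are natural numbers or infinite, so a strict increase gains a full power of the
  maximal ideal.\<close>

lemma contractive_family_madic:
  assumes "contractive_family S (madic l) N" "s \<in> S" "a \<in> madic l" "b \<in> madic l" "a - b \<in> madic n"
  shows "N s a - N s b \<in> madic (Suc n)"
proof (cases "a = b")
  case False
  then have "cords_ord (a - b) < cords_ord (N s a - N s b)"
    using assms(1-4) unfolding contractive_family_def by blast
  then have "enat n < cords_ord (N s a - N s b)"
    using assms(5) by (simp add: mem_madic_iff)
  then show ?thesis by (simp add: mem_madic_iff Suc_ile_eq del: madic.simps)
qed (simp add: zero_in_madic del: madic.simps)

text \<open>Fixed-point iteration for \<open>x = y - N s x\<close>, that is, for inverting the
  identity plus \<open>N s\<close>.\<close>

primrec picard :: "('a \<Rightarrow> 'b \<Rightarrow> 'b::ab_group_add) \<Rightarrow> nat \<Rightarrow> 'a \<Rightarrow> 'b \<Rightarrow> 'b" where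
  "picard N 0 s y = 0"
| "picard N (Suc n) s y = y - N s (picard N n s y)"

text \<open>Iterate \<open>n\<close> is correct modulo \<open>madic n\<close>, so a coefficient of
  degree \<open>d\<close> is final from iterate \<open>d + 1\<close> on. Every coefficient of
  \<open>w\<close> is therefore a coefficient of a finite iterate, and no limit of regular functions
  is taken.\<close>

lemma contractive_inverse:
  fixes N :: "('q \<Rightarrow> 'k::field) \<Rightarrow> ('m::finite, 'n::finite, 'k) cords \<Rightarrow> ('m, 'n, 'k) cords"
  assumes N: "polyfam S (madic l) N" "\<And>s c. s \<in> S \<Longrightarrow> c \<in> madic l \<Longrightarrow> N s c \<in> madic l"
    and contr: "contractive_family S (madic l) N"
  shows "\<exists>w. polyfam S (madic l) w \<and>
    (\<forall>s\<in>S. \<forall>y\<in>madic l. w s y \<in> madic l \<and> w s y + N s (w s y) = y) \<and>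
    (\<forall>s\<in>S. \<forall>a\<in>madic l. w s (a + N s a) = a)"
proof -
  let ?X = "picard N"
  define w where "w s y = (\<lambda>i \<alpha>. ?X (Suc (\<Sum>i\<in>UNIV. \<alpha> i)) s y i \<alpha>)" for s y
  have X: "?X n s y \<in> madic l" if "s \<in> S" "y \<in> madic l" for n s y
  proof (induction n)
    case 0
    show ?case unfolding picard.simps by (rule zero_in_madic)
  next
    case (Suc n)
    show ?case unfolding picard.simps by (intro diff_in_madic N(2) that Suc)
  qed
  have X1: "?X (Suc n) s y - ?X n s y \<in> madic n" if "s \<in> S" "y \<in> madic l" for n s y
  proof (induction n)
    case (Suc n)
    have "?X n s y - ?X (Suc n) s y \<in> madic n"
      using cscale_in_madic[OF Suc, of "-1"] by (simp add: cscale_def fun_diff_def)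
    from contractive_family_madic[OF contr that(1) X[OF that] X[OF that] this]
    have "N s (?X n s y) - N s (?X (Suc n) s y) \<in> madic (Suc n)" .
    moreover have "?X (Suc (Suc n)) s y - ?X (Suc n) s y = N s (?X n s y) - N s (?X (Suc n) s y)"
      by (simp only: picard.simps diff_diff_eq2 diff_add_cancel algebra_simps)
    ultimately show ?case by (simp only:)
  qed simp
  have X2: "?X (n + d) s y - ?X n s y \<in> madic n" if "s \<in> S" "y \<in> madic l" for n d s y
  proof (induction d)
    case (Suc d)
    have "?X (Suc (n + d)) s y - ?X (n + d) s y \<in> madic n"
      using X1[OF that, of "n + d"] madic_antimono[of n "n + d", OF le_add1] by blast
    from add_in_madic[OF this Suc] show ?case
      by (simp only: diff_add_cancel add_diff_eq add_Suc_right)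
  next
    case 0
    show ?case by (simp only: add_0_right diff_self zero_in_madic)
  qed
  have wX: "w s y - ?X n s y \<in> madic n" if "s \<in> S" "y \<in> madic l" for n s y
    unfolding mem_madic_iff enat_le_cords_ord_iff
  proof (intro allI impI)
    fix i and \<alpha> :: "'n \<Rightarrow> nat" assume "(\<Sum>i\<in>UNIV. \<alpha> i) < n"
    then obtain d where "n = Suc (\<Sum>i\<in>UNIV. \<alpha> i) + d" using less_iff_Suc_add by auto
    then show "(w s y - ?X n s y) i \<alpha> = 0"
      using X2[OF that, of "Suc (\<Sum>i\<in>UNIV. \<alpha> i)" d]
      by (simp add: mem_madic_iff enat_le_cords_ord_iff w_def del: picard.simps madic.simps)
  qed
  have w: "w s y \<in> madic l" if "s \<in> S" "y \<in> madic l" for s y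
    using X[OF that]
    by (simp add: mem_madic_iff enat_le_cords_ord_iff w_def del: picard.simps madic.simps)
  have inv1: "w s y + N s (w s y) = y" if "s \<in> S" "y \<in> madic l" for s y
  proof -
    have "w s y + N s (w s y) - y \<in> madic n" for n
    proof -
      have "N s (w s y) - N s (?X n s y) \<in> madic (Suc n)"
        using that by (intro contractive_family_madic[OF contr] w X wX)
      from add_in_madic[OF wX[OF that, of "Suc n"] this]
      have "w s y + N s (w s y) - y \<in> madic (Suc n)" by (simp add: algebra_simps)
      then show ?thesis using madic_Suc_subset by blast
    qed
    then have "w s y + N s (w s y) - y = 0" by (rule eq_zero_if_in_all_madic)
    then show ?thesis by simp
  qed
  \<comment> \<open>The difference of two solutions is, up to sign, a difference of values of
    \<open>N\<close>, and so gains orders without end.\<close>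
  have inj: "a = b"
    if s: "s \<in> S" "a \<in> madic l" "b \<in> madic l" and eq: "a + N s a = b + N s b" for s a b
  proof -
    have "a - b \<in> madic n" for n
    proof (induction n)
      case (Suc n)
      have "b - a \<in> madic n" using cscale_in_madic[OF Suc, of "-1"]
        by (simp add: cscale_def fun_diff_def)
      from contractive_family_madic[OF contr s(1,3,2) this]
      have "N s b - N s a \<in> madic (Suc n)" .
      also have "N s b - N s a = a - b" using eq by (simp add: algebra_simps)
      finally show ?case .
    qed simp
    then have "a - b = 0" by (rule eq_zero_if_in_all_madic)
    then show ?thesis by simp
  qed
  have Xfam: "polyfam S (madic l) (?X n)" for n
  proof (induction n)
    case 0
    have "?X 0 = (\<lambda>s y. 0)" by (intro ext) (simp only: picard.simps)
    then show ?case using polyfam_zero[of S "madic l"] by (simp only:)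
  next
    case (Suc n)
    have "?X (Suc n) = (\<lambda>s y. y - N s (?X n s y))" by (intro ext) (simp only: picard.simps)
    moreover have "polyfam S (madic l) (\<lambda>s y. y - N s (?X n s y))"
      by (rule polyfam_diff[OF polyfam_id polyfam_comp[OF N(1) Suc X]])
    ultimately show ?case by (simp only:)
  qed
  have "polyfam S (madic l) w"
    unfolding polyfam_def
  proof (intro allI)
    fix j \<alpha>
    show "\<exists>\<psi>\<in>regpoly S. \<forall>s\<in>S. \<forall>c\<in>madic l. w s c j \<alpha> = \<psi> s c"
      unfolding w_def
      by (rule Xfam[of "Suc (\<Sum>i\<in>UNIV. \<alpha> i)", unfolded polyfam_def, THEN spec, THEN spec])
  qed
  moreover have "w s (a + N s a) = a" if "s \<in> S" "a \<in> madic l" for s a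
  proof -
    have m: "a + N s a \<in> madic l" using that by (intro add_in_madic N(2))
    show ?thesis by (rule inj[OF that(1) w[OF that(1) m] that(2) inv1[OF that(1) m]])
  qed
  ultimately show ?thesis
    by - (rule exI[of _ w], intro conjI ballI, simp_all only: w inv1)
qed

section \<open>Constant rank\<close>

lemma tangent_linear:
  fixes F :: "('m, 'n, 'k::field_char_0) cords \<Rightarrow> ('p, 'n, 'k) cords"
  assumes "\<And>t. F (a + cscale t v) = F a + cscale t (F v)"
  shows "tangent F a v = F v"
proof (intro ext)
  fix j \<alpha>
  show "tangent F a v j \<alpha> = F v j \<alpha>"
    using tangent_eqI[of F a v j \<alpha> "[:F a j \<alpha>, F v j \<alpha>:]"]
      by (simp add: assms) (simp add: cscale_def)
qed

text \<open>Multiplication by the variable forces the value at 0 to vanish too. This extends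
  identities obtained by cancelling a power of the parameter, which is possible only off 0.\<close>

lemma poly_eq_0_if_zero_off_0:
  fixes p :: "'k::field_char_0 poly"
  assumes "\<And>x. x \<noteq> 0 \<Longrightarrow> poly p x = 0"
  shows "p = 0"
proof -
  have "poly ([:0, 1:] * p) x = 0" for x using assms by (cases "x = 0") auto
  then have "[:0, 1:] * p = 0" using poly_all_0_iff_0 by blast
  then show ?thesis by simp
qed

definition const_coeff :: "(unit, 'n, 'k) cords \<Rightarrow> 'k" where
  "const_coeff t = t () (\<lambda>_. 0)"

text \<open>Constant rank is tested on curves with cord parameters, the argument runs over scalars;
  a polynomial path becomes a curve on the whole cord space.\<close>

lemma curve_poly:
  fixes G :: "'k::field \<Rightarrow> ('m, 'n, 'k) cords"
  assumes "\<And>x. G x \<in> M" "\<And>x j \<alpha>. G x j \<alpha> = poly (g j \<alpha>) x"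
  shows "curve UNIV M (\<lambda>t. G (const_coeff t))"
  unfolding curve_def
proof (intro conjI textile_onI)
  fix j \<alpha>
  have "(\<lambda>\<xi>. poly p (\<xi> ((), \<lambda>_. 0))) \<in> polyfun" for p :: "'k poly"
    by (induction p) (auto intro!: polyfun.add polyfun.mult polyfun.const polyfun.coord)
  then show "\<exists>p\<in>polyfun. \<forall>c\<in>UNIV. G (const_coeff c) j \<alpha> = p (\<lambda>(i, \<beta>). c i \<beta>)"
    by (intro bexI[of _ "\<lambda>\<xi>. poly (g j \<alpha>) (\<xi> ((), \<lambda>_. 0))"]) (auto simp: assms(2) const_coeff_def)
qed (use assms(1) in auto)

lemma curve_scale:
  fixes G :: "(unit, 'n, 'k::field) cords \<Rightarrow> ('m, 'n, 'k) cords"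
  assumes "curve UNIV M G" "\<And>x c. c \<in> M \<Longrightarrow> cscale x c \<in> M"
  shows "curve UNIV M (\<lambda>t. cscale (const_coeff t ^ r) (G t))"
  unfolding curve_def
proof (intro conjI textile_onI)
  fix j \<alpha>
  have "textile_on UNIV G" using assms(1) by (simp add: curve_def)
  from textile_onD[OF this, of j \<alpha>]
  obtain p where "p \<in> polyfun" "\<forall>c\<in>UNIV. G c j \<alpha> = p (\<lambda>(i, \<beta>). c i \<beta>)" ..
  then show "\<exists>p\<in>polyfun. \<forall>c\<in>UNIV. cscale (const_coeff c ^ r) (G c) j \<alpha> = p (\<lambda>(i, \<beta>). c i \<beta>)"
    by (intro bexI[of _ "\<lambda>\<xi>. \<xi> ((), \<lambda>_. 0) ^ r * p \<xi>"] polyfun.mult polyfun_power polyfun.coord)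
       (auto simp: const_coeff_def cscale_def)
next
  have "G t \<in> M" for t using assms(1) by (auto simp: curve_def)
  then show "(\<lambda>t. cscale (const_coeff t ^ r) (G t)) ` UNIV \<subseteq> M" by (blast intro: assms(2))
qed

lemma textile_on_comp:
  fixes H :: "('m, 'n, 'k::comm_ring_1) cords \<Rightarrow> ('p, 'n, 'k) cords"
  assumes "textile_on Y H" "textile_on Y' F" "\<And>c. c \<in> Y \<Longrightarrow> H c \<in> Y'"
  shows "textile_on Y (\<lambda>c. F (H c))"
proof (rule textile_onI)
  fix j \<alpha>
  obtain p where p: "p \<in> polyfun" "\<forall>c\<in>Y'. F c j \<alpha> = p (\<lambda>(i, \<beta>). c i \<beta>)"
    using textile_onD[OF assms(2)] by blast
  have "\<forall>x. \<exists>q\<in>polyfun. \<forall>c\<in>Y. H c (fst x) (snd x) = q (\<lambda>(i, \<beta>). c i \<beta>)"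
    using textile_onD[OF assms(1)] by blast
  then obtain q where q: "\<forall>x. q x \<in> polyfun \<and> (\<forall>c\<in>Y. H c (fst x) (snd x) = q x (\<lambda>(i, \<beta>). c i \<beta>))"
    by metis
  have "F (H c) j \<alpha> = p (\<lambda>x. q x (\<lambda>(i, \<beta>). c i \<beta>))" if "c \<in> Y" for c
  proof -
    have "(\<lambda>x. q x (\<lambda>(i, \<beta>). c i \<beta>)) = (\<lambda>(i, \<beta>). H c i \<beta>)"
      using q that by (auto simp: fun_eq_iff)
    then show ?thesis using p(2) assms(3)[OF that] by simp
  qed
  moreover have "(\<lambda>\<xi>. p (\<lambda>x. q x \<xi>)) \<in> polyfun"
    using q by (intro polyfun_subst[OF p(1)]) blast
  ultimately show "\<exists>p\<in>polyfun. \<forall>c\<in>Y. F (H c) j \<alpha> = p (\<lambda>(i, \<beta>). c i \<beta>)"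
    by (intro bexI[of _ "\<lambda>\<xi>. p (\<lambda>x. q x \<xi>)"]) simp_all
qed

lemma linear_on_cords_add:
  "linear_on_cords Y F \<Longrightarrow> a \<in> Y \<Longrightarrow> b \<in> Y \<Longrightarrow> F (a + b) = F a + F b"
  unfolding linear_on_cords_def by blast

lemma linear_on_cords_cscale:
  "linear_on_cords Y F \<Longrightarrow> a \<in> Y \<Longrightarrow> F (cscale t a) = cscale t (F a)"
  unfolding linear_on_cords_def by blast

lemma linear_on_cords_0:
  assumes "linear_on_cords Y F" "0 \<in> Y"
  shows "F 0 = 0"
proof -
  have "cscale 0 0 = (0 :: ('a, 'b, 'c) cords)" "cscale 0 (F 0) = 0"
    by (simp_all add: cscale_def fun_eq_iff)
  then show ?thesis using linear_on_cords_cscale[OF assms, of 0] by simp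
qed

text \<open>
  The key use of constant rank.  Along \<open>t \<mapsto> \<gamma> t\<close> write a tangential field with values in the kernel
  of \<open>\<pi>\<close> as \<open>t\<^sup>r \<zeta>\<close> with \<open>\<zeta> 0 \<noteq> 0\<close>.  Multiplying the constant rank decomposition of \<open>\<zeta>\<close> by \<open>t\<^sup>r\<close> and
  comparing with the trivial decomposition shows that \<open>\<zeta>\<close> is tangential itself, so that
  \<open>\<zeta> 0\<close> lies in the image of \<open>T\<^sub>0 F\<close>, on which \<open>\<pi>\<close> is the identity, and in the kernel of \<open>\<pi>\<close>.
  The scalar \<open>t\<close> is encoded as the constant coefficient of the parameter of a curve.
\<close>

lemma constant_rank_transversal:
  fixes F :: "('m::finite, 'n::finite, 'k::field_char_0) cords \<Rightarrow> ('p::finite, 'n, 'k) cords"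
  assumes rank: "constant_rank_at_0 (madic l) J F"
    and \<pi>: "textile_on UNIV \<pi>" "linear_on_cords UNIV \<pi>"
      "\<And>c. c \<in> madic l \<Longrightarrow> \<pi> (tangent F 0 c) = tangent F 0 c"
    and F: "textile_on (madic l) F"
    and G: "\<And>t. G t \<in> madic l" "\<And>t i \<beta>. G t i \<beta> = poly (g i \<beta>) t" "G 0 = 0"
    and H: "\<And>t. H t \<in> madic l" "\<And>t i \<beta>. H t i \<beta> = poly (h i \<beta>) t"
    and \<pi>0: "\<And>t. \<pi> (tangent F (G t) (H t)) = 0"
  shows "tangent F (G t) (H t) = 0"
proof -
  obtain Z where Z: "\<forall>t j \<alpha>. tangent F (G t) (H t) j \<alpha> = poly (Z j \<alpha>) t"
    by (rule tangent_poly_curve[OF F G(1,2) H])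
  have J: "cvec.subspace J"
    using rank unfolding constant_rank_at_0_def topological_direct_sum_def by blast
  have "Z j \<alpha> = 0" for j \<alpha>
  proof (rule ccontr)
    assume "Z j \<alpha> \<noteq> 0"
    then have ex: "\<exists>r j \<alpha>. coeff (Z j \<alpha>) r \<noteq> 0" by (metis leading_coeff_0_iff)
    \<comment> \<open>The least order of vanishing at \<open>t = 0\<close> among all coefficients.
      There may be infinitely many of these, but a set of orders has a minimum.\<close>
    define r where "r = (LEAST r. \<exists>j \<alpha>. coeff (Z j \<alpha>) r \<noteq> 0)"
    obtain j0 \<alpha>0 where r: "coeff (Z j0 \<alpha>0) r \<noteq> 0" unfolding r_def using LeastI_ex[OF ex] by blast
    have less: "coeff (Z j \<alpha>) i = 0" if "i < r" for i j \<alpha>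
      using not_less_Least[of i "\<lambda>r. \<exists>j \<alpha>. coeff (Z j \<alpha>) r \<noteq> 0"] that by (auto simp: r_def)
    define z where "z j \<alpha> = poly_shift r (Z j \<alpha>)" for j \<alpha>
    have Zz: "Z j \<alpha> = monom 1 r * z j \<alpha>" for j \<alpha>
      by (rule poly_eqI) (auto simp: coeff_monom_mult z_def coeff_poly_shift less)
    define \<zeta> where "\<zeta> t = (\<lambda>j \<alpha>. poly (z j \<alpha>) t)" for t
    have T\<zeta>: "tangent F (G t) (H t) = cscale (t ^ r) (\<zeta> t)" for t
      using Z by (simp add: fun_eq_iff Zz \<zeta>_def cscale_def poly_monom)
    have \<zeta>0: "\<zeta> 0 \<noteq> 0"
      using r by (auto simp: fun_eq_iff \<zeta>_def z_def poly_0_coeff_0 coeff_poly_shift)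
    have cG: "curve UNIV (madic l) (\<lambda>t. G (const_coeff t))" by (rule curve_poly[OF G(1,2)])
    have cH: "curve UNIV (madic l) (\<lambda>t. H (const_coeff t))" by (rule curve_poly[OF H])
    have c\<zeta>: "curve UNIV UNIV (\<lambda>t. \<zeta> (const_coeff t))"
      by (rule curve_poly[of _ _ z]) (simp_all add: \<zeta>_def)
    have cT: "curve UNIV UNIV (\<lambda>t. tangent F (G (const_coeff t)) (H (const_coeff t)))"
      by (rule curve_poly[of "\<lambda>x. tangent F (G x) (H x)" _ Z]) (use Z in simp_all)
    have c0: "curve UNIV J (\<lambda>t. 0)"
      by (rule curve_poly[of "\<lambda>x. 0" J "\<lambda>j \<alpha>. 0"]) (simp_all add: cvec.subspace_0[OF J])
    have nbhd: "nbhd0 (UNIV :: (unit, 'n, 'k) cords set)"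
      unfolding nbhd0_def openin_madic_topology by blast
    have G0: "G (const_coeff 0) = 0" using G(3) by (simp add: const_coeff_def)
    note rank' = rank[unfolded constant_rank_at_0_def, THEN conjunct2, rule_format,
      OF conjI[OF nbhd conjI[OF cG conjI]], OF G0]
    obtain \<rho> \<tau> where dec: "rank_decomposition UNIV (madic l) J F
        (\<lambda>t. G (const_coeff t)) (\<lambda>t. \<zeta> (const_coeff t)) \<rho> \<tau>"
      using rank'[OF c\<zeta>] by blast
    define \<rho>' \<tau>' where "\<rho>' t = cscale (const_coeff t ^ r) (\<rho> t)"
      and "\<tau>' t = cscale (const_coeff t ^ r) (\<tau> t)" for t
    have \<rho>: "\<rho> t \<in> madic l" for t
      using dec by (auto simp: rank_decomposition_def curve_def)
    have "rank_decomposition UNIV (madic l) J F (\<lambda>t. G (const_coeff t))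
        (\<lambda>t. tangent F (G (const_coeff t)) (H (const_coeff t))) \<rho>' \<tau>'"
      unfolding rank_decomposition_def
    proof (intro conjI ballI)
      show "curve UNIV (madic l) \<rho>'"
        unfolding \<rho>'_def
          by (rule curve_scale) (use dec in \<open>auto simp: rank_decomposition_def cscale_in_madic\<close>)
      show "curve UNIV J \<tau>'"
        unfolding \<tau>'_def
        by (rule curve_scale) (use dec in \<open>auto simp: rank_decomposition_def cvec.subspace_scale[OF J]\<close>)
      fix t :: "(unit, 'n, 'k) cords"
      have "tangent F (G x) (cscale y c) = cscale y (tangent F (G x) c)" if "c \<in> madic l" for x y c
        using tangent_add_cscale[OF F G(1) zero_in_madic that, of x y]
          tangent_add_cscale[OF F G(1) zero_in_madic zero_in_madic, of x 1]
            by (simp add: cscale_def zero_fun_def[symmetric])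
      moreover have "\<zeta> (const_coeff t) = tangent F (G (const_coeff t)) (\<rho> t) + \<tau> t"
        using dec by (simp add: rank_decomposition_def)
      ultimately show "tangent F (G (const_coeff t)) (H (const_coeff t)) =
          tangent F (G (const_coeff t)) (\<rho>' t) + \<tau>' t"
        by (simp add: T\<zeta> \<rho>'_def \<tau>'_def \<rho> cvec.scale_right_distrib)
    qed
    moreover have "rank_decomposition UNIV (madic l) J F (\<lambda>t. G (const_coeff t))
        (\<lambda>t. tangent F (G (const_coeff t)) (H (const_coeff t))) (\<lambda>t. H (const_coeff t)) (\<lambda>t. 0)"
      unfolding rank_decomposition_def using cH c0 by simp
    \<comment> \<open>The trivial decomposition has second summand 0, so uniqueness annihilates
      \<open>\<tau>'\<close>.\<close>
    ultimately have \<tau>'0: "\<tau>' t = 0" for t using rank'[OF cT] by blast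
    \<comment> \<open>\<open>K x\<close> is the constant cord \<open>x\<close>. On constant cords
      \<open>\<tau>\<close> is polynomial in \<open>x\<close>, so its vanishing off 0 extends to
      0.\<close>
    define K :: "'k \<Rightarrow> (unit, 'n, 'k) cords" where "K x = (\<lambda>_ \<beta>. if \<beta> = (\<lambda>_. 0) then x else 0)" for x
    have c\<tau>: "textile_on (madic 0) \<tau>" using dec by (simp add: rank_decomposition_def curve_def)
    have K: "K x i \<beta> = poly (if \<beta> = (\<lambda>_. 0) then [:0, 1:] else 0) x" for x i \<beta> by (simp add: K_def)
    have K': "K x \<in> madic 0" for x by simp
    obtain \<Psi> where \<Psi>: "\<forall>x j \<alpha>. \<tau> (K x) j \<alpha> = poly (\<Psi> j \<alpha>) x" by (rule textile_curve[OF c\<tau> K' K])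
    have KK: "const_coeff (K x) = x" for x by (simp add: const_coeff_def K_def)
    have "\<Psi> j \<alpha> = 0" for j \<alpha>
    proof (rule poly_eq_0_if_zero_off_0)
      fix x :: 'k assume "x \<noteq> 0"
      then show "poly (\<Psi> j \<alpha>) x = 0"
        using fun_cong[OF fun_cong[OF \<tau>'0[of "K x"]], of j \<alpha>] \<Psi> by (simp add: \<tau>'_def KK cscale_def)
    qed
    then have "\<tau> (K 0) = 0" using \<Psi> by (simp add: fun_eq_iff)
    then have "\<zeta> 0 = tangent F 0 (\<rho> (K 0))"
      using dec G(3) by (simp add: rank_decomposition_def KK)
        (metis G0 KK add.right_neutral)
    then have \<pi>\<zeta>: "\<pi> (\<zeta> 0) = \<zeta> 0" using \<pi>(3)[OF \<rho>] by simp
    have \<zeta>': "\<zeta> x \<in> madic 0" "\<zeta> x j \<alpha> = poly (z j \<alpha>) x" for x j \<alpha> by (simp_all add: \<zeta>_def)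
    have \<pi>': "textile_on (madic 0) \<pi>" using \<pi>(1) by simp
    obtain \<Phi> where \<Phi>: "\<forall>x j \<alpha>. \<pi> (\<zeta> x) j \<alpha> = poly (\<Phi> j \<alpha>) x" by (rule textile_curve[OF \<pi>' \<zeta>'])
    have "\<Phi> j \<alpha> = 0" for j \<alpha>
    proof (rule poly_eq_0_if_zero_off_0)
      fix x :: 'k assume x: "x \<noteq> 0"
      have "cscale (x ^ r) (\<pi> (\<zeta> x)) = 0"
        using \<pi>0[of x] unfolding T\<zeta> linear_on_cords_cscale[OF \<pi>(2) UNIV_I] .
      then show "poly (\<Phi> j \<alpha>) x = 0"
        using x \<Phi> by (auto simp: fun_eq_iff cscale_def)
    qed
    then have "\<pi> (\<zeta> 0) = 0" using \<Phi> by (simp add: fun_eq_iff)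
    then show False using \<pi>\<zeta> \<zeta>0 by simp
  qed
  then show ?thesis using Z by (simp add: fun_eq_iff)
qed

text \<open>On the line through \<open>b\<close> in direction \<open>v\<close> the derivative of
  \<open>g\<close> vanishes identically, and in characteristic 0 a polynomial with zero derivative
  is constant.\<close>

lemma constant_if_tangent_zero:
  fixes g :: "('m::finite, 'n::finite, 'k::field_char_0) cords \<Rightarrow> ('p, 'n, 'k) cords"
  assumes g: "textile_on (madic l) g" and bv: "b \<in> madic l" "v \<in> madic l"
    and zero: "\<And>t. tangent g (b + cscale t v) v = 0"
  shows "g (b + v) = g b"
proof -
  obtain \<Psi> where \<Psi>: "\<forall>t j \<alpha>. g (b + cscale t v) j \<alpha> = poly (\<Psi> j \<alpha>) t"
    by (rule textile_line[OF g bv])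
  have "pderiv (\<Psi> j \<alpha>) = 0" for j \<alpha>
  proof -
    have "poly (pderiv (\<Psi> j \<alpha>)) t = 0" for t
    proof -
      have shift: "b + cscale t v + cscale x v = b + cscale (t + x) v" for x
        by (simp add: cscale_def fun_eq_iff algebra_simps)
      \<comment> \<open>Recentring at \<open>t\<close> turns the linear coefficient into the
        derivative at \<open>t\<close>.\<close>
      have "g (b + cscale t v + cscale x v) j \<alpha> = poly (pcompose (\<Psi> j \<alpha>) [:t, 1:]) x" for x
        unfolding shift using \<Psi> by (simp add: poly_pcompose)
      from tangent_eqI[of g, OF this] have "coeff (pcompose (\<Psi> j \<alpha>) [:t, 1:]) 1 = 0"
        by (simp add: zero)
      then have "poly (pderiv (pcompose (\<Psi> j \<alpha>) [:t, 1:])) 0 = 0"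
        by (simp add: poly_0_coeff_0 coeff_pderiv)
      then show ?thesis by (simp add: pderiv_pcompose poly_pcompose pderiv_pCons)
    qed
    then show ?thesis using poly_all_0_iff_0 by blast
  qed
  then have deg: "degree (\<Psi> j \<alpha>) = 0" for j \<alpha> by (simp add: pderiv_eq_0_iff)
  have "poly (\<Psi> j \<alpha>) 1 = poly (\<Psi> j \<alpha>) 0" for j \<alpha>
    by (rule degree_eq_zeroE[OF deg[of j \<alpha>]]) simp
  moreover have "b + cscale 1 v = b + v" "b + cscale 0 v = b"
    by (simp_all add: cscale_def fun_eq_iff)
  ultimately show ?thesis
    using \<Psi>[THEN spec, of 1] \<Psi>[THEN spec, of 0] by (simp add: fun_eq_iff)
qed

text \<open>For a point \<open>a\<close> on the line through \<open>b\<close>, the path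
  \<open>w (cscale t a)\<close> starts at 0 and reaches \<open>w a\<close> at \<open>t = 1\<close>.
  The derivative of \<open>F (w c)\<close> in direction \<open>v\<close> is killed by
  \<open>\<pi>\<close> all along it, since \<open>\<pi> (F (w c))\<close> is linear in
  \<open>c\<close> with \<open>v\<close> in its kernel. Transversality along this path makes the
  derivative vanish at \<open>a\<close>.\<close>

lemma constant_rank_fibres:
  fixes F :: "('m::finite, 'n::finite, 'k::field_char_0) cords \<Rightarrow> ('p::finite, 'n, 'k) cords"
    and w :: "('m, 'n, 'k) cords \<Rightarrow> ('m, 'n, 'k) cords"
  assumes rank: "constant_rank_at_0 (madic l) J F"
    and F: "textile_on (madic l) F"
    and w: "textile_on (madic l) w" "\<And>c. c \<in> madic l \<Longrightarrow> w c \<in> madic l" "w 0 = 0"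
    and \<pi>: "textile_on UNIV \<pi>" "linear_on_cords UNIV \<pi>"
      "\<And>c. c \<in> madic l \<Longrightarrow> \<pi> (tangent F 0 c) = tangent F 0 c"
    and lin: "linear_on_cords (madic l) (tangent F 0)"
    and \<pi>F: "\<And>b. b \<in> madic l \<Longrightarrow> \<pi> (F (w b)) = tangent F 0 b"
    and bv: "b \<in> madic l" "v \<in> madic l" "tangent F 0 v = 0"
  shows "F (w (b + v)) = F (w b)"
proof (rule constant_if_tangent_zero[OF _ bv(1,2)])
  show g: "textile_on (madic l) (\<lambda>c. F (w c))"
    by (rule textile_on_comp[OF w(1) F w(2)])
  fix x
  define a where "a = b + cscale x v"
  have a: "a \<in> madic l" unfolding a_def by (intro add_in_madic cscale_in_madic bv)
  have A: "cscale t a \<in> madic l" "cscale t a i \<beta> = poly [:0, a i \<beta>:] t" for t i \<beta>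
    by (rule cscale_in_madic[OF a]) (simp add: cscale_def)
  have vp: "v \<in> madic l" "v i \<beta> = poly [:v i \<beta>:] t" for t i \<beta> using bv(2) by simp_all
  obtain \<gamma> where \<gamma>: "\<forall>t i \<beta>. w (cscale t a) i \<beta> = poly (\<gamma> i \<beta>) t"
    by (rule textile_curve[OF w(1) A])
  obtain h where h: "\<forall>t i \<beta>. tangent w (cscale t a) v i \<beta> = poly (h i \<beta>) t"
    by (rule tangent_poly_curve[OF w(1) A vp])
  have T: "tangent F (w (cscale t a)) (tangent w (cscale t a) v) =
      tangent (\<lambda>c. F (w c)) (cscale t a) v" for t
    by (rule tangent_comp(1)[OF w(1) F w(2) A(1) bv(2), symmetric])
  have \<pi>': "textile_on (madic 0) \<pi>" using \<pi>(1) by simp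
  have \<pi>_lin: "tangent \<pi> c d = \<pi> d" for c d
    by (rule tangent_linear)
       (simp add: linear_on_cords_add[OF \<pi>(2)] linear_on_cords_cscale[OF \<pi>(2)])
  have "\<pi> (tangent (\<lambda>c. F (w c)) (cscale t a) v) = 0" for t
  proof -
    have "\<pi> (tangent (\<lambda>c. F (w c)) (cscale t a) v) =
        tangent (\<lambda>c. \<pi> (F (w c))) (cscale t a) v"
      using tangent_comp(1)[OF g \<pi>' _ A(1) bv(2)] by (simp add: \<pi>_lin)
    also have "\<dots> = tangent F 0 v"
    proof (intro ext)
      fix j \<alpha>
      have "\<pi> (F (w (cscale t a + cscale y v))) j \<alpha> =
          poly [:tangent F 0 (cscale t a) j \<alpha>, tangent F 0 v j \<alpha>:] y" for y
        using A(1)[of t] bv(2)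
        by (simp add: \<pi>F add_in_madic cscale_in_madic linear_on_cords_add[OF lin]
              linear_on_cords_cscale[OF lin]) (simp add: cscale_def)
      from tangent_eqI[of "\<lambda>c. \<pi> (F (w c))", OF this]
      show "tangent (\<lambda>c. \<pi> (F (w c))) (cscale t a) v j \<alpha> = tangent F 0 v j \<alpha>" by simp
    qed
    finally show ?thesis using bv(3) by simp
  qed
  then have \<pi>0: "\<pi> (tangent F (w (cscale t a)) (tangent w (cscale t a) v)) = 0" for t
    by (simp only: T)
  have wm: "w (cscale t a) \<in> madic l" for t by (intro w(2) A(1))
  have wp: "w (cscale t a) i \<beta> = poly (\<gamma> i \<beta>) t" for t i \<beta> using \<gamma> by blast
  have w0: "w (cscale 0 a) = 0" using w(3) by (simp add: cscale_def zero_fun_def)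
  have tm: "tangent w (cscale t a) v \<in> madic l" for t
    by (rule tangent_comp(2)[OF w(1) F w(2) A(1) bv(2)])
  have tp: "tangent w (cscale t a) v i \<beta> = poly (h i \<beta>) t" for t i \<beta> using h by blast
  from constant_rank_transversal[OF rank \<pi> F wm wp w0 tm tp \<pi>0, of 1]
  have "tangent (\<lambda>c. F (w c)) (cscale 1 a) v = 0" by (simp only: T)
  moreover have "cscale 1 a = a" by (simp add: cscale_def)
  ultimately show "tangent (\<lambda>c. F (w c)) (b + cscale x v) v = 0" by (simp add: a_def)
qed

section \<open>Linearisation of families of constant rank\<close>

lemma nbhd0_madic: "nbhd0 (madic l :: ('m::finite, 'n::finite, 'k::comm_ring_1) cords set)"
  unfolding nbhd0_def openin_madic_topology
  by (rule exI[of _ "madic l"]) (use add_in_madic zero_in_madic in blast)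

theorem theorem4p5:
  fixes S :: "('q::finite \<Rightarrow> 'k::field_char_0) set"
    and l :: nat
    and U :: "('m::finite, 'n::finite, 'k) cords set"
    and f ell h :: "('q \<Rightarrow> 'k) \<Rightarrow> ('m, 'n, 'k) cords \<Rightarrow> ('p::finite, 'n, 'k) cords"
    and J :: "('p, 'n, 'k) cords set"
  assumes "constructible S"
    and "U = madic l"
    and "regular_family S U f"
    and "ell = (\<lambda>s. tangent (f s) 0)"
    and "h = (\<lambda>s c. f s c - ell s c)"
    and "\<forall>s\<in>S. f s 0 = 0"
    and "\<exists>\<sigma>. scission S U ell \<sigma> \<and> contractive_family S U (\<lambda>s c. \<sigma> s (h s c))"
    and "constant_rank_family S U J f"
  shows "\<exists>A B C D u u_inv v v_inv.
           nbhd0 A \<and> nbhd0 B \<and> A \<subseteq> U \<and> B \<subseteq> U \<and> regular_inverse_families S A B u u_inv \<and>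
           nbhd0 C \<and> nbhd0 D \<and> regular_inverse_families S C D v v_inv \<and>
           (\<forall>s\<in>S. \<forall>b\<in>B. f s (u_inv s b) \<in> C \<and> v s (f s (u_inv s b)) = ell s b)"
proof -
  obtain \<sigma> where sci: "scission S U ell \<sigma>" and contr: "contractive_family S U (\<lambda>s c. \<sigma> s (h s c))"
    using assms(7) by blast
  note U = assms(2)
  have f: "polyfam S U f" using polyfam_if_regular_family assms(3) unfolding U by blast
  have ell: "polyfam S U ell" unfolding assms(4) U using f unfolding U by (rule polyfam_tangent_0)
  have h: "polyfam S U h" unfolding assms(5) by (rule polyfam_diff[OF f ell])
  \<comment> \<open>\<open>madic 0\<close> is the whole cord space, so the reduction to normal form
    applies to the scission.\<close>
  have "regular_family S (madic 0) \<sigma>" using sci by (simp add: scission_def)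
  then have \<sigma>: "polyfam S UNIV \<sigma>" using polyfam_if_regular_family by fastforce
  have \<sigma>_lin: "linear_on_cords UNIV (\<sigma> s)" and \<sigma>U: "\<sigma> s y \<in> U"
    and \<sigma>_sci: "c \<in> U \<Longrightarrow> ell s (\<sigma> s (ell s c)) = ell s c" if "s \<in> S" for s y c
    using sci that unfolding scission_def by auto
  define N where "N s c = \<sigma> s (h s c)" for s c
  have N: "polyfam S U N" unfolding N_def by (rule polyfam_comp[OF \<sigma> h]) simp
  have NU: "N s c \<in> U" if "s \<in> S" for s c unfolding N_def by (rule \<sigma>U[OF that])
  have contr: "contractive_family S (madic l) N" using contr unfolding N_def U .
  obtain w where wfam: "polyfam S U w"
    and w: "\<forall>s\<in>S. \<forall>y\<in>U. w s y \<in> U \<and> w s y + N s (w s y) = y"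
    and w': "\<forall>s\<in>S. \<forall>a\<in>U. w s (a + N s a) = a"
    using contractive_inverse[OF N[unfolded U] NU[unfolded U] contr] unfolding U by blast
  have ell_lin: "linear_on_cords U (ell s)" if "s \<in> S" for s
  proof -
    have t: "textile_on (madic l) (f s)" using polyfam_textile_on[OF f that] unfolding U .
    have T: "ell s (a + cscale r b) = ell s a + cscale r (ell s b)" if "a \<in> U" "b \<in> U" for a b r
      using that tangent_add_cscale[OF t zero_in_madic, of a b r] unfolding U assms(4) by blast
    have "cscale 1 b = b" "0 + cscale r b = cscale r b" for r and b :: "('m, 'n, 'k) cords"
      by (simp_all add: cscale_def fun_eq_iff)
    moreover have "cscale 1 b = b" "0 + cscale r b = cscale r b" for r and b :: "('p, 'n, 'k) cords"
      by (simp_all add: cscale_def fun_eq_iff)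
    moreover have "ell s 0 = 0" using T[of 0 0 1] unfolding U
      by (simp add: zero_in_madic calculation)
    ultimately show ?thesis
      using T[of _ _ 1] T[of 0] zero_in_madic unfolding linear_on_cords_def U by metis
  qed
  define P where "P s y = ell s (\<sigma> s y)" for s y
  have Pfam: "polyfam S UNIV P" unfolding P_def by (rule polyfam_comp[OF ell \<sigma>]) (rule \<sigma>U)
  have P_lin: "linear_on_cords UNIV (P s)" if "s \<in> S" for s
    using linear_on_cords_add[OF \<sigma>_lin[OF that]] linear_on_cords_cscale[OF \<sigma>_lin[OF that]]
      linear_on_cords_add[OF ell_lin[OF that]] linear_on_cords_cscale[OF ell_lin[OF that]]
    by (simp add: linear_on_cords_def P_def \<sigma>U[OF that])
  have P_ell: "P s (ell s c) = ell s c" if "s \<in> S" "c \<in> U" for s c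
    unfolding P_def by (rule \<sigma>_sci[OF that])
  have PP: "P s (P s y) = P s y" if "s \<in> S" for s y
    using P_ell[OF that \<sigma>U[OF that]] by (simp add: P_def)
  define g where "g s b = f s (w s b)" for s b
  have gfam: "polyfam S U g" unfolding g_def by (rule polyfam_comp[OF f wfam]) (use w in blast)
  have Pg: "P s (g s b) = ell s b" if s: "s \<in> S" and b: "b \<in> U" for s b
  proof -
    let ?a = "w s b"
    have a: "?a \<in> U" "?a + N s ?a = b" using w s b by auto
    \<comment> \<open>Apply \<open>ell s\<close> to the equation
      \<open>w s b + N s (w s b) = b\<close>.\<close>
    have "ell s b = ell s ?a + P s (h s ?a)"
      using linear_on_cords_add[OF ell_lin[OF s] a(1) NU[OF s], of ?a] a(2)
        by (simp add: N_def P_def)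
    moreover have "f s ?a = h s ?a + ell s ?a" by (simp add: assms(5))
    then have "P s (g s b) = P s (h s ?a) + ell s ?a"
      using linear_on_cords_add[OF P_lin[OF s], of "h s ?a" "ell s ?a"] P_ell[OF s a(1)]
      by (simp add: g_def)
    ultimately show ?thesis by (simp add: add.commute)
  qed
  have zU: "0 \<in> U" unfolding U by (rule zero_in_madic)
  \<comment> \<open>The path used on the fibres must start at 0, as the curves in constant rank
    do.\<close>
  have w0: "w s 0 = 0" if s: "s \<in> S" for s
  proof -
    have "N s 0 = 0"
      using assms(6) s linear_on_cords_0[OF ell_lin[OF s] zU] linear_on_cords_0[OF \<sigma>_lin[OF s]]
      by (simp add: N_def assms(5))
    then show ?thesis using w' s zU by force
  qed
  have fibre: "g s (b + c) = g s b" if s: "s \<in> S" and bc: "b \<in> U" "c \<in> U" "ell s c = 0" for s b c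
    unfolding g_def
  proof (rule constant_rank_fibres[of l J "f s" "w s" "P s"])
    show "constant_rank_at_0 (madic l) J (f s)"
      using assms(8) s by (simp add: constant_rank_family_def U)
    show "textile_on (madic l) (f s)" using polyfam_textile_on[OF f s] unfolding U .
    show "textile_on (madic l) (w s)" using polyfam_textile_on[OF wfam s] unfolding U .
    show "textile_on UNIV (P s)" by (rule polyfam_textile_on[OF Pfam s])
    show "linear_on_cords (madic l) (tangent (f s) 0)" using ell_lin[OF s] unfolding assms(4) U .
    show "w s c \<in> madic l" if "c \<in> madic l" for c using w s that unfolding U by blast
    show "P s (tangent (f s) 0 c) = tangent (f s) 0 c" if "c \<in> madic l" for c
      using P_ell[OF s, of c] that unfolding U assms(4) by blast
    show "P s (f s (w s b)) = tangent (f s) 0 b" if "b \<in> madic l" for b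
      using Pg[OF s, of b] that unfolding U assms(4) g_def by blast
    show "tangent (f s) 0 c = 0" using bc(3) unfolding assms(4) .
  qed (use w0[OF s] P_lin[OF s] bc in \<open>simp_all add: U\<close>)
  define D where "D s y = g s (\<sigma> s y) - P s (g s (\<sigma> s y))" for s y
  have Dfam: "polyfam S UNIV D"
    unfolding D_def
    by (intro polyfam_diff polyfam_comp[OF gfam \<sigma>] polyfam_comp[OF Pfam polyfam_comp[OF gfam \<sigma>]]) (simp_all add: \<sigma>U)
  have scale: "cscale (-1) y = - y" for y :: "('p, 'n, 'k) cords"
    by (simp add: cscale_def fun_eq_iff)
  \<comment> \<open>\<open>\<sigma>\<close> carries the kernel of \<open>P\<close> into the kernel
    of \<open>ell\<close>, along which \<open>g\<close> is constant.\<close>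
  have D_shift: "D s (y + z) = D s y" if s: "s \<in> S" and z: "P s z = 0" for s y z
    using fibre[OF s \<sigma>U[OF s] \<sigma>U[OF s], of z y] z linear_on_cords_add[OF \<sigma>_lin[OF s], of y z]
    by (simp add: D_def P_def)
  have P_minus: "P s (- y) = - P s y" if "s \<in> S" for s y
    using linear_on_cords_cscale[OF P_lin[OF that] UNIV_I, of "-1" y] by (simp add: scale)
  have PD: "P s (D s y) = 0" if s: "s \<in> S" for s y
    using linear_on_cords_add[OF P_lin[OF s] UNIV_I UNIV_I, of "g s (\<sigma> s y)" "- P s (g s (\<sigma> s y))"]
    by (simp add: D_def P_minus[OF s] PP[OF s])
  have Dg: "D s (g s b) = g s b - ell s b" if s: "s \<in> S" and b: "b \<in> U" for s b
  proof -
    \<comment> \<open>By \<open>Pg\<close>, \<open>\<sigma> s (g s b)\<close> and \<open>b\<close>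
      have the same image under \<open>ell s\<close>, so \<open>g\<close> takes the same value at
      both.\<close>
    let ?c = "\<sigma> s (g s b) - b"
    have c: "?c \<in> U" using \<sigma>U[OF s, of "g s b"] b unfolding U by (rule diff_in_madic)
    have "ell s (b + ?c) = ell s b" using Pg[OF s b] by (simp add: P_def)
    then have "ell s ?c = 0" using linear_on_cords_add[OF ell_lin[OF s] b c] by simp
    from fibre[OF s b c this] have "g s (\<sigma> s (g s b)) = g s b" by simp
    then show ?thesis using Pg[OF s b] by (simp add: D_def)
  qed
  define v where "v s y = y - D s y" for s y
  define v' where "v' s y = y + D s y" for s y
  have vfam: "polyfam S UNIV v" unfolding v_def by (rule polyfam_diff[OF polyfam_id Dfam])
  have v'fam: "polyfam S UNIV v'" unfolding v'_def by (rule polyfam_add[OF polyfam_id Dfam])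
  \<comment> \<open>\<open>D\<close> takes values in the kernel of \<open>P\<close> and is unchanged
    by shifts along it, so \<open>y\<close>, \<open>v s y\<close> and \<open>v' s y\<close> all have
    the same correction \<open>D\<close>.\<close>
  have vv': "v s (v' s y) = y" "v' s (v s y) = y" if s: "s \<in> S" for s y
    using D_shift[OF s PD[OF s], of y y] D_shift[OF s, of "- D s y" y] PD[OF s, of y]
    by (simp_all add: v_def v'_def P_minus[OF s])
  define u where "u s a = a + N s a" for s a
  have ufam: "polyfam S U u" unfolding u_def by (rule polyfam_add[OF polyfam_id N])
  have uU: "u s a \<in> U" if "s \<in> S" "a \<in> U" for s a
    using that(2) NU[OF that(1)] unfolding u_def U by (rule add_in_madic)
  have "regular_inverse_families S U U u w"
    unfolding regular_inverse_families_def
    using w w' uU regular_family_if_polyfam[OF ufam] regular_family_if_polyfam[OF wfam]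
    by (simp add: u_def)
  moreover have "regular_inverse_families S UNIV UNIV v v'"
    unfolding regular_inverse_families_def
    using vv' regular_family_if_polyfam[OF vfam] regular_family_if_polyfam[OF v'fam] by simp
  moreover have "nbhd0 U" unfolding U by (rule nbhd0_madic)
  moreover have "nbhd0 (UNIV :: ('p, 'n, 'k) cords set)" using nbhd0_madic[of 0] by simp
  moreover have "\<forall>s\<in>S. \<forall>b\<in>U. f s (w s b) \<in> UNIV \<and> v s (f s (w s b)) = ell s b"
    using Dg by (simp add: v_def flip: g_def)
  \<comment> \<open>No shrinking occurs: \<open>u\<close> is invertible on all of \<open>U\<close>,
    and \<open>v\<close> on the whole target space.\<close>
  ultimately show ?thesis
    by (intro exI conjI) (assumption | rule order_refl)+
qed

end
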